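(* Let $T>0$, let $d,k,m\in\mathbb{N}$, and let $(\Omega,\mathcal{F},\mathbb{P})$ be a fixed probability space. For each $n\in\mathbb{N}$, let $W_n$ be an $\mathbb{R}^k$-valued Wiener process on a filtered probability space $(\Omega,\mathcal{F},\{\mathcal{F}^n_t\}_{t\in[0,T]},\mathbb{P})$, and let $W$ be an $\mathbb{R}^k$-valued Wiener process on a filtered probability space $(\Omega,\mathcal{F},\{\mathcal{F}_t\}_{t\in[0,T]},\mathbb{P})$. Suppose $p>2$ and $1\le r<p$. For each $n$, let $V_n$ be an $L^1(\mathbb{T}^d;\mathbb{R}^{m\times k})$-valued $\{\mathcal{F}^n_t\}$-predictable process, and let $V$ be an $L^1(\mathbb{T}^d;\mathbb{R}^{m\times k})$-valued $\{\mathcal{F}_t\}$-predictable process, such that $$V_n\rightharpoonup V\ \text{ weakly in } L^r([0,T]\times\mathbb{T}^d;\mathbb{R}^{m\times k}),\ \mathbb{P}\text{-almost surely},$$ $$\sup_n\mathbb{E}\,\|V_n\|^p_{L^p([0,T];L^1(\mathbb{T}^d;\mathbb{R}^{m\times k}))}<\infty.$$ Suppose further that $W_n\to W$ in $C([0,T];\mathbb{R}^k)$, $\mathbb{P}$-almost surely. Fix $q>d/2$, and suppose that for a given $\beta\in H^q(\mathbb{T}^d)$, $$\mathbb{E}\int_h^T\Big|\int_{\mathbb{T}^d}\beta(x)\big(V_n(t)-V_n(t-h)\big)\,\mathrm{d}x\Big|\,\mathrm{d}t\longrightarrow0\quad\text{as } h\downarrow0,\ \text{uniformly in } n.$$ Then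 for every $t\in[0,T]$, $$\int_0^t\int_{\mathbb{T}^d}\beta\,V_n\,\mathrm{d}x\,\mathrm{d}W_n\longrightarrow\int_0^t\int_{\mathbb{T}^d}\beta\,V\,\mathrm{d}x\,\mathrm{d}W\quad\text{strongly in } L^2(\Omega;\mathbb{R}^m)\text{ as } n\to\infty.$$
   Context: $\mathbb{T}^d$ is the $d$-dimensional torus and $H^q(\mathbb{T}^d)$ is the usual $L^2$-based Sobolev space. $\int_{\mathbb{T}^d}\beta V_n\,\mathrm{d}x$ is computed entrywise and is an $\mathbb{R}^{m\times k}$-valued process; the stochastic integral is the $\mathbb{R}^m$-valued Itô integral. *)

theory Defs
  imports "HOL-Probability.Probability"
begin

section \<open>Lebesgue spaces\<close>

text \<open>
  Elements of \<open>L\<^sup>p(\<mu>; 'b)\<close>, \<open>1 \<le> p < \<infinity>\<close>, are given by representatives; every notion below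
  depends only on the almost-everywhere classes.
\<close>

definition Lp_space :: "real \<Rightarrow> 'x measure \<Rightarrow> ('x \<Rightarrow> 'b::euclidean_space) set" where
  "Lp_space p \<mu> = {f \<in> borel_measurable \<mu>. integrable \<mu> (\<lambda>x. norm (f x) powr p)}"

definition Lp_norm :: "real \<Rightarrow> 'x measure \<Rightarrow> ('x \<Rightarrow> 'b::euclidean_space) \<Rightarrow> real" where
  "Lp_norm p \<mu> f = (\<integral>x. norm (f x) powr p \<partial>\<mu>) powr (1 / p)"

definition Lp_tendsto ::
  "real \<Rightarrow> 'x measure \<Rightarrow> (nat \<Rightarrow> 'x \<Rightarrow> 'b::euclidean_space) \<Rightarrow> ('x \<Rightarrow> 'b) \<Rightarrow> bool" where
  "Lp_tendsto p \<mu> f g \<longleftrightarrow>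
     (\<forall>n. f n \<in> Lp_space p \<mu>) \<and> g \<in> Lp_space p \<mu> \<and>
     (\<lambda>n. Lp_norm p \<mu> (\<lambda>x. f n x - g x)) \<longlonglongrightarrow> 0"

text \<open>
  Boundedness with respect to the seminorm \<^const>\<open>Lp_norm\<close> forces a functional to respect
  almost-everywhere equality, so these are exactly the elements of the dual of \<open>L\<^sup>p\<close>.
\<close>

definition Lp_dual :: "real \<Rightarrow> 'x measure \<Rightarrow> (('x \<Rightarrow> 'b::euclidean_space) \<Rightarrow> real) set" where
  "Lp_dual p \<mu> = {\<Lambda>.
     (\<forall>f \<in> Lp_space p \<mu>. \<forall>g \<in> Lp_space p \<mu>. \<Lambda> (\<lambda>x. f x + g x) = \<Lambda> f + \<Lambda> g) \<and>
     (\<forall>c. \<forall>f \<in> Lp_space p \<mu>. \<Lambda> (\<lambda>x. c *\<^sub>R f x) = c * \<Lambda> f) \<and>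
     (\<exists>C. \<forall>f \<in> Lp_space p \<mu>. \<bar>\<Lambda> f\<bar> \<le> C * Lp_norm p \<mu> f)}"

definition Lp_weak_tendsto ::
  "real \<Rightarrow> 'x measure \<Rightarrow> (nat \<Rightarrow> 'x \<Rightarrow> 'b::euclidean_space) \<Rightarrow> ('x \<Rightarrow> 'b) \<Rightarrow> bool" where
  "Lp_weak_tendsto p \<mu> f g \<longleftrightarrow>
     (\<forall>n. f n \<in> Lp_space p \<mu>) \<and> g \<in> Lp_space p \<mu> \<and>
     (\<forall>\<Lambda> \<in> Lp_dual p \<mu>. (\<lambda>n. \<Lambda> (f n)) \<longlonglongrightarrow> \<Lambda> g)"

text \<open>
  The Borel sigma-algebra of \<open>L\<^sup>p\<close>. Open sets of the seminorm topology are saturated for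
  almost-everywhere equality, so this is the Borel sigma-algebra of the quotient space,
  pulled back to representatives.
\<close>

definition Lp_borel :: "real \<Rightarrow> 'x measure \<Rightarrow> ('x \<Rightarrow> 'b::euclidean_space) measure" where
  "Lp_borel p \<mu> = sigma (Lp_space p \<mu>)
     {U. U \<subseteq> Lp_space p \<mu> \<and>
         (\<forall>f\<in>U. \<exists>e>0. \<forall>g \<in> Lp_space p \<mu>. Lp_norm p \<mu> (\<lambda>x. g x - f x) < e \<longrightarrow> g \<in> U)}"

section \<open>The torus and its Sobolev spaces\<close>

abbreviation lborel_on :: "'b::euclidean_space set \<Rightarrow> 'b measure" where
  "lborel_on S \<equiv> restrict_space lborel S"

text \<open>The torus is \<open>\<real>\<^sup>d / \<int>\<^sup>d\<close>, realised as its fundamental cell with Lebesgue measure.\<close>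

definition torus :: "(real ^ 'd::finite) measure" where
  "torus = lborel_on {x. \<forall>i. 0 \<le> x $ i \<and> x $ i < 1}"

definition fourier_coeff :: "(real ^ 'd::finite \<Rightarrow> real) \<Rightarrow> int ^ 'd \<Rightarrow> complex" where
  "fourier_coeff f \<kappa> =
     (\<integral>x. complex_of_real (f x) * cis (- 2 * pi * (\<Sum>i\<in>UNIV. of_int (\<kappa> $ i) * x $ i)) \<partial>torus)"

text \<open>Real-valued \<open>H\<^sup>q(\<bbbT>\<^sup>d)\<close> for real \<open>q \<ge> 0\<close>.\<close>

definition sobolev :: "real \<Rightarrow> (real ^ 'd::finite \<Rightarrow> real) set" where
  "sobolev q = {f \<in> Lp_space 2 torus.
     (\<lambda>\<kappa>. (1 + (\<Sum>i\<in>UNIV. (of_int (\<kappa> $ i))\<^sup>2)) powr q * (cmod (fourier_coeff f \<kappa>))\<^sup>2)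
       summable_on UNIV}"

text \<open>
  A function \<open>v\<close> of \<open>(t, x)\<close> represents the path \<open>t \<mapsto> V t\<close> of almost-everywhere classes. The
  function \<open>\<lambda>(t, x). V t x\<close> itself need not be jointly measurable, because the representatives
  \<open>V t\<close> are chosen separately for each \<open>t\<close>.
\<close>

definition space_time_version ::
  "real \<Rightarrow> (real \<times> (real ^ 'd::finite) \<Rightarrow> 'b) \<Rightarrow> (real \<Rightarrow> real ^ 'd \<Rightarrow> 'b) \<Rightarrow> bool" where
  "space_time_version T v V \<longleftrightarrow>
     (AE t in lborel_on {0..T}. AE x in torus. v (t, x) = V t x)"

section \<open>Filtrations, predictable processes and Wiener processes on \<open>[0,T]\<close>\<close>

definition filtration_on :: "'a measure \<Rightarrow> real \<Rightarrow> (real \<Rightarrow> 'a measure) \<Rightarrow> bool" where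
  "filtration_on M T F \<longleftrightarrow>
     (\<forall>t\<in>{0..T}. subalgebra M (F t)) \<and>
     (\<forall>s t. 0 \<le> s \<and> s \<le> t \<and> t \<le> T \<longrightarrow> sets (F s) \<subseteq> sets (F t))"

definition predictable_sigma :: "'a measure \<Rightarrow> real \<Rightarrow> (real \<Rightarrow> 'a measure) \<Rightarrow> (real \<times> 'a) measure"
  where
  "predictable_sigma M T F = sigma ({0..T} \<times> space M)
     ({{0} \<times> A | A. A \<in> sets (F 0)} \<union>
      {{s<..t} \<times> A | s t A. 0 \<le> s \<and> s < t \<and> t \<le> T \<and> A \<in> sets (F s)})"

text \<open>
  The density below is that of the centred Gaussian on \<open>\<real>\<^sup>k\<close> with covariance \<open>(t - s) I\<close>;
  \<^const>\<open>normal_density\<close> takes the standard deviation.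
\<close>

definition wiener_process ::
  "'a measure \<Rightarrow> real \<Rightarrow> (real \<Rightarrow> 'a measure) \<Rightarrow> (real \<Rightarrow> 'a \<Rightarrow> real ^ 'k::finite) \<Rightarrow> bool" where
  "wiener_process M T F W \<longleftrightarrow>
     (\<forall>t\<in>{0..T}. W t \<in> borel_measurable (F t)) \<and>
     (AE \<omega> in M. W 0 \<omega> = 0) \<and>
     (AE \<omega> in M. continuous_on {0..T} (\<lambda>t. W t \<omega>)) \<and>
     (\<forall>s t. 0 \<le> s \<and> s < t \<and> t \<le> T \<longrightarrow>
        distributed M lborel (\<lambda>\<omega>. W t \<omega> - W s \<omega>)
          (\<lambda>y. ennreal (\<Prod>i\<in>UNIV. normal_density 0 (sqrt (t - s)) (y $ i))) \<and>
        prob_space.indep_set M (sets (F s))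
          {(\<lambda>\<omega>. W t \<omega> - W s \<omega>) -` B \<inter> space M | B. B \<in> sets borel})"

section \<open>The It\^o integral\<close>

text \<open>
  A triple \<open>(N, \<tau>, \<xi>)\<close> encodes the elementary integrand
  \<open>\<Sum>i<N. \<xi> i \<cdot> 1\<^bsub>(\<tau> i, \<tau> (i+1)]\<^esub>\<close> on \<open>[0,t]\<close>.
\<close>

definition elementary_process ::
  "'a measure \<Rightarrow> (real \<Rightarrow> 'a measure) \<Rightarrow> real \<Rightarrow>
   nat \<Rightarrow> (nat \<Rightarrow> real) \<Rightarrow> (nat \<Rightarrow> 'a \<Rightarrow> real ^ 'k::finite ^ 'm::finite) \<Rightarrow> bool" where
  "elementary_process M F t N \<tau> \<xi> \<longleftrightarrow>
     0 \<le> \<tau> 0 \<and> (\<forall>i<N. \<tau> i \<le> \<tau> (Suc i)) \<and> \<tau> N \<le> t \<and>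
     (\<forall>i<N. \<xi> i \<in> borel_measurable (F (\<tau> i)) \<and> (\<exists>C. \<forall>\<omega>\<in>space M. norm (\<xi> i \<omega>) \<le> C))"

definition elementary_value ::
  "nat \<Rightarrow> (nat \<Rightarrow> real) \<Rightarrow> (nat \<Rightarrow> 'a \<Rightarrow> real ^ 'k::finite ^ 'm::finite) \<Rightarrow>
   real \<Rightarrow> 'a \<Rightarrow> real ^ 'k ^ 'm" where
  "elementary_value N \<tau> \<xi> s \<omega> = (\<Sum>i<N. indicator {\<tau> i<..\<tau> (Suc i)} s *\<^sub>R \<xi> i \<omega>)"

definition elementary_integral ::
  "(real \<Rightarrow> 'a \<Rightarrow> real ^ 'k::finite) \<Rightarrow>
   nat \<Rightarrow> (nat \<Rightarrow> real) \<Rightarrow> (nat \<Rightarrow> 'a \<Rightarrow> real ^ 'k ^ 'm::finite) \<Rightarrow> 'a \<Rightarrow> real ^ 'm" where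
  "elementary_integral W N \<tau> \<xi> \<omega> = (\<Sum>i<N. \<xi> i \<omega> *v (W (\<tau> (Suc i)) \<omega> - W (\<tau> i) \<omega>))"

text \<open>
  \<open>J\<close> is (a version of) \<open>\<integral>\<^sub>0\<^sup>t \<phi> dW\<close>: for elementary integrands converging to \<open>\<phi>\<close> in
  \<open>L\<^sup>2([0,t] \<times> \<Omega>)\<close>, the elementary integrals converge to \<open>J\<close> in \<open>L\<^sup>2(\<Omega>)\<close>. By the It\^o
  isometry \<open>J\<close> is unique up to null sets and independent of the approximating sequence, and it
  exists for every predictable \<open>\<phi>\<close> in \<open>L\<^sup>2([0,t] \<times> \<Omega>)\<close>.
\<close>

definition has_ito_integral ::
  "'a measure \<Rightarrow> (real \<Rightarrow> 'a measure) \<Rightarrow> (real \<Rightarrow> 'a \<Rightarrow> real ^ 'k::finite) \<Rightarrow>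
   (real \<Rightarrow> 'a \<Rightarrow> real ^ 'k ^ 'm::finite) \<Rightarrow> real \<Rightarrow> ('a \<Rightarrow> real ^ 'm) \<Rightarrow> bool" where
  "has_ito_integral M F W \<phi> t J \<longleftrightarrow>
     (\<exists>N \<tau> \<xi>.
        (\<forall>j. elementary_process M F t (N j) (\<tau> j) (\<xi> j)) \<and>
        Lp_tendsto 2 (lborel_on {0..t} \<Otimes>\<^sub>M M)
          (\<lambda>j (s, \<omega>). elementary_value (N j) (\<tau> j) (\<xi> j) s \<omega>) (\<lambda>(s, \<omega>). \<phi> s \<omega>) \<and>
        Lp_tendsto 2 M (\<lambda>j. elementary_integral W (N j) (\<tau> j) (\<xi> j)) J)"

definition ito_integral ::
  "'a measure \<Rightarrow> (real \<Rightarrow> 'a measure) \<Rightarrow> (real \<Rightarrow> 'a \<Rightarrow> real ^ 'k::finite) \<Rightarrow>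
   (real \<Rightarrow> 'a \<Rightarrow> real ^ 'k ^ 'm::finite) \<Rightarrow> real \<Rightarrow> 'a \<Rightarrow> real ^ 'm" where
  "ito_integral M F W \<phi> t = (SOME J. has_ito_integral M F W \<phi> t J)"

end

theory Submission
  imports Defs
begin

text \<open>
  Since \<open>q > d/2\<close>, the Fourier series of \<open>\<beta>\<close> converges absolutely, so \<open>\<beta>\<close> is essentially bounded and
  \<open>X\<^sub>n = \<integral> \<beta> V\<^sub>n dx\<close> is a predictable process bounded in \<open>L\<^sup>p(\<Omega> \<times> [0,T])\<close>. Let \<open>Z\<^sub>n\<close> be the
  elementary process that on the interval \<open>(ih, (i+1)h]\<close> equals the truncated average of \<open>X\<^sub>n\<close> over the
  preceding interval. The translation estimate bounds \<open>X\<^sub>n - Z\<^sub>n\<close> in \<open>L\<^sup>1\<close>, and with the \<open>L\<^sup>p\<close>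
  bound, \<open>p > 2\<close>, in \<open>L\<^sup>2\<close>, uniformly in \<open>n\<close>. Weak lower semicontinuity passes both bounds on to
  \<open>X = \<integral> \<beta> V dx\<close>. By the \<open>L\<^sup>2\<close> bound for stochastic integrals it thus suffices to consider the
  stochastic integrals of \<open>Z\<^sub>n\<close> for fixed \<open>h\<close>. These are finite sums in which the averages converge
  almost surely by weak convergence and the increments of \<open>W\<^sub>n\<close> by uniform convergence, and they are
  bounded in \<open>L\<^sup>4(\<Omega>)\<close>.
\<close>

section \<open>Boundedness of Sobolev functions on the torus\<close>

text \<open>The obstacle is that \<open>Vn n\<close> converges only weakly and that the
  \<open>Fn n\<close> need not be related to \<open>F\<close>: the paired processes need not
  converge strongly, and none need be admissible as integrand for the Wiener process of another.
  Hence they are compared through integrands on one common grid. The average over a fixed interval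
  is a weakly continuous functional of the path, so it converges pathwise for fixed
  \<open>h\<close>; averaging over the preceding interval makes the value known at the left
  endpoint, for each filtration separately. Truncation at \<open>R\<close> makes the integrand
  bounded, as \<open>elementary_process\<close> demands, and it converts the mean error into a mean
  square error at the price of a factor \<open>R\<close> and a tail of order
  \<open>R powr (2 - p)\<close>; so \<open>R\<close> is fixed before \<open>h\<close>. Since
  \<open>V\<close> has only integrable values in \<open>x\<close>, the pairing asks for an
  essentially bounded \<open>\<beta>\<close>. That is obtained by duality, bounding the integral of
  \<open>\<beta>\<close> times \<open>P\<close> by a multiple of the integral of
  \<open>\<bar>P\<bar>\<close>, without summing the Fourier series. As \<open>ito_integral\<close>
  is a choice, the approximations must also supply the existence of every integral involved.\<close>

abbreviation cell :: "(real ^ 'd::finite) set" where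
  "cell \<equiv> {x. \<forall>i. 0 \<le> x $ i \<and> x $ i < 1}"

lemma cell_measurable: "(cell :: (real ^ 'd::finite) set) \<in> sets borel"
proof -
  have "cell = (\<Inter>i\<in>UNIV. {x :: real ^ 'd. 0 \<le> x $ i} \<inter> {x. x $ i < 1})" by auto
  also have "\<dots> \<in> sets borel"
    by (intro sets.finite_INT sets.Int borel_closed borel_open closed_halfspace_component_ge_cart open_halfspace_component_lt_cart)
      (auto simp: closed_Collect_le continuous_on_component open_Collect_less)
  finally show ?thesis .
qed

lemma space_torus [simp]: "space torus = cell"
  by (simp add: torus_def space_restrict_space)

lemma finite_measure_torus: "finite_measure (torus :: (real ^ 'd::finite) measure)"
proof (rule finite_measureI)
  have "cell \<subseteq> cbox 0 (1 :: real ^ 'd)" by (auto simp: mem_box_cart less_imp_le)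
  then have "emeasure lborel (cell :: (real ^ 'd) set) \<le> emeasure lborel (cbox 0 (1 :: real ^ 'd))"
    by (intro emeasure_mono) auto
  also have "\<dots> < \<infinity>" by (rule emeasure_lborel_cbox_finite)
  finally show "emeasure torus (space (torus :: (real ^ 'd) measure)) \<noteq> \<infinity>"
    by (simp add: torus_def emeasure_restrict_space cell_measurable space_restrict_space)
qed

section \<open>Characters and trigonometric polynomials on the torus\<close>

definition torus_char :: "int ^ 'd::finite \<Rightarrow> real ^ 'd \<Rightarrow> complex" where
  "torus_char \<kappa> x = cis (2 * pi * (\<Sum>i\<in>UNIV. of_int (\<kappa> $ i) * x $ i))"

lemma torus_char_add: "torus_char (\<kappa> + \<nu>) x = torus_char \<kappa> x * torus_char \<nu> x"
  by (simp add: torus_char_def cis_mult sum.distrib ring_distribs)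

lemma norm_torus_char [simp]: "norm (torus_char \<kappa> x) = 1"
  by (simp add: torus_char_def)

lemma torus_char_zero [simp]: "torus_char 0 x = 1"
  by (simp add: torus_char_def)

lemma continuous_on_torus_char: "continuous_on S (torus_char \<kappa>)"
  unfolding torus_char_def[abs_def] cis_conv_exp by (intro continuous_intros)

lemma measurable_torus_char [measurable]: "torus_char \<kappa> \<in> borel_measurable borel"
  by (intro borel_measurable_continuous_onI continuous_on_torus_char)

lemma measurable_torusI: "f \<in> borel_measurable borel \<Longrightarrow> f \<in> borel_measurable torus"
  unfolding torus_def by (simp add: measurable_restrict_space1)

lemma fourier_coeff_eq: "fourier_coeff f \<kappa> = (\<integral>x. complex_of_real (f x) * torus_char (- \<kappa>) x \<partial>torus)"
  unfolding fourier_coeff_def torus_char_def by (simp add: sum_negf)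

text \<open>Closing the interval changes a null set and makes the fundamental theorem of calculus
  applicable; for \<open>k \<noteq> 0\<close> the antiderivative has period 1.\<close>

lemma integral_cis_unit:
  "(\<integral>t. indicator {0..<1::real} t *\<^sub>R cis (2 * pi * (of_int k * t)) \<partial>lborel) = (if k = 0 then 1 else 0)"
proof -
  have eq: "(\<integral>t. indicator {0..<1::real} t *\<^sub>R cis (2 * pi * (of_int k * t)) \<partial>lborel) =
     (\<integral>t. indicator {0..1::real} t *\<^sub>R cis (2 * pi * (of_int k * t)) \<partial>lborel)"
  proof (rule integral_cong_AE)
    have [measurable]: "(\<lambda>t. cis (2 * pi * (of_int k * t))) \<in> borel_measurable borel"
      unfolding cis_conv_exp by (intro borel_measurable_continuous_onI continuous_intros)
    show "(\<lambda>t. indicator {0..<1::real} t *\<^sub>R cis (2 * pi * (of_int k * t))) \<in> borel_measurable lborel"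
      "(\<lambda>t. indicator {0..1::real} t *\<^sub>R cis (2 * pi * (of_int k * t))) \<in> borel_measurable lborel"
      by measurable
    show "AE t in lborel. indicator {0..<1::real} t *\<^sub>R cis (2 * pi * (of_int k * t)) =
        indicator {0..1::real} t *\<^sub>R cis (2 * pi * (of_int k * t))"
      using AE_lborel_singleton[of "1::real"] by eventually_elim (auto simp: indicator_def)
  qed
  show ?thesis
  proof (cases "k = 0")
    case True
    then show ?thesis unfolding eq by simp
  next
    case False
    let ?c = "2 * pi * of_int k * \<i> :: complex"
    have c: "?c \<noteq> 0" using False by simp
    have "(\<integral>t. indicator {0..1::real} t *\<^sub>R exp (?c * of_real t) \<partial>lborel) = exp (?c * of_real 1) / ?c - exp (?c * of_real 0) / ?c"
    proof (rule integral_FTC_atLeastAtMost)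
      fix x :: real
      show "((\<lambda>t. exp (?c * of_real t) / ?c) has_vector_derivative exp (?c * of_real x)) (at x within {0..1})"
      proof (rule has_vector_derivative_real_field)
        show "((\<lambda>z. exp (?c * z) / ?c) has_field_derivative exp (?c * of_real x)) (at (of_real x))"
          using c by (auto intro!: derivative_eq_intros)
      qed
    qed (auto intro!: continuous_intros)
    also have "\<dots> = 0"
      using exp_integer_2pi[of "of_int k"] by (simp add: mult_ac)
    finally show ?thesis unfolding eq using False by (simp add: cis_conv_exp mult_ac)
  qed
qed

text \<open>The indicator of the cell times a character is a product of functions of one coordinate,
  and Lebesgue measure is the image of a product measure, so the integral factors into those of
  \<open>integral_cis_unit\<close>.\<close>

lemma integral_torus_char:
  "(\<integral>x. torus_char \<kappa> x \<partial>(torus :: (real ^ 'd::finite) measure)) = (if \<kappa> = 0 then 1 else 0)"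
proof -
  let ?g = "\<lambda>k t. indicator {0..<1::real} t *\<^sub>R cis (2 * pi * (of_int k * t))"
  \<comment> \<open>The product measure is indexed by \<open>Basis\<close>, the components by the
    index type; \<open>ix\<close> recovers \<open>i\<close> from the basis vector
    \<open>axis i 1\<close>.\<close>
  define ix where "ix = (\<lambda>b :: real ^ 'd. SOME i. b = axis i 1)"
  have ix: "ix (axis i 1) = i" for i
    unfolding ix_def by (simp add: axis_eq_axis)
  have B: "(Basis :: (real ^ 'd) set) = (\<lambda>i. axis i 1) ` UNIV"
    unfolding Basis_vec_def by auto
  have inj: "inj (\<lambda>i::'d. axis i (1::real))"
    by (auto simp: inj_on_def axis_eq_axis)
  have gm: "?g k \<in> borel_measurable borel" for k
  proof (rule borel_measurable_scaleR)
    show "(\<lambda>t. cis (2 * pi * (of_int k * t))) \<in> borel_measurable borel"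
      unfolding cis_conv_exp by (intro borel_measurable_continuous_onI continuous_intros)
  qed simp
  have gi: "integrable lborel (?g k)" for k
    by (rule Bochner_Integration.integrable_bound[of _ "indicator {0..<1::real} :: real \<Rightarrow> real"])
      (use gm in \<open>auto simp: integrable_indicator_iff indicator_def\<close>)
  have prod_cis: "cis (\<Sum>i\<in>I. a i) = (\<Prod>i\<in>I. cis (a i))" if "finite I" for I :: "'d set" and a
    using that by (induction I rule: finite_induct) (auto simp: cis_mult[symmetric])
  have ind: "indicator cell x *\<^sub>R torus_char \<kappa> x = (\<Prod>i\<in>UNIV. ?g (\<kappa> $ i) (x $ i))" for x
  proof (cases "x \<in> cell")
    case True
    then have "(\<Prod>i\<in>UNIV. ?g (\<kappa> $ i) (x $ i)) = (\<Prod>i\<in>UNIV. cis (2 * pi * (of_int (\<kappa> $ i) * x $ i)))"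
      by (intro prod.cong) auto
    also have "\<dots> = torus_char \<kappa> x"
      unfolding torus_char_def sum_distrib_left by (simp add: prod_cis)
    finally show ?thesis using True by simp
  next
    case False
    then obtain i where "x $ i \<notin> {0..<1}" by auto
    then have "(\<Prod>i\<in>UNIV. ?g (\<kappa> $ i) (x $ i)) = 0" by (intro prod_zero bexI[of _ i]) (auto simp: indicator_def)
    then show ?thesis using False by simp
  qed
  have "(\<integral>x. torus_char \<kappa> x \<partial>(torus :: (real ^ 'd) measure)) = (\<integral>x. indicator cell x *\<^sub>R torus_char \<kappa> x \<partial>lborel)"
    unfolding torus_def by (subst integral_restrict_space) (auto simp: cell_measurable)
  also have "\<dots> = (\<integral>x. (\<Prod>i\<in>UNIV. ?g (\<kappa> $ i) (x $ i)) \<partial>lborel)"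
    by (simp only: ind)
  also have "\<dots> = (\<integral>x. (\<Prod>b\<in>Basis. ?g (\<kappa> $ ix b) (x \<bullet> b)) \<partial>lborel)"
    unfolding B prod.reindex[OF inj] by (simp add: ix inner_axis o_def)
  also have "\<dots> = (\<integral>f. (\<Prod>b\<in>Basis. ?g (\<kappa> $ ix b) (f b)) \<partial>(\<Pi>\<^sub>M b\<in>Basis. lborel))"
  proof -
    have "(\<lambda>x :: real ^ 'd. \<Prod>b\<in>Basis. ?g (\<kappa> $ ix b) (x \<bullet> b)) \<in> borel_measurable borel"
      by (intro borel_measurable_prod measurable_compose[OF _ gm]) auto
    then show ?thesis
      unfolding lborel_def[where 'a="real ^ 'd"] lborel_eq_real[symmetric]
      by (subst integral_distr) (auto simp: inner_sum_left inner_Basis if_distrib sum.If_cases intro!: Bochner_Integration.integral_cong prod.cong)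
  qed
  also have "\<dots> = (\<Prod>b\<in>(Basis :: (real ^ 'd) set). \<integral>t. ?g (\<kappa> $ ix b) t \<partial>lborel)"
  proof -
    interpret product_sigma_finite "\<lambda>b :: real ^ 'd. lborel :: real measure" ..
    show ?thesis by (rule product_integral_prod) (auto intro: gi)
  qed
  also have "\<dots> = (\<Prod>i\<in>UNIV. if \<kappa> $ i = 0 then 1 else 0)"
    unfolding B prod.reindex[OF inj] by (simp add: ix o_def integral_cis_unit)
  also have "\<dots> = (if \<kappa> = 0 then 1 else 0)"
    by (auto simp: vec_eq_iff)
  finally show ?thesis .
qed

text \<open>The inductive form makes closure under products a double induction. The form as a finite
  sum with distinct frequencies, from which coefficients can be read off, is recovered in
  \<open>trig_poly_expansion\<close>.\<close>

inductive trig_poly :: "(real ^ 'd::finite \<Rightarrow> complex) \<Rightarrow> bool" where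
  char: "trig_poly (\<lambda>x. c * torus_char \<kappa> x)"
| add: "trig_poly f \<Longrightarrow> trig_poly g \<Longrightarrow> trig_poly (\<lambda>x. f x + g x)"

lemma trig_poly_mult:
  assumes "trig_poly f" "trig_poly g"
  shows "trig_poly (\<lambda>x. f x * g x)"
  using assms(1)
proof (induction f rule: trig_poly.induct)
  case (char c \<kappa>)
  from assms(2) show ?case
  proof (induction g rule: trig_poly.induct)
    case (char c' \<kappa>')
    have "(\<lambda>x. c * torus_char \<kappa> x * (c' * torus_char \<kappa>' x)) = (\<lambda>x. (c * c') * torus_char (\<kappa> + \<kappa>') x)"
      by (simp add: torus_char_add mult_ac)
    then show ?case by (simp only: trig_poly.char)
  next
    case (add f g)
    then show ?case by (simp add: distrib_left trig_poly.add)
  qed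
next
  case (add f1 f2)
  then show ?case by (simp add: distrib_right trig_poly.add)
qed

lemma trig_poly_const: "trig_poly (\<lambda>x. c)"
  using trig_poly.char[of c 0] by simp

lemma trig_poly_expansion:
  assumes "trig_poly f"
  shows "\<exists>A c. finite A \<and> f = (\<lambda>x. \<Sum>\<kappa>\<in>A. c \<kappa> * torus_char \<kappa> x)"
  using assms
proof (induction f rule: trig_poly.induct)
  case (char c \<kappa>)
  show ?case by (rule exI[of _ "{\<kappa>}"], rule exI[of _ "\<lambda>_. c"]) simp
next
  case (add f g)
  then obtain A c B d where A: "finite A" "f = (\<lambda>x. \<Sum>\<kappa>\<in>A. c \<kappa> * torus_char \<kappa> x)"
    and B: "finite B" "g = (\<lambda>x. \<Sum>\<kappa>\<in>B. d \<kappa> * torus_char \<kappa> x)" by blast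
  let ?c = "\<lambda>\<kappa>. (if \<kappa> \<in> A then c \<kappa> else 0) + (if \<kappa> \<in> B then d \<kappa> else 0)"
  have "(\<Sum>\<kappa>\<in>A. c \<kappa> * torus_char \<kappa> x) = (\<Sum>\<kappa>\<in>A \<union> B. (if \<kappa> \<in> A then c \<kappa> else 0) * torus_char \<kappa> x)"
    "(\<Sum>\<kappa>\<in>B. d \<kappa> * torus_char \<kappa> x) = (\<Sum>\<kappa>\<in>A \<union> B. (if \<kappa> \<in> B then d \<kappa> else 0) * torus_char \<kappa> x)" for x
    using A B by (auto intro!: sum.mono_neutral_cong_left)
  then have "(\<lambda>x. f x + g x) = (\<lambda>x. \<Sum>\<kappa>\<in>A \<union> B. ?c \<kappa> * torus_char \<kappa> x)"
    unfolding A(2) B(2) by (simp add: sum.distrib[symmetric] distrib_right)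
  then show ?case using A(1) B(1) by (intro exI[of _ "A \<union> B"] exI[of _ ?c]) simp
qed

lemma integrable_trig_poly: "trig_poly f \<Longrightarrow> integrable torus f"
proof (induction rule: trig_poly.induct)
  case (char c \<kappa>)
  interpret finite_measure "torus :: (real ^ 'a) measure" by (rule finite_measure_torus)
  show ?case
    by (rule integrable_const_bound[where B="norm c"]) (auto simp: norm_mult intro!: measurable_torusI)
qed auto

text \<open>Orthogonality of the characters, in the form that recovers one coefficient as an
  integral.\<close>

lemma trig_poly_coeff:
  assumes "finite A" "\<nu> \<in> A"
  shows "(\<integral>x. (\<Sum>\<kappa>\<in>A. c \<kappa> * torus_char \<kappa> x) * torus_char (- \<nu>) x \<partial>torus) = c \<nu>"
proof -
  have eq: "(\<Sum>\<kappa>\<in>A. c \<kappa> * torus_char \<kappa> x) * torus_char (- \<nu>) x = (\<Sum>\<kappa>\<in>A. c \<kappa> * torus_char (\<kappa> - \<nu>) x)" for x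
    using torus_char_add[of _ "- \<nu>" x] by (simp add: sum_distrib_right mult.assoc)
  have i: "integrable torus (\<lambda>x. c \<kappa> * torus_char (\<kappa> - \<nu>) x)" for \<kappa>
    by (intro integrable_trig_poly trig_poly.char)
  have "(\<integral>x. (\<Sum>\<kappa>\<in>A. c \<kappa> * torus_char \<kappa> x) * torus_char (- \<nu>) x \<partial>torus) = (\<Sum>\<kappa>\<in>A. c \<kappa> * (\<integral>x. torus_char (\<kappa> - \<nu>) x \<partial>torus))"
    unfolding eq using i by (subst Bochner_Integration.integral_sum) auto
  also have "\<dots> = (\<Sum>\<kappa>\<in>A. if \<kappa> = \<nu> then c \<kappa> else 0)"
    by (intro sum.cong refl) (simp add: integral_torus_char)
  also have "\<dots> = c \<nu>" using assms by simp
  finally show ?thesis .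
qed

section \<open>The pairing bound against trigonometric polynomials\<close>

context
  fixes \<beta> :: "real ^ 'd::finite \<Rightarrow> real" and S :: real
  assumes \<beta>: "integrable torus \<beta>"
    and S: "\<And>A. finite A \<Longrightarrow> (\<Sum>\<kappa>\<in>A. cmod (fourier_coeff \<beta> \<kappa>)) \<le> S"
begin

lemma fourier_bound_nonneg: "0 \<le> S"
  using S[of "{}"] by simp

text \<open>Each coefficient of \<open>P\<close> is an integral of \<open>P\<close> against a
  function of modulus one, hence at most the integral of \<open>cmod (P x)\<close>; pairing with
  \<open>\<beta>\<close> sums these coefficients against Fourier coefficients of
  \<open>\<beta>\<close>, whose moduli add up to at most \<open>S\<close>. The bound involves
  \<open>P\<close> only through its integral norm, so it survives approximation; applied to
  indicators it will bound \<open>\<beta>\<close>.\<close>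

lemma fourier_bound_trig_poly:
  assumes P: "trig_poly P"
  shows "cmod (\<integral>x. complex_of_real (\<beta> x) * P x \<partial>torus) \<le> S * (\<integral>x. cmod (P x) \<partial>torus)"
proof -
  note [measurable] = borel_measurable_integrable[OF \<beta>]
  obtain A c where A: "finite A" and Pe: "P = (\<lambda>x. \<Sum>\<kappa>\<in>A. c \<kappa> * torus_char \<kappa> x)"
    using trig_poly_expansion[OF P] by blast
  have c: "cmod (c \<nu>) \<le> (\<integral>x. cmod (P x) \<partial>torus)" if "\<nu> \<in> A" for \<nu>
  proof -
    have "c \<nu> = (\<integral>x. P x * torus_char (- \<nu>) x \<partial>torus)"
      unfolding Pe using trig_poly_coeff[OF A that] by simp
    also have "cmod \<dots> \<le> (\<integral>x. cmod (P x * torus_char (- \<nu>) x) \<partial>torus)" by (rule integral_norm_bound)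
    finally show ?thesis by (simp add: norm_mult)
  qed
  have bi: "integrable torus (\<lambda>x. complex_of_real (\<beta> x) * torus_char \<kappa> x)" for \<kappa>
  proof (rule Bochner_Integration.integrable_bound[OF \<beta>])
    have [measurable]: "torus_char \<kappa> \<in> borel_measurable torus" by (intro measurable_torusI) simp
    show "(\<lambda>x. complex_of_real (\<beta> x) * torus_char \<kappa> x) \<in> borel_measurable torus" by measurable
  qed (simp add: norm_mult)
  have "(\<integral>x. complex_of_real (\<beta> x) * P x \<partial>torus) = (\<integral>x. (\<Sum>\<kappa>\<in>A. c \<kappa> * (complex_of_real (\<beta> x) * torus_char \<kappa> x)) \<partial>torus)"
    unfolding Pe by (simp add: sum_distrib_left mult_ac)
  also have "\<dots> = (\<Sum>\<kappa>\<in>A. c \<kappa> * fourier_coeff \<beta> (- \<kappa>))"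
    using bi by (subst Bochner_Integration.integral_sum) (auto simp: fourier_coeff_eq)
  also have "cmod \<dots> \<le> (\<Sum>\<kappa>\<in>A. (\<integral>x. cmod (P x) \<partial>torus) * cmod (fourier_coeff \<beta> (- \<kappa>)))"
    by (intro sum_norm_le) (auto simp: norm_mult intro!: mult_right_mono c)
  also have "\<dots> = (\<integral>x. cmod (P x) \<partial>torus) * (\<Sum>\<kappa>\<in>uminus ` A. cmod (fourier_coeff \<beta> \<kappa>))"
    by (subst sum.reindex) (auto simp: sum_distrib_left)
  also have "\<dots> \<le> (\<integral>x. cmod (P x) \<partial>torus) * S"
    by (intro mult_left_mono S) (auto simp: A)
  finally show ?thesis by (simp add: mult.commute)
qed

end

text \<open>
  Functions of the form \<open>f \<circ> torus_embedding\<close>, \<open>f\<close> continuous, are the continuous periodic ones; real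
  polynomials on \<open>\<complex>\<^sup>d\<close> become trigonometric polynomials, so Stone-Weierstrass applies.
\<close>

definition torus_embedding :: "real ^ 'd::finite \<Rightarrow> complex ^ 'd" where
  "torus_embedding x = (\<chi> i. cis (2 * pi * x $ i))"

text \<open>A left inverse of the embedding on the cell. It serves to write a Borel subset of the
  cell as the preimage of a Borel subset of \<open>complex ^ 'd\<close>.\<close>

definition torus_embedding_inv :: "complex ^ 'd::finite \<Rightarrow> real ^ 'd" where
  "torus_embedding_inv z = (\<chi> i. Arg2pi (z $ i) / (2 * pi))"

lemma torus_embedding_inv: "x \<in> cell \<Longrightarrow> torus_embedding_inv (torus_embedding x) = x"
proof -
  assume x: "x \<in> cell"
  \<comment> \<open>The range of \<open>Arg2pi\<close>, closed at 0 and open at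
    \<open>2 * pi\<close>, matches the half-open cell.\<close>
  have "Arg2pi (cis (2 * pi * x $ i)) = 2 * pi * x $ i" for i
    using x by (intro Arg2pi_unique[of 1]) (auto simp: cis_conv_exp)
  then show ?thesis by (simp add: torus_embedding_def torus_embedding_inv_def vec_eq_iff)
qed

lemma continuous_on_torus_embedding: "continuous_on S torus_embedding"
  unfolding torus_embedding_def[abs_def] cis_conv_exp by (intro continuous_intros)

lemma measurable_torus_embedding [measurable]: "torus_embedding \<in> torus \<rightarrow>\<^sub>M borel"
  by (intro measurable_torusI borel_measurable_continuous_onI continuous_on_torus_embedding)

text \<open>\<open>Arg2pi\<close> jumps only across the closed nonnegative real axis, where its
  value is 0.\<close>

lemma borel_measurable_Arg2pi: "Arg2pi \<in> borel_measurable borel"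
proof -
  have "(\<lambda>z. if z \<in> \<real>\<^sub>\<ge>\<^sub>0 then 0 else Arg2pi z) \<in> borel_measurable borel"
    by (intro borel_measurable_continuous_on_if continuous_on_const)
      (auto intro!: continuous_at_imp_continuous_on continuous_at_Arg2pi borel_closed)
  moreover have "(\<lambda>z. if z \<in> \<real>\<^sub>\<ge>\<^sub>0 then 0 else Arg2pi z) = Arg2pi"
    by (auto simp: fun_eq_iff Arg2pi_eq_0 nonneg_Reals_def complex_nonneg_Reals_iff complex_is_Real_iff)
  ultimately show ?thesis by simp
qed

lemma measurable_torus_embedding_inv: "torus_embedding_inv \<in> borel_measurable borel"
proof (rule borel_measurable_euclidean_space[THEN iffD2, rule_format])
  fix b :: "real ^ 'a" assume "b \<in> Basis"
  then obtain i where b: "b = axis i 1" by (auto simp: Basis_vec_def)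
  have "(\<lambda>z :: complex ^ 'a. z $ i) \<in> borel_measurable borel"
    by (intro borel_measurable_continuous_onI continuous_intros)
  then have [measurable]: "(\<lambda>z :: complex ^ 'a. Arg2pi (z $ i)) \<in> borel_measurable borel"
    by (rule measurable_compose) (rule borel_measurable_Arg2pi)
  show "(\<lambda>z. torus_embedding_inv z \<bullet> b) \<in> borel_measurable borel"
    unfolding b by (simp add: torus_embedding_inv_def inner_axis)
qed

lemma trig_poly_coordinate:
  fixes i :: "'d::finite"
  shows "trig_poly (\<lambda>x. complex_of_real (cos (2 * pi * x $ i)))" (is ?c)
    and "trig_poly (\<lambda>x. complex_of_real (sin (2 * pi * x $ i)))" (is ?s)
proof -
  have s: "(\<Sum>j\<in>UNIV. of_int (axis i a $ j) * x $ j) = of_int a * x $ i" for x :: "real ^ 'd" and a :: int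
  proof -
    have "(\<Sum>j\<in>UNIV. of_int (axis i a $ j) * x $ j) = (\<Sum>j\<in>UNIV. if j = i then of_int a * x $ i else 0)"
      by (intro sum.cong) (auto simp: axis_def)
    then show ?thesis by simp
  qed
  have c: "torus_char (axis i a) x = cis (2 * pi * (of_int a * x $ i))" for x :: "real ^ 'd" and a
    unfolding torus_char_def s ..
  have "(\<lambda>x :: real ^ 'd. 1 / 2 * torus_char (axis i 1) x + 1 / 2 * torus_char (axis i (- 1)) x) = (\<lambda>x. complex_of_real (cos (2 * pi * x $ i)))"
    by (auto simp: c complex_eq_iff fun_eq_iff)
  then show ?c using trig_poly.add[OF trig_poly.char[of "1/2" "axis i 1"] trig_poly.char[of "1/2" "axis i (- 1)"]] by simp
  have "(\<lambda>x :: real ^ 'd. (- \<i> / 2) * torus_char (axis i 1) x + (\<i> / 2) * torus_char (axis i (- 1)) x) = (\<lambda>x. complex_of_real (sin (2 * pi * x $ i)))"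
    by (auto simp: c complex_eq_iff fun_eq_iff)
  then show ?s using trig_poly.add[OF trig_poly.char[of "- \<i> / 2" "axis i 1"] trig_poly.char[of "\<i> / 2" "axis i (- 1)"]] by simp
qed

lemma trig_poly_sum: "finite I \<Longrightarrow> (\<And>i. i \<in> I \<Longrightarrow> trig_poly (f i)) \<Longrightarrow> trig_poly (\<lambda>x. \<Sum>i\<in>I. f i x)"
  by (induction I rule: finite_induct) (auto intro: trig_poly_const trig_poly.add)

text \<open>Real polynomial functions are generated by constants and real-linear functionals. The
  latter are combinations of real and imaginary parts of coordinates, which the embedding turns into
  cosines and sines.\<close>

lemma trig_poly_of_polynomial:
  fixes g :: "complex ^ 'd::finite \<Rightarrow> real"
  assumes "real_polynomial_function g"
  shows "trig_poly (\<lambda>x. complex_of_real (g (torus_embedding x)))"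
  using assms
proof (induction g rule: real_polynomial_function.induct)
  case (linear g)
  have "g (torus_embedding x) = (\<Sum>i\<in>UNIV. cos (2 * pi * x $ i) * g (axis i 1) + sin (2 * pi * x $ i) * g (axis i \<i>))" for x
  proof -
    have "torus_embedding x = (\<Sum>i\<in>UNIV. cos (2 * pi * x $ i) *\<^sub>R axis i 1 + sin (2 * pi * x $ i) *\<^sub>R axis i \<i>)"
    proof (rule vec_eq_iff[THEN iffD2], rule allI)
      fix j
      have "(\<Sum>i\<in>UNIV. cos (2 * pi * x $ i) *\<^sub>R axis i 1 + sin (2 * pi * x $ i) *\<^sub>R axis i \<i>) $ j =
          (\<Sum>i\<in>UNIV. if i = j then cis (2 * pi * x $ j) else 0)"
        unfolding sum_component by (rule sum.cong) (auto simp: axis_def complex_eq_iff)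
      then show "torus_embedding x $ j = (\<Sum>i\<in>UNIV. cos (2 * pi * x $ i) *\<^sub>R axis i 1 + sin (2 * pi * x $ i) *\<^sub>R axis i \<i>) $ j"
        by (simp add: torus_embedding_def)
    qed
    then show ?thesis
      using bounded_linear.linear[OF linear]
      by (simp add: linear_sum linear_add linear_scale)
  qed
  then have eq: "complex_of_real (g (torus_embedding x)) =
      (\<Sum>i\<in>UNIV. complex_of_real (cos (2 * pi * x $ i)) * of_real (g (axis i 1)) + complex_of_real (sin (2 * pi * x $ i)) * of_real (g (axis i \<i>)))" for x
    by simp
  show ?case
    unfolding eq
    by (intro trig_poly_sum trig_poly.add trig_poly_mult trig_poly_coordinate trig_poly_const) simp
qed (auto intro: trig_poly_const trig_poly.add trig_poly_mult)

section \<open>Extension of the pairing bound to continuous functions and to indicators of open and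
  Borel sets\<close>

context
  fixes \<beta> :: "real ^ 'd::finite \<Rightarrow> real" and S :: real
  assumes \<beta>: "integrable torus \<beta>"
    and S: "\<And>A. finite A \<Longrightarrow> (\<Sum>\<kappa>\<in>A. cmod (fourier_coeff \<beta> \<kappa>)) \<le> S"
begin

text \<open>Replacing \<open>f\<close> by a polynomial \<open>g\<close> with error below
  \<open>e\<close> on a compact set containing the image of the torus changes the two sides together
  by at most \<open>e\<close> times a constant, so the bound for trigonometric polynomials passes to
  \<open>f\<close>.\<close>

lemma fourier_bound_continuous:
  assumes f: "continuous_on UNIV f"
  shows "\<bar>\<integral>x. \<beta> x * f (torus_embedding x) \<partial>torus\<bar> \<le> S * (\<integral>x. \<bar>f (torus_embedding x)\<bar> \<partial>torus)"
proof -
  interpret finite_measure "torus :: (real ^ 'd) measure" by (rule finite_measure_torus)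
  let ?\<mu> = "measure torus (space (torus :: (real ^ 'd) measure))" and ?B = "\<integral>x. \<bar>\<beta> x\<bar> \<partial>torus"
  note [measurable] = borel_measurable_integrable[OF \<beta>]
  \<comment> \<open>Real and imaginary parts of points of the image lie between -1 and 1.\<close>
  define K where "K = cbox (\<chi> i. Complex (-1) (-1)) (\<chi> i. Complex 1 1 :: complex ^ 'd)"
  have K: "compact K" unfolding K_def by (rule compact_cbox)
  have EK: "torus_embedding x \<in> K" for x :: "real ^ 'd"
    unfolding K_def by (auto simp: mem_box Basis_vec_def Basis_complex_def inner_axis torus_embedding_def)
  have [measurable]: "f \<in> borel_measurable borel" using f by (rule borel_measurable_continuous_onI)
  have fb: "bounded (f ` K)" using continuous_on_subset[OF f] K by (intro compact_imp_bounded compact_continuous_image) auto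
  then obtain D where D: "\<And>z. z \<in> K \<Longrightarrow> \<bar>f z\<bar> \<le> D" unfolding bounded_iff by auto
  have fi: "integrable torus (\<lambda>x. f (torus_embedding x))"
    by (rule integrable_const_bound[where B=D]) (auto intro!: D EK)
  have \<beta>fi: "integrable torus (\<lambda>x. \<beta> x * f (torus_embedding x))"
  proof (rule Bochner_Integration.integrable_bound)
    show "integrable torus (\<lambda>x. \<beta> x * \<bar>D\<bar>)" using \<beta> by simp
    show "AE x in torus. norm (\<beta> x * f (torus_embedding x)) \<le> norm (\<beta> x * \<bar>D\<bar>)"
      unfolding norm_mult using D[OF EK] by (intro AE_I2 mult_left_mono) (auto intro: order_trans[OF _ abs_ge_self])
  qed measurable
  have le: "\<bar>\<integral>x. \<beta> x * f (torus_embedding x) \<partial>torus\<bar> \<le> S * (\<integral>x. \<bar>f (torus_embedding x)\<bar> \<partial>torus) + e * (S * ?\<mu> + ?B)" if e: "e > 0" for e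
  proof -
    obtain g where g: "real_polynomial_function g" "\<And>z. z \<in> K \<Longrightarrow> \<bar>f z - g z\<bar> < e"
      using Stone_Weierstrass_real_polynomial_function[OF K continuous_on_subset[OF f] e] by auto
    note P = trig_poly_of_polynomial[OF g(1)]
    have gb: "continuous_on UNIV g" using g(1) by (simp add: continuous_on_polymonial_function real_polynomial_function_eq)
    have [measurable]: "g \<in> borel_measurable borel" using gb by (rule borel_measurable_continuous_onI)
    have gle: "\<bar>g (torus_embedding x)\<bar> \<le> \<bar>f (torus_embedding x)\<bar> + e" for x :: "real ^ 'd" using g(2)[OF EK[of x]] by linarith
    have gi: "integrable torus (\<lambda>x. g (torus_embedding x))"
    proof (rule integrable_const_bound[where B="D + e"])
      show "AE x in torus. norm (g (torus_embedding x)) \<le> D + e"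
        unfolding real_norm_def by (intro AE_I2 order_trans[OF gle] add_right_mono D EK)
    qed measurable
    have \<beta>di: "integrable torus (\<lambda>x. \<beta> x * (f (torus_embedding x) - g (torus_embedding x)))"
    proof (rule Bochner_Integration.integrable_bound)
      show "integrable torus (\<lambda>x. \<beta> x * e)" using \<beta> by simp
      show "AE x in torus. norm (\<beta> x * (f (torus_embedding x) - g (torus_embedding x))) \<le> norm (\<beta> x * e)"
        unfolding norm_mult using g(2)[OF EK] e by (intro AE_I2 mult_left_mono) (auto intro: less_imp_le)
    qed measurable
    have "integrable torus (\<lambda>x. \<beta> x * f (torus_embedding x) - \<beta> x * (f (torus_embedding x) - g (torus_embedding x)))"
      using \<beta>fi \<beta>di by (rule Bochner_Integration.integrable_diff)
    then have \<beta>gi: "integrable torus (\<lambda>x. \<beta> x * g (torus_embedding x))" by (simp add: algebra_simps)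
    have "\<bar>\<integral>x. \<beta> x * g (torus_embedding x) \<partial>torus\<bar> = cmod (\<integral>x. complex_of_real (\<beta> x) * complex_of_real (g (torus_embedding x)) \<partial>torus)"
      unfolding of_real_mult[symmetric] integral_complex_of_real by simp
    also have "\<dots> \<le> S * (\<integral>x. \<bar>g (torus_embedding x)\<bar> \<partial>torus)"
      using fourier_bound_trig_poly[OF \<beta> S P] by simp
    also have "\<dots> \<le> S * (\<integral>x. \<bar>f (torus_embedding x)\<bar> + e \<partial>torus)"
      using fi gi gle fourier_bound_nonneg[OF \<beta> S] by (intro mult_left_mono integral_mono) auto
    also have "\<dots> = S * (\<integral>x. \<bar>f (torus_embedding x)\<bar> \<partial>torus) + S * (e * ?\<mu>)"
      using fi by (simp add: distrib_left mult.commute)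
    finally have 1: "\<bar>\<integral>x. \<beta> x * g (torus_embedding x) \<partial>torus\<bar> \<le> S * (\<integral>x. \<bar>f (torus_embedding x)\<bar> \<partial>torus) + S * (e * ?\<mu>)" .
    have "\<bar>\<integral>x. \<beta> x * (f (torus_embedding x) - g (torus_embedding x)) \<partial>torus\<bar> \<le> (\<integral>x. \<bar>\<beta> x * (f (torus_embedding x) - g (torus_embedding x))\<bar> \<partial>torus)"
      by (rule integral_abs_bound)
    also have "\<dots> \<le> (\<integral>x. e * \<bar>\<beta> x\<bar> \<partial>torus)"
    proof (rule integral_mono)
      fix x :: "real ^ 'd"
      show "\<bar>\<beta> x * (f (torus_embedding x) - g (torus_embedding x))\<bar> \<le> e * \<bar>\<beta> x\<bar>"
        unfolding abs_mult mult.commute[of e] using g(2)[OF EK[of x]] by (intro mult_left_mono) auto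
    qed (use \<beta>di \<beta> in auto)
    finally have 2: "\<bar>\<integral>x. \<beta> x * (f (torus_embedding x) - g (torus_embedding x)) \<partial>torus\<bar> \<le> e * ?B" by simp
    have "(\<integral>x. \<beta> x * f (torus_embedding x) \<partial>torus) = (\<integral>x. \<beta> x * g (torus_embedding x) \<partial>torus) + (\<integral>x. \<beta> x * (f (torus_embedding x) - g (torus_embedding x)) \<partial>torus)"
      using \<beta>gi \<beta>di by (simp add: Bochner_Integration.integral_add[symmetric] algebra_simps)
    with 1 2 show ?thesis by (simp add: algebra_simps)
  qed
  show ?thesis
  proof (rule field_le_epsilon)
    fix e :: real assume e: "e > 0"
    \<comment> \<open>The error is applied with \<open>e / (c + 1)\<close>; the added 1 covers the
      case \<open>c = 0\<close>.\<close>
    define c where "c = S * ?\<mu> + ?B"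
    have c: "c \<ge> 0" unfolding c_def using fourier_bound_nonneg[OF \<beta> S] by simp
    have "e / (c + 1) * c \<le> e" using c e by (simp add: field_simps)
    with le[of "e / (c + 1)"] c e show "\<bar>\<integral>x. \<beta> x * f (torus_embedding x) \<partial>torus\<bar> \<le> S * (\<integral>x. \<bar>f (torus_embedding x)\<bar> \<partial>torus) + e"
      unfolding c_def[symmetric] by simp
  qed
qed

text \<open>The indicator of an open set is the limit of continuous functions with values between 0
  and 1, built from the distance to the complement; dominated convergence applies on both
  sides.\<close>

lemma fourier_bound_open:
  fixes U :: "(complex ^ 'd) set"
  assumes U: "open U"
  shows "\<bar>\<integral>x. \<beta> x * indicator U (torus_embedding x) \<partial>torus\<bar> \<le> S * (\<integral>x. indicator U (torus_embedding x) \<partial>torus)"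
\<comment> \<open>For \<open>U = UNIV\<close> the complement is empty, where \<open>infdist\<close>
  is 0 by convention, so the approximating functions would vanish.\<close>
proof (cases "U = UNIV")
  case True
  then show ?thesis using fourier_bound_continuous[of "\<lambda>_. 1"] by simp
next
  case False
  interpret finite_measure "torus :: (real ^ 'd) measure" by (rule finite_measure_torus)
  note [measurable] = borel_measurable_integrable[OF \<beta>]
  have [measurable]: "U \<in> sets borel" using U by simp
  define f where "f n z = min 1 (real n * infdist z (- U))" for n z
  have fc: "continuous_on UNIV (f n)" for n unfolding f_def by (intro continuous_intros)
  have [measurable]: "f n \<in> borel_measurable borel" for n using fc by (rule borel_measurable_continuous_onI)
  have fb: "0 \<le> f n z" "f n z \<le> 1" for n z by (auto simp: f_def infdist_nonneg)
  have lim: "(\<lambda>n. f n z) \<longlonglongrightarrow> indicator U z" for z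
  proof (cases "z \<in> U")
    case True
    have "infdist z (- U) > 0"
      using in_closed_iff_infdist_zero[of "- U" z] U False True infdist_nonneg[of z "- U"] by (auto simp: closed_def less_le)
    then obtain n where n: "1 < real n * infdist z (- U)" using reals_Archimedean3[of "infdist z (- U)"] by auto
    have "f k z = 1" if "k \<ge> n" for k
    proof -
      have "real n * infdist z (- U) \<le> real k * infdist z (- U)"
        using that by (intro mult_right_mono infdist_nonneg) simp
      then show ?thesis unfolding f_def using n by simp
    qed
    then show ?thesis using True by (intro tendsto_eventually) (auto simp: eventually_sequentially)
  qed (simp add: f_def)
  have 1: "(\<lambda>n. \<integral>x. \<beta> x * f n (torus_embedding x) \<partial>torus) \<longlonglongrightarrow> (\<integral>x. \<beta> x * indicator U (torus_embedding x) \<partial>torus)"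
  proof (rule integral_dominated_convergence[where w="\<lambda>x. \<bar>\<beta> x\<bar>"])
    show "AE x in torus. (\<lambda>n. \<beta> x * f n (torus_embedding x)) \<longlonglongrightarrow> \<beta> x * indicator U (torus_embedding x)"
      by (intro AE_I2 tendsto_mult tendsto_const lim)
    show "AE x in torus. norm (\<beta> x * f n (torus_embedding x)) \<le> \<bar>\<beta> x\<bar>" for n
      using fb[of n] by (intro AE_I2) (simp add: abs_mult mult_left_le)
  qed (use \<beta> in auto)
  have 2: "(\<lambda>n. \<integral>x. \<bar>f n (torus_embedding x)\<bar> \<partial>torus) \<longlonglongrightarrow> (\<integral>x. indicator U (torus_embedding x) \<partial>torus)"
  proof (rule integral_dominated_convergence[where w="\<lambda>x. 1"])
    show "AE x in torus. (\<lambda>n. \<bar>f n (torus_embedding x)\<bar>) \<longlonglongrightarrow> indicator U (torus_embedding x)"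
      using fb lim by (intro AE_I2) (simp add: abs_of_nonneg)
    show "AE x in torus. norm \<bar>f n (torus_embedding x)\<bar> \<le> 1" for n
      using fb[of n] by (intro AE_I2) simp
  qed auto
  show ?thesis
    by (rule LIMSEQ_le[OF tendsto_rabs[OF 1] tendsto_mult[OF tendsto_const 2]]) (auto intro!: fourier_bound_continuous fc)
qed

text \<open>Outer regularity of a finite Borel measure on \<open>complex ^ 'd\<close> yields an open
  superset with small excess, and the bound for open sets is transferred.\<close>

lemma fourier_bound_borel:
  fixes B :: "(complex ^ 'd) set"
  assumes B [measurable]: "B \<in> sets borel"
  shows "\<bar>\<integral>x. \<beta> x * indicator B (torus_embedding x) \<partial>torus\<bar> \<le> S * (\<integral>x. indicator B (torus_embedding x) \<partial>torus)"
proof (rule field_le_epsilon)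
  fix e :: real assume e: "e > 0"
  interpret finite_measure "torus :: (real ^ 'd) measure" by (rule finite_measure_torus)
  note [measurable] = borel_measurable_integrable[OF \<beta>]
  \<comment> \<open>The density \<open>1 + \<bar>\<beta> x\<bar>\<close> dominates both integrands,
    so a single small excess of \<open>U\<close> over \<open>B\<close> controls the error on both
    sides.\<close>
  define \<nu> where "\<nu> = distr (density torus (\<lambda>x. ennreal (1 + \<bar>\<beta> x\<bar>))) borel (torus_embedding :: real ^ 'd \<Rightarrow> _)"
  have \<nu>: "emeasure \<nu> A = ennreal (\<integral>x. (1 + \<bar>\<beta> x\<bar>) * indicator A (torus_embedding x) \<partial>torus)" and
      \<nu>i: "integrable torus (\<lambda>x. (1 + \<bar>\<beta> x\<bar>) * indicator A (torus_embedding x))"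
    if [measurable]: "A \<in> sets borel" for A
  proof -
    show i: "integrable torus (\<lambda>x. (1 + \<bar>\<beta> x\<bar>) * indicator A (torus_embedding x))"
      by (rule Bochner_Integration.integrable_bound[of _ "\<lambda>x. 1 + \<bar>\<beta> x\<bar>"]) (use \<beta> in \<open>auto simp: indicator_def\<close>)
    have m: "torus_embedding -` A \<inter> space torus \<in> sets (torus :: (real ^ 'd) measure)"
      by (rule measurable_sets[OF measurable_torus_embedding that])
    have "emeasure \<nu> A = emeasure (density torus (\<lambda>x. ennreal (1 + \<bar>\<beta> x\<bar>))) (torus_embedding -` A \<inter> space torus)"
      unfolding \<nu>_def by (subst emeasure_distr) auto
    also have "\<dots> = (\<integral>\<^sup>+x. ennreal (1 + \<bar>\<beta> x\<bar>) * indicator (torus_embedding -` A \<inter> space torus) x \<partial>torus)"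
      by (rule emeasure_density[OF _ m]) measurable
    also have "\<dots> = (\<integral>\<^sup>+x. ennreal ((1 + \<bar>\<beta> x\<bar>) * indicator A (torus_embedding x)) \<partial>torus)"
      by (intro nn_integral_cong) (auto simp: indicator_def)
    also have "\<dots> = ennreal (\<integral>x. (1 + \<bar>\<beta> x\<bar>) * indicator A (torus_embedding x) \<partial>torus)"
      by (rule nn_integral_eq_integral[OF i]) auto
    finally show "emeasure \<nu> A = ennreal (\<integral>x. (1 + \<bar>\<beta> x\<bar>) * indicator A (torus_embedding x) \<partial>torus)" .
  qed
  \<comment> \<open>The excess enters once multiplied by \<open>S\<close> on the right and once
    directly on the left, in total \<open>(1 + S) * \<eta>\<close>.\<close>
  define \<eta> where "\<eta> = e / (1 + S)"
  have \<eta>: "\<eta> > 0" and Se: "(1 + S) * \<eta> = e" unfolding \<eta>_def using e fourier_bound_nonneg[OF \<beta> S] by auto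
  have fin: "emeasure \<nu> (space \<nu>) \<noteq> \<infinity>"
    using \<nu>[of UNIV] by (simp add: \<nu>_def)
  have "(INF U\<in>{U. B \<subseteq> U \<and> open U}. emeasure \<nu> U) < emeasure \<nu> B + ennreal \<eta>"
    using outer_regular[of \<nu> B] fin B \<nu>[OF B] \<eta> by (simp add: \<nu>_def)
  then obtain U where U: "B \<subseteq> U" "open U" "emeasure \<nu> U < emeasure \<nu> B + ennreal \<eta>"
    by (auto simp: INF_less_iff)
  then have [measurable]: "U \<in> sets borel" by simp
  let ?iB = "\<lambda>x. indicator B (torus_embedding x) :: real" and ?iU = "\<lambda>x. indicator U (torus_embedding x) :: real"
  have int_ind: "integrable torus (\<lambda>x. indicator A (torus_embedding x) :: real)"
    "integrable torus (\<lambda>x. \<beta> x * indicator A (torus_embedding x))" if [measurable]: "A \<in> sets borel" for A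
  proof -
    show "integrable torus (\<lambda>x. indicator A (torus_embedding x) :: real)"
      by (rule integrable_const_bound[where B=1]) (simp_all add: indicator_def)
    show "integrable torus (\<lambda>x. \<beta> x * indicator A (torus_embedding x))"
      by (rule Bochner_Integration.integrable_bound[OF \<beta>]) (simp_all add: indicator_def)
  qed
  note ints = int_ind(1)[OF B] int_ind(1)[OF \<open>U \<in> sets borel\<close>] int_ind(2)[OF B] int_ind(2)[OF \<open>U \<in> sets borel\<close>]
  have nn: "0 \<le> (\<integral>x. (1 + \<bar>\<beta> x\<bar>) * ?iB x \<partial>torus)" by (intro integral_nonneg_AE AE_I2) auto
  have "ennreal (\<integral>x. (1 + \<bar>\<beta> x\<bar>) * ?iU x \<partial>torus) < ennreal ((\<integral>x. (1 + \<bar>\<beta> x\<bar>) * ?iB x \<partial>torus) + \<eta>)"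
    using U(3) \<eta> nn by (simp add: \<nu>)
  then have lt: "(\<integral>x. (1 + \<bar>\<beta> x\<bar>) * ?iU x \<partial>torus) < (\<integral>x. (1 + \<bar>\<beta> x\<bar>) * ?iB x \<partial>torus) + \<eta>"
    by (subst (asm) ennreal_less_iff) (auto intro!: integral_nonneg_AE AE_I2)
  have le: "?iB x \<le> ?iU x" for x using U(1) by (auto simp: indicator_def)
  have "(\<integral>x. ?iU x \<partial>torus) - (\<integral>x. ?iB x \<partial>torus) = (\<integral>x. ?iU x - ?iB x \<partial>torus)"
    using ints by simp
  also have "\<dots> \<le> (\<integral>x. (1 + \<bar>\<beta> x\<bar>) * ?iU x - (1 + \<bar>\<beta> x\<bar>) * ?iB x \<partial>torus)"
    using ints \<nu>i le by (intro integral_mono) (auto simp: right_diff_distrib[symmetric] distrib_right mult_right_mono)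
  also have "\<dots> \<le> \<eta>" using lt \<nu>i by simp
  finally have d1: "(\<integral>x. ?iU x \<partial>torus) \<le> (\<integral>x. ?iB x \<partial>torus) + \<eta>" by simp
  have "\<bar>(\<integral>x. \<beta> x * ?iB x \<partial>torus) - (\<integral>x. \<beta> x * ?iU x \<partial>torus)\<bar> = \<bar>\<integral>x. \<beta> x * ?iB x - \<beta> x * ?iU x \<partial>torus\<bar>"
    using ints by simp
  also have "\<dots> \<le> (\<integral>x. \<bar>\<beta> x * ?iB x - \<beta> x * ?iU x\<bar> \<partial>torus)" by (rule integral_abs_bound)
  also have "\<dots> \<le> (\<integral>x. (1 + \<bar>\<beta> x\<bar>) * ?iU x - (1 + \<bar>\<beta> x\<bar>) * ?iB x \<partial>torus)"
    using ints \<nu>i U(1) by (intro integral_mono) (auto simp: indicator_def)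
  also have "\<dots> \<le> \<eta>" using lt \<nu>i by simp
  finally have d2: "\<bar>\<integral>x. \<beta> x * ?iB x \<partial>torus\<bar> \<le> \<bar>\<integral>x. \<beta> x * ?iU x \<partial>torus\<bar> + \<eta>" by linarith
  also have "\<dots> \<le> S * (\<integral>x. ?iU x \<partial>torus) + \<eta>" using fourier_bound_open[OF U(2)] by simp
  also have "\<dots> \<le> S * ((\<integral>x. ?iB x \<partial>torus) + \<eta>) + \<eta>" using d1 fourier_bound_nonneg[OF \<beta> S] by (simp add: mult_left_mono)
  also have "\<dots> = S * (\<integral>x. ?iB x \<partial>torus) + e" unfolding Se[symmetric] by (simp add: algebra_simps)
  finally show "\<bar>\<integral>x. \<beta> x * ?iB x \<partial>torus\<bar> \<le> S * (\<integral>x. ?iB x \<partial>torus) + e" .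
qed

text \<open>On the set where \<open>s * \<beta>\<close> exceeds \<open>S\<close>, the function
  \<open>s * \<beta> - S\<close> is positive, but by the pairing bound its integral is at most 0;
  hence the set is null. The signs \<open>s = 1\<close> and \<open>s = -1\<close> together give the
  absolute value.\<close>

lemma AE_abs_le_fourier_sum: "AE x in torus. \<bar>\<beta> x\<bar> \<le> S"
proof -
  interpret finite_measure "torus :: (real ^ 'd) measure" by (rule finite_measure_torus)
  note [measurable] = borel_measurable_integrable[OF \<beta>]
  have "AE x in torus. s * \<beta> x \<le> S" if s: "\<bar>s\<bar> = 1" for s :: real
  proof -
    define A where "A = {x \<in> space torus. s * \<beta> x > S}"
    have A [measurable]: "A \<in> sets torus" unfolding A_def by measurable
    have Ab: "A \<in> sets borel"
      using A unfolding torus_def by (auto simp: sets_restrict_space cell_measurable)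
    \<comment> \<open>The pairing bound is about Borel sets in \<open>complex ^ 'd\<close>; the
      preimage of \<open>A\<close> under the left inverse is one whose trace on the embedded cell is
      \<open>A\<close>.\<close>
    define B where "B = torus_embedding_inv -` A"
    have B: "B \<in> sets borel" unfolding B_def using measurable_sets_borel[OF measurable_torus_embedding_inv Ab] .
    have ind: "indicator B (torus_embedding x) = (indicator A x :: real)" if "x \<in> space torus" for x
      using that torus_embedding_inv[of x] by (simp add: B_def indicator_def)
    have i: "integrable torus (\<lambda>x. \<beta> x * indicator A x)" "integrable torus (indicator A :: _ \<Rightarrow> real)"
      by (rule integrable_real_mult_indicator[OF A \<beta>])
        (rule integrable_const_bound[where B=1], auto simp: indicator_def)
    have "\<bar>\<integral>x. \<beta> x * indicator A x \<partial>torus\<bar> \<le> S * (\<integral>x. indicator A x \<partial>torus)"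
    proof -
      have "(\<integral>x. \<beta> x * indicator B (torus_embedding x) \<partial>torus) = (\<integral>x. \<beta> x * indicator A x \<partial>torus)"
        "(\<integral>x. indicator B (torus_embedding x) \<partial>torus) = (\<integral>x. (indicator A x :: real) \<partial>torus)"
        by (intro Bochner_Integration.integral_cong refl; simp only: ind)+
      with fourier_bound_borel[OF B] show ?thesis by (simp only:)
    qed
    moreover have "s * (\<integral>x. \<beta> x * indicator A x \<partial>torus) \<le> \<bar>s\<bar> * \<bar>\<integral>x. \<beta> x * indicator A x \<partial>torus\<bar>"
      unfolding abs_mult[symmetric] by simp
    ultimately have "(\<integral>x. s * (\<beta> x * indicator A x) - S * indicator A x \<partial>torus) \<le> 0"
      using i s by simp
    moreover have nn: "0 \<le> s * (\<beta> x * indicator A x) - S * indicator A x" for x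
      by (auto simp: A_def indicator_def)
    ultimately have "(\<integral>x. s * (\<beta> x * indicator A x) - S * indicator A x \<partial>torus) = 0"
      by (intro antisym integral_nonneg_AE AE_I2) auto
    then have "AE x in torus. s * (\<beta> x * indicator A x) - S * indicator A x = 0"
      using i nn by (subst (asm) integral_nonneg_eq_0_iff_AE) auto
    then show ?thesis
      using AE_space by eventually_elim (auto simp: A_def indicator_def split: if_splits)
  qed
  from this[of 1] this[of "-1"] show ?thesis by auto
qed

end

section \<open>Lattice sums and the Sobolev embedding\<close>

lemma sum_int_powr_bounded:
  fixes a :: real
  assumes "a > 1 / 2"
  obtains C where "\<And>n. (\<Sum>j\<in>{- int n..int n}. (1 + (real_of_int j)\<^sup>2) powr (- a)) \<le> C"
proof -
  let ?g = "\<lambda>j. (1 + (real_of_int j)\<^sup>2) powr (- a)"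
  have sm: "summable (\<lambda>n. real n powr (- 2 * a))" using assms by (subst summable_real_powr_iff) simp
  have g1: "?g (int n) \<le> (if n = 0 then 1 else 0) + real n powr (- 2 * a)" for n
  proof (cases "n = 0")
    case False
    have "?g (int n) \<le> ((real n)\<^sup>2) powr (- a)"
      using assms False by (intro powr_mono2') auto
    also have "\<dots> = real n powr (- 2 * a)"
      using False by (simp add: powr_powr flip: powr_numeral)
    finally show ?thesis using False by simp
  qed (use assms in simp)
  define D where "D = 1 + (\<Sum>n. real n powr (- 2 * a))"
  have s: "(\<Sum>n\<le>N. ?g (int n)) \<le> D" for N
  proof -
    have "(\<Sum>n\<le>N. ?g (int n)) \<le> (\<Sum>n\<le>N. (if n = 0 then 1 else 0) + real n powr (- 2 * a))"
      by (intro sum_mono g1)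
    also have "\<dots> = 1 + (\<Sum>n\<le>N. real n powr (- 2 * a))" by (simp add: sum.distrib)
    also have "\<dots> \<le> D" unfolding D_def by (intro add_left_mono sum_le_suminf sm) auto
    finally show ?thesis .
  qed
  have "(\<Sum>j\<in>{- int n..int n}. ?g j) \<le> D + D" for n
  proof -
    have "(\<Sum>j\<in>{- int n..int n}. ?g j) \<le> (\<Sum>j\<in>int ` {..n} \<union> (\<lambda>k. - int k) ` {..n}. ?g j)"
    proof (rule sum_mono2)
      show "{- int n..int n} \<subseteq> int ` {..n} \<union> (\<lambda>k. - int k) ` {..n}"
      proof
        fix j assume "j \<in> {- int n..int n}"
        then show "j \<in> int ` {..n} \<union> (\<lambda>k. - int k) ` {..n}"
          by (cases "j \<ge> 0") (auto intro: image_eqI[of _ _ "nat j"] image_eqI[of _ _ "nat (- j)"])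
      qed
    qed auto
    also have "\<dots> \<le> (\<Sum>j\<in>int ` {..n}. ?g j) + (\<Sum>j\<in>(\<lambda>k. - int k) ` {..n}. ?g j)"
      by (subst sum.union_inter[symmetric]) (auto intro: sum_nonneg)
    also have "\<dots> = (\<Sum>k\<le>n. ?g (int k)) + (\<Sum>k\<le>n. ?g (int k))"
      by (subst (1 2) sum.reindex) (auto simp: inj_on_def)
    finally show ?thesis using s[of n] by linarith
  qed
  then show ?thesis using that by blast
qed

text \<open>Reduction to one dimension: \<open>1 + (\<Sum>i. \<dots>)\<close> dominates each factor
  \<open>1 + (\<kappa> $ i)\<^sup>2\<close>, so the summand is at most a product over coordinates
  with exponent \<open>q / d\<close> each. Summed over a cube containing \<open>A\<close>, the
  product becomes a power of a sum over integers.\<close>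

lemma sum_lattice_powr_bounded:
  fixes q :: real
  assumes q: "q > real CARD('d::finite) / 2"
  obtains C where "\<And>A :: (int ^ 'd) set. finite A \<Longrightarrow>
    (\<Sum>\<kappa>\<in>A. (1 + (\<Sum>i\<in>UNIV. (real_of_int (\<kappa> $ i))\<^sup>2)) powr (- q)) \<le> C"
proof -
  let ?d = "real CARD('d)"
  \<comment> \<open>Distributing the exponent evenly is what turns \<open>q > d / 2\<close> into the
    one-dimensional condition \<open>a > 1 / 2\<close>.\<close>
  define a where "a = q / ?d"
  have d: "?d > 0" by simp
  have a: "a > 1 / 2" unfolding a_def using q d by (simp add: field_simps)
  obtain C where C: "\<And>n. (\<Sum>j\<in>{- int n..int n}. (1 + (real_of_int j)\<^sup>2) powr (- a)) \<le> C"
    using sum_int_powr_bounded[OF a] by blast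
  let ?g = "\<lambda>j. (1 + (real_of_int j)\<^sup>2) powr (- a)"
  have le: "(1 + (\<Sum>i\<in>UNIV. (real_of_int (\<kappa> $ i))\<^sup>2)) powr (- q) \<le> (\<Prod>i\<in>UNIV. ?g (\<kappa> $ i))" for \<kappa> :: "int ^ 'd"
  proof -
    let ?s = "1 + (\<Sum>i\<in>UNIV. (real_of_int (\<kappa> $ i))\<^sup>2)"
    have s: "?s > 0" by (intro add_pos_nonneg sum_nonneg) auto
    have "?s powr (- q) = (?s powr (- a)) powr ?d" unfolding a_def using d by (simp add: powr_powr)
    also have "\<dots> = (?s powr (- a)) ^ CARD('d)" using s by (simp add: powr_realpow)
    also have "\<dots> = (\<Prod>i\<in>(UNIV :: 'd set). ?s powr (- a))" by simp
    also have "\<dots> \<le> (\<Prod>i\<in>UNIV. ?g (\<kappa> $ i))"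
    proof (rule prod_mono, intro conjI)
      fix i
      have "(real_of_int (\<kappa> $ i))\<^sup>2 \<le> (\<Sum>i\<in>UNIV. (real_of_int (\<kappa> $ i))\<^sup>2)"
        by (rule member_le_sum) auto
      then show "?s powr (- a) \<le> ?g (\<kappa> $ i)" using a by (intro powr_mono2') (auto simp: add_pos_nonneg)
    qed simp
    finally show ?thesis .
  qed
  have "(\<Sum>\<kappa>\<in>A. (1 + (\<Sum>i\<in>UNIV. (real_of_int (\<kappa> $ i))\<^sup>2)) powr (- q)) \<le> C ^ CARD('d)" if A: "finite A" for A :: "(int ^ 'd) set"
  proof -
    define n where "n = nat (Max (insert 0 ((\<lambda>(\<kappa>, i). \<bar>\<kappa> $ i\<bar>) ` (A \<times> UNIV))))"
    have n: "\<bar>\<kappa> $ i\<bar> \<le> int n" if "\<kappa> \<in> A" for \<kappa> i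
    proof -
      have "\<bar>\<kappa> $ i\<bar> \<le> Max (insert 0 ((\<lambda>(\<kappa>, i). \<bar>\<kappa> $ i\<bar>) ` (A \<times> UNIV)))"
        using A that by (intro Max_ge) auto
      moreover from this have "0 \<le> Max (insert 0 ((\<lambda>(\<kappa>, i). \<bar>\<kappa> $ i\<bar>) ` (A \<times> UNIV)))"
        by (rule order_trans[OF abs_ge_zero])
      ultimately show ?thesis unfolding n_def by (simp only: nat_0_le)
    qed
    have "(\<Sum>\<kappa>\<in>A. (1 + (\<Sum>i\<in>UNIV. (real_of_int (\<kappa> $ i))\<^sup>2)) powr (- q)) \<le> (\<Sum>\<kappa>\<in>A. \<Prod>i\<in>UNIV. ?g (\<kappa> $ i))"
      by (intro sum_mono le)
    also have "\<dots> = (\<Sum>f\<in>vec_nth ` A. \<Prod>i\<in>UNIV. ?g (f i))"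
      by (subst sum.reindex) (auto simp: inj_on_def vec_eq_iff)
    also have "\<dots> \<le> (\<Sum>f\<in>PiE UNIV (\<lambda>_ :: 'd. {- int n..int n}). \<Prod>i\<in>UNIV. ?g (f i))"
      using n by (intro sum_mono2 finite_PiE) (auto intro!: prod_nonneg simp: abs_le_iff, (smt (verit))+)
    also have "\<dots> = (\<Prod>i\<in>(UNIV :: 'd set). \<Sum>j\<in>{- int n..int n}. ?g j)"
      by (rule prod_sum_PiE[symmetric]) auto
    also have "\<dots> \<le> C ^ CARD('d)"
      using C[of n] by (simp add: power_mono sum_nonneg)
    finally show ?thesis .
  qed
  then show ?thesis using that by blast
qed

text \<open>Weighting with \<open>u = w powr (q / 2)\<close> and
  \<open>x * y \<le> x\<^sup>2 + y\<^sup>2\<close> bounds the modulus of a coefficient by its term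
  in the Sobolev sum plus \<open>w powr (- q)\<close>. Finite sums of both are bounded, the second
  by the lattice estimate, so the Fourier coefficients are absolutely summable.\<close>

lemma sobolev_AE_bounded:
  fixes \<beta> :: "real ^ 'd::finite \<Rightarrow> real"
  assumes \<beta>: "\<beta> \<in> sobolev q" and q: "q > real CARD('d) / 2"
  obtains B where "B \<ge> 0" "AE x in torus. \<bar>\<beta> x\<bar> \<le> B"
proof -
  interpret finite_measure "torus :: (real ^ 'd) measure" by (rule finite_measure_torus)
  let ?w = "\<lambda>\<kappa> :: int ^ 'd. 1 + (\<Sum>i\<in>UNIV. (real_of_int (\<kappa> $ i))\<^sup>2)"
  let ?h = "\<lambda>\<kappa>. ?w \<kappa> powr q * (cmod (fourier_coeff \<beta> \<kappa>))\<^sup>2"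
  have b2: "\<beta> \<in> borel_measurable torus" "integrable torus (\<lambda>x. \<bar>\<beta> x\<bar>\<^sup>2)" and sm: "?h summable_on UNIV"
    using \<beta> unfolding sobolev_def Lp_space_def by auto
  have bi: "integrable torus \<beta>"
  proof (rule Bochner_Integration.integrable_bound)
    show "integrable torus (\<lambda>x. 1 + \<bar>\<beta> x\<bar>\<^sup>2)" using b2 by (intro Bochner_Integration.integrable_add) auto
    have "\<bar>y\<bar> \<le> 1 + \<bar>y\<bar>\<^sup>2" for y :: real
      using zero_le_power2[of "\<bar>y\<bar> - 1 / 2"] by (simp add: power2_eq_square algebra_simps)
    then show "AE x in torus. norm (\<beta> x) \<le> norm (1 + \<bar>\<beta> x\<bar>\<^sup>2)" by (intro AE_I2) simp
  qed (use b2 in simp)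
  obtain C where C: "\<And>A :: (int ^ 'd) set. finite A \<Longrightarrow> (\<Sum>\<kappa>\<in>A. ?w \<kappa> powr (- q)) \<le> C"
    using sum_lattice_powr_bounded[OF q] by blast
  have le: "cmod (fourier_coeff \<beta> \<kappa>) \<le> ?h \<kappa> + ?w \<kappa> powr (- q)" for \<kappa>
  proof -
    have w: "?w \<kappa> > 0" by (intro add_pos_nonneg sum_nonneg) auto
    define u where "u = ?w \<kappa> powr (q / 2)"
    have u: "u > 0" "u\<^sup>2 = ?w \<kappa> powr q"
      unfolding u_def power2_eq_square[of "_ powr _"] powr_add[symmetric] using w by auto
    have u': "(1 / u)\<^sup>2 = ?w \<kappa> powr (- q)"
      by (simp only: power_divide u powr_minus_divide power_one)
    let ?b = "cmod (fourier_coeff \<beta> \<kappa>)"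
    have "?b = (u * ?b) * (1 / u)" using u by simp
    also have "\<dots> \<le> (u * ?b)\<^sup>2 + (1 / u)\<^sup>2"
    proof -
      have "x * y \<le> x\<^sup>2 + y\<^sup>2" for x y :: real
        using sum_squares_bound[of x y] zero_le_power2[of x] zero_le_power2[of y] by linarith
      then show ?thesis .
    qed
    finally show ?thesis unfolding power_mult_distrib u u' .
  qed
  define S where "S = infsum ?h UNIV + C"
  have S: "(\<Sum>\<kappa>\<in>A. cmod (fourier_coeff \<beta> \<kappa>)) \<le> S" if A: "finite A" for A
  proof -
    have "(\<Sum>\<kappa>\<in>A. cmod (fourier_coeff \<beta> \<kappa>)) \<le> (\<Sum>\<kappa>\<in>A. ?h \<kappa>) + (\<Sum>\<kappa>\<in>A. ?w \<kappa> powr (- q))"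
      unfolding sum.distrib[symmetric] by (intro sum_mono le)
    also have "\<dots> \<le> S" unfolding S_def
      by (intro add_mono C A finite_sum_le_infsum sm) auto
    finally show ?thesis .
  qed
  show ?thesis by (rule that[OF fourier_bound_nonneg[OF bi S] AE_abs_le_fourier_sum[OF bi S]])
qed

section \<open>An \<open>L\<^sup>2\<close> bound for stochastic integrals\<close>

text \<open>The norm of a matrix as an element of \<open>real ^ 'k ^ 'm\<close> is the Frobenius
  norm; Cauchy-Schwarz is applied to each row.\<close>

lemma norm_matrix_vector_mult_le:
  fixes A :: "real ^ 'k ^ 'm"
  shows "norm (A *v x) \<le> norm A * norm x"
proof -
  have "(norm (A *v x))\<^sup>2 = (\<Sum>i\<in>UNIV. (A $ i \<bullet> x)\<^sup>2)"
    unfolding power2_norm_eq_inner inner_vec_def[of "A *v x"]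
    by (simp add: matrix_vector_mult_def inner_vec_def power2_eq_square)
  also have "\<dots> \<le> (\<Sum>i\<in>UNIV. (norm (A $ i))\<^sup>2 * (norm x)\<^sup>2)"
    by (intro sum_mono) (simp add: Cauchy_Schwarz_ineq power2_norm_eq_inner)
  also have "\<dots> = (norm A * norm x)\<^sup>2"
    unfolding power_mult_distrib power2_norm_eq_inner[of A] inner_vec_def[of A A]
    by (simp add: sum_distrib_right power2_norm_eq_inner)
  finally show ?thesis
    by (rule power2_le_imp_le) simp
qed

lemma borel_measurable_matrix_vector_mult [measurable]:
  fixes A :: "'a \<Rightarrow> real ^ 'k ^ 'm"
  assumes "A \<in> borel_measurable M" "x \<in> borel_measurable M"
  shows "(\<lambda>w. A w *v x w) \<in> borel_measurable M"
proof (rule borel_measurable_continuous_Pair[OF assms])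
  show "continuous_on UNIV (\<lambda>x::(real ^ 'k ^ 'm) \<times> (real ^ 'k). fst x *v snd x)"
    unfolding matrix_vector_mult_def by (intro continuous_intros)
qed

lemma borel_measurable_vector_matrix_mult [measurable]:
  fixes A :: "'a \<Rightarrow> real ^ 'k ^ 'm"
  assumes "A \<in> borel_measurable M" "x \<in> borel_measurable M"
  shows "(\<lambda>w. x w v* A w) \<in> borel_measurable M"
proof (rule borel_measurable_continuous_Pair[OF assms])
  show "continuous_on UNIV (\<lambda>x::(real ^ 'k ^ 'm) \<times> (real ^ 'm). snd x v* fst x)"
    unfolding vector_matrix_mult_def by (intro continuous_intros)
qed

lemma borel_measurable_vec_nth' [measurable]:
  fixes f :: "'a \<Rightarrow> real ^ 'k"
  assumes "f \<in> borel_measurable M"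
  shows "(\<lambda>w. f w $ i) \<in> borel_measurable M"
  using measurable_compose[OF assms borel_measurable_continuous_onI[of "\<lambda>x. x $ i"]]
  by (simp add: continuous_intros)

section \<open>Gaussian marginals and moments of Wiener increments\<close>

lemma nn_integral_lborel_vec_prod:
  fixes f :: "'k::finite \<Rightarrow> real \<Rightarrow> ennreal"
  assumes [measurable]: "\<And>i. f i \<in> borel_measurable borel"
  shows "(\<integral>\<^sup>+y. (\<Prod>i\<in>UNIV. f i (y $ i)) \<partial>(lborel :: (real ^ 'k) measure)) = (\<Prod>i\<in>UNIV. \<integral>\<^sup>+x. f i x \<partial>lborel)"
proof -
  define ix where "ix = (\<lambda>b :: real ^ 'k. SOME i. b = axis i 1)"
  have ix: "ix (axis i 1) = i" for i
    unfolding ix_def by (simp add: axis_eq_axis)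
  have B: "(Basis :: (real ^ 'k) set) = (\<lambda>i. axis i 1) ` UNIV"
    unfolding Basis_vec_def by auto
  have inj: "inj (\<lambda>i::'k. axis i (1::real))"
    by (auto simp: inj_on_def axis_eq_axis)
  have "(\<integral>\<^sup>+y. (\<Prod>b\<in>Basis. f (ix b) (y \<bullet> b)) \<partial>(lborel :: (real ^ 'k) measure)) = (\<Prod>b\<in>(Basis :: (real ^ 'k) set). \<integral>\<^sup>+x. f (ix b) x \<partial>lborel)"
    by (rule nn_integral_lborel_prod) auto
  then show ?thesis
    unfolding B prod.reindex[OF inj] by (simp add: ix inner_axis o_def)
qed

text \<open>The marginal law of one component: every other factor of the product density integrates
  to 1.\<close>

lemma nn_integral_gaussian_component:
  fixes g :: "real \<Rightarrow> ennreal" and j :: "'k::finite"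
  assumes [measurable]: "g \<in> borel_measurable borel" and s: "s > 0"
  shows "(\<integral>\<^sup>+y. ennreal (\<Prod>i\<in>UNIV. normal_density 0 s (y $ i)) * g (y $ j) \<partial>(lborel :: (real ^ 'k) measure)) =
    (\<integral>\<^sup>+x. ennreal (normal_density 0 s x) * g x \<partial>lborel)"
proof -
  let ?f = "\<lambda>i x. if i = j then ennreal (normal_density 0 s x) * g x else ennreal (normal_density 0 s x)"
  have nd: "(\<integral>\<^sup>+x. ennreal (normal_density 0 s x) \<partial>lborel) = 1"
    using s prob_space.emeasure_space_1[OF prob_space_normal_density[OF s, of 0]] by (simp add: emeasure_density)
  have "(\<Prod>i\<in>UNIV. ?f i (y $ i)) = ennreal (\<Prod>i\<in>UNIV. normal_density 0 s (y $ i)) * g (y $ j)" for y :: "real ^ 'k"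
    by (subst (1 2) prod.remove[of _ j])
      (auto simp: prod_ennreal[symmetric] ennreal_mult prod_nonneg ac_simps intro!: prod.cong)
  then have "(\<integral>\<^sup>+y. ennreal (\<Prod>i\<in>UNIV. normal_density 0 s (y $ i)) * g (y $ j) \<partial>(lborel :: (real ^ 'k) measure)) =
      (\<integral>\<^sup>+y. (\<Prod>i\<in>UNIV. ?f i (y $ i)) \<partial>(lborel :: (real ^ 'k) measure))" by simp
  also have "\<dots> = (\<Prod>i\<in>UNIV. \<integral>\<^sup>+x. ?f i x \<partial>lborel)"
    by (rule nn_integral_lborel_vec_prod) auto
  also have "\<dots> = (\<integral>\<^sup>+x. ennreal (normal_density 0 s x) * g x \<partial>lborel)"
    by (subst prod.remove[of _ j]) (auto simp: nd)
  finally show ?thesis .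
qed

locale wiener_space = prob_space M for M :: "'a measure" +
  fixes T :: real and F :: "real \<Rightarrow> 'a measure" and W :: "real \<Rightarrow> 'a \<Rightarrow> real ^ 'k::finite"
  assumes filt: "filtration_on M T F" and wien: "wiener_process M T F W"
begin

lemma measurable_F_M: "0 \<le> t \<Longrightarrow> t \<le> T \<Longrightarrow> f \<in> F t \<rightarrow>\<^sub>M N \<Longrightarrow> f \<in> M \<rightarrow>\<^sub>M N"
  using filt unfolding filtration_on_def by (auto intro: measurable_from_subalg)

lemma measurable_F_mono: "0 \<le> s \<Longrightarrow> s \<le> t \<Longrightarrow> t \<le> T \<Longrightarrow> f \<in> F s \<rightarrow>\<^sub>M N \<Longrightarrow> f \<in> F t \<rightarrow>\<^sub>M N"
  using filt unfolding filtration_on_def subalgebra_def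
  by (intro measurable_mono[of N N "F s" "F t", THEN subsetD]) auto

lemma W_measurable_F: "0 \<le> t \<Longrightarrow> t \<le> T \<Longrightarrow> W t \<in> borel_measurable (F t)"
  using wien unfolding wiener_process_def by auto

lemma W_measurable: "0 \<le> t \<Longrightarrow> t \<le> T \<Longrightarrow> W t \<in> borel_measurable M"
  using W_measurable_F measurable_F_M by blast

lemma space_F: "0 \<le> t \<Longrightarrow> t \<le> T \<Longrightarrow> space (F t) = space M"
  using filt unfolding filtration_on_def subalgebra_def by auto

text \<open>\<open>f\<close> of the increment generates a sub-sigma-algebra of that of the
  increment, and \<open>U\<close> one of \<open>F s\<close>; independence passes to smaller
  families. This brings the set form of independence in \<open>wiener_process\<close> into the form
  needed for expectations of products.\<close>

lemma indep_increment:
  assumes st: "0 \<le> s" "s < t" "t \<le> T" and U: "U \<in> borel_measurable (F s)"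
    and f: "f \<in> borel_measurable borel"
  shows "indep_var borel U borel (\<lambda>w. f (W t w - W s w))"
proof -
  have Ws [measurable]: "W s \<in> borel_measurable M" and Wt [measurable]: "W t \<in> borel_measurable M"
    using st by (auto intro!: W_measurable)
  note [measurable] = f
  have UM [measurable]: "U \<in> borel_measurable M"
    using measurable_F_M[of s] U st by auto
  let ?D = "\<lambda>w. W t w - W s w"
  let ?B = "{?D -` B \<inter> space M | B. B \<in> sets borel}"
  have ind: "indep_set (sets (F s)) ?B"
    using wien st unfolding wiener_process_def by blast
  have Bs: "?B = sets (vimage_algebra (space M) ?D borel)"
    by (rule sets_vimage_algebra2[symmetric]) auto
  have sub: "sigma_sets (space M) {(\<lambda>w. f (?D w)) -` A \<inter> space M |A. A \<in> sets borel} \<subseteq> ?B"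
    unfolding Bs
  proof (rule sets.sigma_sets_subset'[of _ "vimage_algebra (space M) ?D borel" "space M"])
    show "{(\<lambda>w. f (?D w)) -` A \<inter> space M |A. A \<in> sets borel} \<subseteq> sets (vimage_algebra (space M) ?D borel)"
      unfolding Bs[symmetric] using measurable_sets_borel[OF f] by (auto simp: vimage_def)
    show "space M \<in> sets (vimage_algebra (space M) ?D borel)"
      unfolding Bs[symmetric] by auto (metis UNIV_I sets.top space_borel vimage_UNIV inf_top.left_neutral)
  qed
  have sub2: "sigma_sets (space M) {U -` A \<inter> space M |A. A \<in> sets borel} \<subseteq> sets (F s)"
    using space_F[of s] st measurable_sets[OF U] sets.top[of "F s"]
    by (intro sets.sigma_sets_subset') auto
  have "indep_set (sigma_sets (space M) {U -` A \<inter> space M |A. A \<in> sets borel})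
     (sigma_sets (space M) {(\<lambda>w. f (?D w)) -` A \<inter> space M |A. A \<in> sets borel})"
    using ind unfolding indep_set_def
    by (rule indep_sets_mono_sets) (use sub sub2 in \<open>auto split: bool.split\<close>)
  then show ?thesis
    unfolding indep_var_eq using st by auto
qed

lemma increment_distributed:
  assumes st: "0 \<le> s" "s < t" "t \<le> T"
  shows "distributed M lborel (\<lambda>w. (W t w - W s w) $ j) (normal_density 0 (sqrt (t - s)))"
proof -
  have Ws [measurable]: "W s \<in> borel_measurable M" and Wt [measurable]: "W t \<in> borel_measurable M"
    using st by (auto intro!: W_measurable)
  let ?D = "\<lambda>w. W t w - W s w"
  let ?p = "\<lambda>y. ennreal (\<Prod>i\<in>UNIV. normal_density 0 (sqrt (t - s)) (y $ i))"
  have dist: "distributed M lborel ?D ?p"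
    using wien st unfolding wiener_process_def by blast
  have [measurable]: "?D \<in> borel_measurable M" by measurable
  show ?thesis
    unfolding distributed_def
  proof (intro conjI measure_eqI)
    fix A assume "A \<in> sets (distr M lborel (\<lambda>w. ?D w $ j))"
    then have [measurable]: "A \<in> sets borel" by simp
    have "emeasure (distr M lborel (\<lambda>w. ?D w $ j)) A = (\<integral>\<^sup>+w. indicator A (?D w $ j) \<partial>M)"
      by (subst nn_integral_indicator[symmetric], simp, subst nn_integral_distr) auto
    also have "\<dots> = (\<integral>\<^sup>+y. ?p y * indicator A (y $ j) \<partial>lborel)"
      by (rule distributed_nn_integral[OF dist, symmetric]) simp
    also have "\<dots> = (\<integral>\<^sup>+x. ennreal (normal_density 0 (sqrt (t - s)) x) * indicator A x \<partial>lborel)"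
      using st by (intro nn_integral_gaussian_component) auto
    finally show "emeasure (distr M lborel (\<lambda>w. ?D w $ j)) A = emeasure (density lborel (normal_density 0 (sqrt (t - s)))) A"
      by (simp add: emeasure_density)
  qed auto
qed

lemma increment_moments:
  assumes st: "0 \<le> s" "s < t" "t \<le> T"
  shows "integrable M (\<lambda>w. (W t w - W s w) $ j)"
    and "expectation (\<lambda>w. (W t w - W s w) $ j) = 0"
    and "integrable M (\<lambda>w. ((W t w - W s w) $ j)\<^sup>2)"
    and "expectation (\<lambda>w. ((W t w - W s w) $ j)\<^sup>2) = t - s"
    and "integrable M (\<lambda>w. ((W t w - W s w) $ j) ^ 4)"
    and "expectation (\<lambda>w. ((W t w - W s w) $ j) ^ 4) = 3 * (t - s)\<^sup>2"
proof -
  have s: "sqrt (t - s) > 0" using st by simp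
  note D = increment_distributed[OF st, of j]
  have mom: "has_bochner_integral M (\<lambda>w. g ((W t w - W s w) $ j)) c"
    if h: "has_bochner_integral lborel (\<lambda>x. normal_density 0 (sqrt (t - s)) x * g x) c"
      and [measurable]: "g \<in> borel_measurable borel" for g and c :: real
    using h distributed_integrable[OF D, of g] distributed_integral[OF D, of g] s
    by (auto simp: has_bochner_integral_iff)
  show "integrable M (\<lambda>w. (W t w - W s w) $ j)" "expectation (\<lambda>w. (W t w - W s w) $ j) = 0"
    using mom[of "\<lambda>x. x" 0] normal_moment_odd[OF s, of 0 0] by (auto simp: has_bochner_integral_iff)
  show "integrable M (\<lambda>w. ((W t w - W s w) $ j)\<^sup>2)" "expectation (\<lambda>w. ((W t w - W s w) $ j)\<^sup>2) = t - s"
    using mom[of "\<lambda>x. x^2" "t - s"] normal_moment_even[OF s, of 0 1] st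
    by (auto simp: has_bochner_integral_iff)
  \<comment> \<open>The left side is the constant in which \<open>normal_moment_even\<close> states
    the fourth moment.\<close>
  have "fact (2 * 2) / ((2 / (sqrt (t - s))\<^sup>2) ^ 2 * fact 2) = 3 * (t - s)\<^sup>2"
    using st by (simp add: fact_numeral field_simps)
  then show "integrable M (\<lambda>w. ((W t w - W s w) $ j) ^ 4)" "expectation (\<lambda>w. ((W t w - W s w) $ j) ^ 4) = 3 * (t - s)\<^sup>2"
    using mom[of "\<lambda>x. x^4" "3 * (t - s)\<^sup>2"] normal_moment_even[OF s, of 0 2] 
    by (auto simp: has_bochner_integral_iff)
qed

lemma increment_norm_moments:
  assumes st: "0 \<le> s" "s \<le> t" "t \<le> T"
  shows "integrable M (\<lambda>w. (norm (W t w - W s w))\<^sup>2)"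
    and "expectation (\<lambda>w. (norm (W t w - W s w))\<^sup>2) = real CARD('k) * (t - s)"
    and "integrable M (\<lambda>w. (norm (W t w - W s w)) ^ 4)"
    and "expectation (\<lambda>w. (norm (W t w - W s w)) ^ 4) \<le> 3 * (real CARD('k) * (t - s))\<^sup>2"
proof -
  have Ws [measurable]: "W s \<in> borel_measurable M" and Wt [measurable]: "W t \<in> borel_measurable M"
    using st by (auto intro!: W_measurable)
  have Dm[measurable]: "(\<lambda>w. W t w - W s w) \<in> borel_measurable M" by measurable
  have eq: "(norm x)\<^sup>2 = (\<Sum>j\<in>UNIV. (x $ j)\<^sup>2)" for x :: "real ^ 'k"
    unfolding power2_norm_eq_inner inner_vec_def by (simp add: power2_eq_square)
  have le: "(norm x) ^ 4 \<le> (\<Sum>j\<in>UNIV. real CARD('k) * (x $ j) ^ 4)" for x :: "real ^ 'k"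
  proof -
    have "(norm x) ^ 4 = (\<Sum>j\<in>UNIV. (x $ j)\<^sup>2)\<^sup>2"
      unfolding eq[symmetric] by simp
    also have "\<dots> \<le> real CARD('k) * (\<Sum>j\<in>UNIV. ((x $ j)\<^sup>2)\<^sup>2)"
      using sum_squared_le_sum_of_squares[of "\<lambda>j. (x $ j)\<^sup>2" UNIV] by (simp add: mult.commute)
    finally show ?thesis by (simp add: sum_distrib_left)
  qed
  have "integrable M (\<lambda>w. (norm (W t w - W s w))\<^sup>2) \<and>
    expectation (\<lambda>w. (norm (W t w - W s w))\<^sup>2) = real CARD('k) * (t - s) \<and>
    integrable M (\<lambda>w. (norm (W t w - W s w)) ^ 4) \<and>
    expectation (\<lambda>w. (norm (W t w - W s w)) ^ 4) \<le> 3 * (real CARD('k) * (t - s))\<^sup>2"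
  proof (cases "s = t")
    case False
    with st have st': "0 \<le> s" "s < t" "t \<le> T" by auto
    note m = increment_moments[OF st']
    have i4: "integrable M (\<lambda>w. \<Sum>j\<in>UNIV. real CARD('k) * ((W t w - W s w) $ j) ^ 4)"
      using m(5) by (intro Bochner_Integration.integrable_sum integrable_mult_right) auto
    have n4: "integrable M (\<lambda>w. (norm (W t w - W s w)) ^ 4)"
      by (rule Bochner_Integration.integrable_bound[OF i4])
        (auto intro!: AE_I2 order_trans[OF le] sum_nonneg)
    have "expectation (\<lambda>w. (norm (W t w - W s w)) ^ 4) \<le> (\<integral>w. (\<Sum>j\<in>UNIV. real CARD('k) * ((W t w - W s w) $ j) ^ 4) \<partial>M)"
      by (intro integral_mono n4 i4 le)
    also have "\<dots> = (\<Sum>j\<in>(UNIV::'k set). real CARD('k) * (3 * (t - s)\<^sup>2))"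
      using m(5,6) by (subst Bochner_Integration.integral_sum) auto
    also have "\<dots> = 3 * (real CARD('k) * (t - s))\<^sup>2"
      by (simp add: power2_eq_square)
    finally show ?thesis
      using n4 m unfolding eq by (subst Bochner_Integration.integral_sum) auto
  qed auto
  then show "integrable M (\<lambda>w. (norm (W t w - W s w))\<^sup>2)"
    and "expectation (\<lambda>w. (norm (W t w - W s w))\<^sup>2) = real CARD('k) * (t - s)"
    and "integrable M (\<lambda>w. (norm (W t w - W s w)) ^ 4)"
    and "expectation (\<lambda>w. (norm (W t w - W s w)) ^ 4) \<le> 3 * (real CARD('k) * (t - s))\<^sup>2"
    by auto
qed


text \<open>
  The factor \<open>CARD('k)\<close> is not sharp, but this bound needs no independence between the components
  of an increment.
\<close>

lemma ito_step:
  fixes S :: "'a \<Rightarrow> real ^ 'm" and z :: "'a \<Rightarrow> real ^ 'k ^ 'm"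
  assumes st: "0 \<le> s" "s \<le> t" "t \<le> T"
    and S: "S \<in> borel_measurable (F s)" "integrable M (\<lambda>w. (norm (S w))\<^sup>2)"
    and z: "z \<in> borel_measurable (F s)" "\<And>w. w \<in> space M \<Longrightarrow> norm (z w) \<le> C"
  shows "integrable M (\<lambda>w. (norm (S w + z w *v (W t w - W s w)))\<^sup>2)"
    and "expectation (\<lambda>w. (norm (S w + z w *v (W t w - W s w)))\<^sup>2) \<le>
      expectation (\<lambda>w. (norm (S w))\<^sup>2) + real CARD('k) * (t - s) * expectation (\<lambda>w. (norm (z w))\<^sup>2)"
proof -
  have Ws [measurable]: "W s \<in> borel_measurable M" and Wt [measurable]: "W t \<in> borel_measurable M"
    using st by (auto intro!: W_measurable)
  have SM [measurable]: "S \<in> borel_measurable M" and zM [measurable]: "z \<in> borel_measurable M"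
    using S(1) z(1) st by (auto intro: measurable_F_M[of s])
  note SF [measurable] = S(1) and zF [measurable] = z(1)
  let ?D = "\<lambda>w. W t w - W s w"
  have z2: "integrable M (\<lambda>w. (norm (z w))\<^sup>2)"
  proof (rule integrable_const_bound[where B="C\<^sup>2"])
    show "AE w in M. norm ((norm (z w))\<^sup>2) \<le> C\<^sup>2"
      using z(2) by (intro AE_I2) (auto intro: power_mono)
  qed simp
  have "(integrable M (\<lambda>w. (norm (S w + z w *v ?D w))\<^sup>2)) \<and>
    expectation (\<lambda>w. (norm (S w + z w *v ?D w))\<^sup>2) \<le>
      expectation (\<lambda>w. (norm (S w))\<^sup>2) + real CARD('k) * (t - s) * expectation (\<lambda>w. (norm (z w))\<^sup>2)"
  proof (cases "s = t")
    case True
    then show ?thesis using S z2 by simp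
  next
    case False
    with st have st': "0 \<le> s" "s < t" "t \<le> T" by auto
    note m = increment_moments[OF st'] and nm = increment_norm_moments[OF st]
    have zDind: "indep_var borel (\<lambda>w. (norm (z w))\<^sup>2) borel (\<lambda>w. (norm (?D w))\<^sup>2)"
      by (rule indep_increment[OF st', of "\<lambda>w. (norm (z w))\<^sup>2" "\<lambda>x. (norm x)\<^sup>2"]) measurable
    have zDi: "integrable M (\<lambda>w. (norm (z w))\<^sup>2 * (norm (?D w))\<^sup>2)"
      by (rule indep_var_integrable[OF zDind z2 nm(1)])
    have zDe: "expectation (\<lambda>w. (norm (z w))\<^sup>2 * (norm (?D w))\<^sup>2) = expectation (\<lambda>w. (norm (z w))\<^sup>2) * (real CARD('k) * (t - s))"
      using indep_var_lebesgue_integral[OF zDind z2 nm(1)] nm(2) by simp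
    have zD2le: "(norm (z w *v ?D w))\<^sup>2 \<le> (norm (z w))\<^sup>2 * (norm (?D w))\<^sup>2" for w
      unfolding power_mult_distrib[symmetric] by (intro power_mono norm_matrix_vector_mult_le) auto
    have zD2: "integrable M (\<lambda>w. (norm (z w *v ?D w))\<^sup>2)"
      by (rule Bochner_Integration.integrable_bound[OF zDi]) (auto intro!: AE_I2 zD2le)
    \<comment> \<open>Moving the matrix to the other side of the inner product separates the
      variables: the cross term is a sum of products of a component of \<open>U\<close>, measurable
      for \<open>F s\<close>, with an independent centred component of the increment. The bounds on
      \<open>S\<close> and \<open>z\<close> make \<open>U\<close> integrable, so its expectation
      vanishes.\<close>
    define U where "U = (\<lambda>w. S w v* z w)"
    have UF [measurable]: "U \<in> borel_measurable (F s)" unfolding U_def by measurable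
    have UM [measurable]: "U \<in> borel_measurable M" unfolding U_def by measurable
    have Ub: "\<bar>U w $ j\<bar> \<le> (1 + (norm (S w))\<^sup>2) * C" if "w \<in> space M" for w j
    proof -
      have "U w $ j = S w \<bullet> (z w *v axis j 1)"
        unfolding U_def dot_lmul_matrix[symmetric] by (simp add: inner_axis)
      then have "\<bar>U w $ j\<bar> \<le> norm (S w) * norm (z w *v axis j 1)"
        using Cauchy_Schwarz_ineq2 by auto
      also have "\<dots> \<le> norm (S w) * (norm (z w) * norm (axis j (1::real)))"
        by (intro mult_left_mono norm_matrix_vector_mult_le) simp
      also have "\<dots> \<le> (1 + (norm (S w))\<^sup>2) * C"
      proof (intro mult_mono)
        show "norm (S w) \<le> 1 + (norm (S w))\<^sup>2"
          using sum_squares_bound[of "norm (S w)" 1] by (simp add: power2_eq_square) (smt (verit) mult_nonneg_nonneg norm_ge_zero)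
      qed (use z(2)[OF that] in \<open>auto intro: order_trans[OF norm_ge_zero]\<close>)
      finally show ?thesis .
    qed
    have Ui: "integrable M (\<lambda>w. U w $ j)" for j
    proof (rule Bochner_Integration.integrable_bound)
      show "integrable M (\<lambda>w. (1 + (norm (S w))\<^sup>2) * C)" using S(2) by simp
      show "AE w in M. norm (U w $ j) \<le> norm ((1 + (norm (S w))\<^sup>2) * C)"
        unfolding real_norm_def by (intro AE_I2 order_trans[OF Ub abs_ge_self])
    qed simp
    have ind: "indep_var borel (\<lambda>w. U w $ j) borel (\<lambda>w. ?D w $ j)" for j
      by (rule indep_increment[OF st', of "\<lambda>w. U w $ j" "\<lambda>x. x $ j"]) measurable
    have cross: "S w \<bullet> (z w *v ?D w) = (\<Sum>j\<in>UNIV. U w $ j * ?D w $ j)" for w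
      unfolding dot_lmul_matrix[symmetric] by (simp add: inner_vec_def U_def)
    have ci: "integrable M (\<lambda>w. S w \<bullet> (z w *v ?D w))"
      unfolding cross using indep_var_integrable[OF ind Ui m(1)] by auto
    have ce: "expectation (\<lambda>w. S w \<bullet> (z w *v ?D w)) = 0"
      unfolding cross using indep_var_integrable[OF ind Ui m(1)] indep_var_lebesgue_integral[OF ind Ui m(1)]
      by (subst Bochner_Integration.integral_sum) (auto simp: m(2)[simplified])
    have eq: "(norm (S w + z w *v ?D w))\<^sup>2 = (norm (S w))\<^sup>2 + 2 * (S w \<bullet> (z w *v ?D w)) + (norm (z w *v ?D w))\<^sup>2" for w
      unfolding power2_norm_eq_inner by (simp add: inner_add_left inner_add_right inner_commute)
    have "expectation (\<lambda>w. (norm (S w + z w *v ?D w))\<^sup>2) =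
        expectation (\<lambda>w. (norm (S w))\<^sup>2) + expectation (\<lambda>w. (norm (z w *v ?D w))\<^sup>2)"
      unfolding eq using S(2) ci zD2 ce by simp
    also have "\<dots> \<le> expectation (\<lambda>w. (norm (S w))\<^sup>2) + expectation (\<lambda>w. (norm (z w))\<^sup>2 * (norm (?D w))\<^sup>2)"
      using zD2 zDi zD2le by (intro add_left_mono integral_mono) auto
    finally show ?thesis
      unfolding zDe using S(2) ci zD2 unfolding eq by (auto simp: mult_ac)
  qed
  then show "integrable M (\<lambda>w. (norm (S w + z w *v ?D w))\<^sup>2)"
    and "expectation (\<lambda>w. (norm (S w + z w *v ?D w))\<^sup>2) \<le>
      expectation (\<lambda>w. (norm (S w))\<^sup>2) + real CARD('k) * (t - s) * expectation (\<lambda>w. (norm (z w))\<^sup>2)"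
    by auto
qed

lemma elementary_process_times:
  assumes "elementary_process M F t N \<tau> \<xi>" "i \<le> j" "j \<le> N"
  shows "\<tau> i \<le> \<tau> j"
  using assms(2,3)
proof (induction rule: dec_induct)
  case (step j)
  then show ?case using assms(1) unfolding elementary_process_def
    by (meson Suc_le_lessD Suc_leD order_trans)
qed simp

lemma elementary_process_range:
  assumes "elementary_process M F t N \<tau> \<xi>" "j \<le> N"
  shows "0 \<le> \<tau> j" "\<tau> j \<le> t"
  using elementary_process_times[OF assms(1), of 0 j] elementary_process_times[OF assms(1), of j N] assms
  unfolding elementary_process_def by auto

text \<open>Induction over the partial sums with \<open>ito_step\<close>. Measurability for
  \<open>F (\<tau> K)\<close> is carried along because the next step needs the sum so far to belong
  to the past.\<close>

lemma ito_sum: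
  fixes \<xi> :: "nat \<Rightarrow> 'a \<Rightarrow> real ^ 'k ^ 'm"
  assumes e: "elementary_process M F t N \<tau> \<xi>" and t: "t \<le> T" and K: "K \<le> N"
  shows "elementary_integral W K \<tau> \<xi> \<in> borel_measurable (F (\<tau> K)) \<and>
    integrable M (\<lambda>w. (norm (elementary_integral W K \<tau> \<xi> w))\<^sup>2) \<and>
    expectation (\<lambda>w. (norm (elementary_integral W K \<tau> \<xi> w))\<^sup>2) \<le>
      real CARD('k) * (\<Sum>i<K. (\<tau> (Suc i) - \<tau> i) * expectation (\<lambda>w. (norm (\<xi> i w))\<^sup>2))"
  using K
proof (induction K)
  case 0
  then show ?case by (simp add: elementary_integral_def[abs_def])
next
  case (Suc K)
  then have KN: "K < N" and K: "K \<le> N" by auto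
  note IH = Suc.IH[OF K]
  have \<tau>: "0 \<le> \<tau> K" "\<tau> K \<le> \<tau> (Suc K)" "\<tau> (Suc K) \<le> T"
    using elementary_process_range[OF e, of K] elementary_process_range[OF e, of "Suc K"]
      elementary_process_times[OF e, of K "Suc K"] KN t by auto
  have \<xi>F: "\<xi> K \<in> borel_measurable (F (\<tau> K))" using e KN unfolding elementary_process_def by auto
  obtain C where C: "\<And>w. w \<in> space M \<Longrightarrow> norm (\<xi> K w) \<le> C"
    using e KN unfolding elementary_process_def by blast
  have eq: "elementary_integral W (Suc K) \<tau> \<xi> w = elementary_integral W K \<tau> \<xi> w + \<xi> K w *v (W (\<tau> (Suc K)) w - W (\<tau> K) w)" for w
    unfolding elementary_integral_def by simp
  have [measurable]: "elementary_integral W K \<tau> \<xi> \<in> borel_measurable (F (\<tau> (Suc K)))"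
    "\<xi> K \<in> borel_measurable (F (\<tau> (Suc K)))" "W (\<tau> K) \<in> borel_measurable (F (\<tau> (Suc K)))"
    "W (\<tau> (Suc K)) \<in> borel_measurable (F (\<tau> (Suc K)))"
    using IH \<xi>F \<tau> W_measurable_F[of "\<tau> K"] W_measurable_F[of "\<tau> (Suc K)"] by (auto intro: measurable_F_mono[of "\<tau> K" "\<tau> (Suc K)"])
  have m: "elementary_integral W (Suc K) \<tau> \<xi> \<in> borel_measurable (F (\<tau> (Suc K)))"
    unfolding eq[abs_def] by measurable
  have "expectation (\<lambda>w. (norm (elementary_integral W (Suc K) \<tau> \<xi> w))\<^sup>2) \<le>
      expectation (\<lambda>w. (norm (elementary_integral W K \<tau> \<xi> w))\<^sup>2) + real CARD('k) * (\<tau> (Suc K) - \<tau> K) * expectation (\<lambda>w. (norm (\<xi> K w))\<^sup>2)"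
    unfolding eq by (rule ito_step[OF \<tau> _ _ \<xi>F C]) (use IH in auto)
  also have "\<dots> \<le> real CARD('k) * (\<Sum>i<Suc K. (\<tau> (Suc i) - \<tau> i) * expectation (\<lambda>w. (norm (\<xi> i w))\<^sup>2))"
    using IH by (simp add: algebra_simps)
  finally show ?case
    using m ito_step(1)[OF \<tau> _ _ \<xi>F C] IH unfolding eq by auto
qed

end

section \<open>Mean square convergence and completeness\<close>

text \<open>Values in \<open>ennreal\<close> keep estimates free of integrability conditions and
  give direct access to Fatou and Tonelli; \<open>Lp_tendsto_2_iff\<close> connects it to
  \<open>Lp_tendsto\<close>.\<close>

definition sqnorm :: "'x measure \<Rightarrow> ('x \<Rightarrow> 'b::euclidean_space) \<Rightarrow> ennreal" where
  "sqnorm \<mu> f = (\<integral>\<^sup>+x. ennreal ((norm (f x))\<^sup>2) \<partial>\<mu>)"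

lemma sqnorm_minus_commute: "sqnorm \<mu> (\<lambda>x. f x - g x) = sqnorm \<mu> (\<lambda>x. g x - f x)"
  by (simp add: sqnorm_def norm_minus_commute)

lemma sqnorm_add_le:
  assumes [measurable]: "f \<in> borel_measurable \<mu>" "g \<in> borel_measurable \<mu>"
  shows "sqnorm \<mu> (\<lambda>x. f x + g x) \<le> 2 * sqnorm \<mu> f + 2 * sqnorm \<mu> g"
proof -
  have "(norm (f x + g x))\<^sup>2 \<le> 2 * (norm (f x))\<^sup>2 + 2 * (norm (g x))\<^sup>2" for x
  proof -
    have "(norm (f x + g x))\<^sup>2 \<le> (norm (f x) + norm (g x))\<^sup>2"
      by (intro power_mono norm_triangle_ineq) simp
    also have "\<dots> \<le> 2 * (norm (f x))\<^sup>2 + 2 * (norm (g x))\<^sup>2"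
      using sum_squares_bound[of "norm (f x)" "norm (g x)"] by (simp add: power2_sum)
    finally show ?thesis .
  qed
  then have "sqnorm \<mu> (\<lambda>x. f x + g x) \<le> (\<integral>\<^sup>+x. 2 * ennreal ((norm (f x))\<^sup>2) + 2 * ennreal ((norm (g x))\<^sup>2) \<partial>\<mu>)"
    unfolding sqnorm_def
    by (intro nn_integral_mono) (auto simp: ennreal_plus[symmetric] ennreal_mult'[symmetric] ennreal_leI simp flip: ennreal_numeral simp del: ennreal_plus)
  also have "\<dots> = 2 * sqnorm \<mu> f + 2 * sqnorm \<mu> g"
    unfolding sqnorm_def by (simp add: nn_integral_add nn_integral_cmult)
  finally show ?thesis .
qed

lemma sqnorm_triangle:
  assumes [measurable]: "f \<in> borel_measurable \<mu>" "g \<in> borel_measurable \<mu>" "h \<in> borel_measurable \<mu>"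
  shows "sqnorm \<mu> (\<lambda>x. f x - h x) \<le> 2 * sqnorm \<mu> (\<lambda>x. f x - g x) + 2 * sqnorm \<mu> (\<lambda>x. g x - h x)"
  using sqnorm_add_le[of "\<lambda>x. f x - g x" \<mu> "\<lambda>x. g x - h x"] by simp

lemma Lp_space_2_iff: "f \<in> Lp_space 2 \<mu> \<longleftrightarrow> f \<in> borel_measurable \<mu> \<and> sqnorm \<mu> f < \<infinity>"
  unfolding Lp_space_def sqnorm_def by (auto simp: integrable_iff_bounded)

lemma Lp_space_2_diff: "f \<in> Lp_space 2 \<mu> \<Longrightarrow> g \<in> Lp_space 2 \<mu> \<Longrightarrow> (\<lambda>x. f x - g x) \<in> Lp_space 2 \<mu>"
  using sqnorm_add_le[of f \<mu> "\<lambda>x. - g x"]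
  by (auto simp: Lp_space_2_iff sqnorm_def ennreal_mult_less_top intro: le_less_trans)

lemma sqnorm_eq_Lp_norm:
  assumes "f \<in> Lp_space 2 \<mu>"
  shows "sqnorm \<mu> f = ennreal ((Lp_norm 2 \<mu> f)\<^sup>2)"
proof -
  have i: "integrable \<mu> (\<lambda>x. (norm (f x))\<^sup>2)" using assms unfolding Lp_space_def by simp
  have "(Lp_norm 2 \<mu> f)\<^sup>2 = (\<integral>x. (norm (f x))\<^sup>2 \<partial>\<mu>)"
    unfolding Lp_norm_def by (simp add: powr_half_sqrt)
  then show ?thesis unfolding sqnorm_def using nn_integral_eq_integral[OF i] by simp
qed

lemma Lp_tendsto_2_iff:
  "Lp_tendsto 2 \<mu> f g \<longleftrightarrow> (\<forall>n. f n \<in> Lp_space 2 \<mu>) \<and> g \<in> Lp_space 2 \<mu> \<and>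
    (\<lambda>n. sqnorm \<mu> (\<lambda>x. f n x - g x)) \<longlonglongrightarrow> 0"
proof -
  have "(\<lambda>n. Lp_norm 2 \<mu> (\<lambda>x. f n x - g x)) \<longlonglongrightarrow> 0 \<longleftrightarrow> (\<lambda>n. sqnorm \<mu> (\<lambda>x. f n x - g x)) \<longlonglongrightarrow> 0"
    if "\<And>n. f n \<in> Lp_space 2 \<mu>" "g \<in> Lp_space 2 \<mu>"
  proof -
    let ?a = "\<lambda>n. Lp_norm 2 \<mu> (\<lambda>x. f n x - g x)"
    have eq: "sqnorm \<mu> (\<lambda>x. f n x - g x) = ennreal ((?a n)\<^sup>2)" for n
      using that by (intro sqnorm_eq_Lp_norm Lp_space_2_diff) auto
    show ?thesis unfolding eq
    proof
      assume "?a \<longlonglongrightarrow> 0"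
      then have "(\<lambda>n. (?a n)\<^sup>2) \<longlonglongrightarrow> 0\<^sup>2" by (intro tendsto_power)
      then show "(\<lambda>n. ennreal ((?a n)\<^sup>2)) \<longlonglongrightarrow> 0"
        using tendsto_ennrealI by fastforce
    next
      assume "(\<lambda>n. ennreal ((?a n)\<^sup>2)) \<longlonglongrightarrow> 0"
      then have "(\<lambda>n. enn2real (ennreal ((?a n)\<^sup>2))) \<longlonglongrightarrow> enn2real 0"
        by (intro tendsto_enn2real) auto
      then have "(\<lambda>n. sqrt ((?a n)\<^sup>2)) \<longlonglongrightarrow> sqrt 0" by (intro tendsto_real_sqrt) simp
      then show "?a \<longlonglongrightarrow> 0" by (simp add: tendsto_rabs_zero_iff)
    qed
  qed
  then show ?thesis unfolding Lp_tendsto_def by auto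
qed

text \<open>Expanding \<open>(norm (f x) - e / 2)\<^sup>2 / e \<ge> 0\<close> bounds the norm by
  \<open>e / 4\<close> plus its square over \<open>e\<close>, and the assumption makes each part at
  most \<open>e / 4\<close> in mean. It lets sequences that are Cauchy in mean square count as
  Cauchy in mean.\<close>

lemma (in prob_space) expectation_norm_less:
  fixes f :: "'a \<Rightarrow> 'b::euclidean_space"
  assumes f: "f \<in> Lp_space 2 M" and e: "0 < e" "sqnorm M f \<le> ennreal (e\<^sup>2 / 4)"
  shows "integrable M f" "expectation (\<lambda>x. norm (f x)) < e"
proof -
  have [measurable]: "f \<in> borel_measurable M" using f unfolding Lp_space_def by auto
  have i2: "integrable M (\<lambda>x. (norm (f x))\<^sup>2)" using f unfolding Lp_space_def by simp
  have le: "norm (f x) \<le> e / 4 + (norm (f x))\<^sup>2 / e" for x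
  proof -
    have "0 \<le> (norm (f x) - e / 2)\<^sup>2 / e" using e by simp
    also have "\<dots> = (norm (f x))\<^sup>2 / e + e / 4 - norm (f x)"
      using e by (simp add: power2_eq_square field_simps)
    finally show ?thesis by simp
  qed
  have i3: "integrable M (\<lambda>x. e / 4 + (norm (f x))\<^sup>2 / e)" using i2 by simp
  show i: "integrable M f"
    by (rule Bochner_Integration.integrable_bound[OF i3]) (auto intro!: AE_I2 order_trans[OF le])
  have "sqnorm M f = ennreal (expectation (\<lambda>x. (norm (f x))\<^sup>2))"
    unfolding sqnorm_def by (rule nn_integral_eq_integral[OF i2]) simp
  then have b: "expectation (\<lambda>x. (norm (f x))\<^sup>2) \<le> e\<^sup>2 / 4" using e by simp
  have "expectation (\<lambda>x. norm (f x)) \<le> expectation (\<lambda>x. e / 4 + (norm (f x))\<^sup>2 / e)"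
    by (intro integral_mono i3 le integrable_norm i)
  also have "\<dots> = e / 4 + expectation (\<lambda>x. (norm (f x))\<^sup>2) / e"
    using i2 by (simp add: prob_space)
  also have "\<dots> \<le> e / 4 + (e\<^sup>2 / 4) / e" using b e by (intro add_left_mono divide_right_mono) auto
  also have "\<dots> < e" using e by (simp add: power2_eq_square)
  finally show "expectation (\<lambda>x. norm (f x)) < e" .
qed

lemma norm_le_one_plus_sq: "norm y \<le> 1 + (norm y)\<^sup>2"
proof -
  have "0 \<le> (norm y - 1 / 2)\<^sup>2" by simp
  then show ?thesis by (simp add: power2_eq_square algebra_simps)
qed

text \<open>A sequence that is Cauchy in mean has an almost surely Cauchy subsequence, whose limit
  is the candidate. Fatou along that subsequence turns the Cauchy bound into a bound on the distance
  to the limit.\<close>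

lemma (in prob_space) L2_complete:
  fixes f :: "nat \<Rightarrow> 'a \<Rightarrow> 'b::euclidean_space"
  assumes f: "\<And>n. f n \<in> Lp_space 2 M"
    and C: "\<And>e. e > 0 \<Longrightarrow> \<exists>N. \<forall>i\<ge>N. \<forall>j\<ge>N. sqnorm M (\<lambda>x. f i x - f j x) \<le> ennreal e"
  obtains g where "Lp_tendsto 2 M f g"
proof -
  have fm [measurable]: "f n \<in> borel_measurable M" for n using f[of n] unfolding Lp_space_def by auto
  have fi: "integrable M (f n)" for n
  proof -
    have "integrable M (\<lambda>x. (norm (f n x))\<^sup>2)" using f[of n] unfolding Lp_space_def by simp
    then have i: "integrable M (\<lambda>x. 1 + (norm (f n x))\<^sup>2)" by simp
    show ?thesis
    proof (rule Bochner_Integration.integrable_bound[OF i])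
      show "AE x in M. norm (f n x) \<le> norm (1 + (norm (f n x))\<^sup>2)"
        by (intro AE_I2 order_trans[OF norm_le_one_plus_sq]) simp
    qed simp
  qed
  obtain r where r: "strict_mono r" "AE x in M. Cauchy (\<lambda>i. f (r i) x)"
  proof (rule cauchy_L1_AE_cauchy_subseq[of M f])
    fix e :: real assume e: "e > 0"
    obtain N where "\<forall>i\<ge>N. \<forall>j\<ge>N. sqnorm M (\<lambda>x. f i x - f j x) \<le> ennreal (e\<^sup>2 / 4)"
      using C[of "e\<^sup>2 / 4"] e by auto
    then show "\<exists>N. \<forall>i\<ge>N. \<forall>j\<ge>N. expectation (\<lambda>x. norm (f i x - f j x)) < e"
      using expectation_norm_less(2)[OF Lp_space_2_diff[OF f f] e] by blast
  qed (use fi that in auto)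
  define g where "g = (\<lambda>x. lim (\<lambda>i. f (r i) x))"
  have gm [measurable]: "g \<in> borel_measurable M"
    unfolding g_def by (rule borel_measurable_lim_metric) simp
  have conv: "AE x in M. (\<lambda>i. f (r i) x) \<longlonglongrightarrow> g x"
    using r(2) unfolding g_def by eventually_elim (simp add: Cauchy_convergent_iff convergent_LIMSEQ_iff)
  have bound: "sqnorm M (\<lambda>x. f i x - g x) \<le> ennreal e"
    if N: "\<forall>i\<ge>N. \<forall>j\<ge>N. sqnorm M (\<lambda>x. f i x - f j x) \<le> ennreal e" and i: "i \<ge> N" for e N i
  proof -
    have "sqnorm M (\<lambda>x. f i x - g x) = (\<integral>\<^sup>+x. liminf (\<lambda>k. ennreal ((norm (f i x - f (r k) x))\<^sup>2)) \<partial>M)"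
      unfolding sqnorm_def
    proof (rule nn_integral_cong_AE)
      show "AE x in M. ennreal ((norm (f i x - g x))\<^sup>2) = liminf (\<lambda>k. ennreal ((norm (f i x - f (r k) x))\<^sup>2))"
        using conv
      proof eventually_elim
        case (elim x)
        then have "(\<lambda>k. ennreal ((norm (f i x - f (r k) x))\<^sup>2)) \<longlonglongrightarrow> ennreal ((norm (f i x - g x))\<^sup>2)"
          by (intro tendsto_ennrealI tendsto_intros)
        then show ?case by (intro lim_imp_Liminf[symmetric]) auto
      qed
    qed
    also have "\<dots> \<le> liminf (\<lambda>k. sqnorm M (\<lambda>x. f i x - f (r k) x))"
      unfolding sqnorm_def by (rule nn_integral_liminf) measurable
    also have "\<dots> \<le> ennreal e"
    proof (rule Liminf_le)
      show "\<forall>\<^sub>F k in sequentially. sqnorm M (\<lambda>x. f i x - f (r k) x) \<le> ennreal e"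
        using eventually_ge_at_top[of N]
        by eventually_elim (use N i seq_suble[OF r(1)] in \<open>meson order_trans\<close>)
    qed simp
    finally show ?thesis .
  qed
  have "(\<lambda>n. sqnorm M (\<lambda>x. f n x - g x)) \<longlonglongrightarrow> 0"
  proof (rule tendsto_0_if_Limsup_eq_0_ennreal)
    have "limsup (\<lambda>n. sqnorm M (\<lambda>x. f n x - g x)) \<le> 0"
    proof (rule ennreal_le_epsilon)
      fix e :: real assume "e > 0"
      then obtain N where "\<forall>i\<ge>N. \<forall>j\<ge>N. sqnorm M (\<lambda>x. f i x - f j x) \<le> ennreal e" using C by blast
      then show "limsup (\<lambda>n. sqnorm M (\<lambda>x. f n x - g x)) \<le> 0 + ennreal e"
        using bound by (intro Limsup_bounded) (auto simp: eventually_sequentially intro!: exI[of _ N])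
    qed
    then show "limsup (\<lambda>n. sqnorm M (\<lambda>x. f n x - g x)) = 0" by simp
  qed
  moreover obtain N where "\<forall>i\<ge>N. \<forall>j\<ge>N. sqnorm M (\<lambda>x. f i x - f j x) \<le> ennreal 1" using C[of 1] by auto
  then have "sqnorm M (\<lambda>x. f N x - g x) < \<infinity>" using bound[of N 1 N]
    by (simp add: le_less_trans[of _ 1])
  then have "(\<lambda>x. f N x - g x) \<in> Lp_space 2 M" by (simp add: Lp_space_2_iff)
  from Lp_space_2_diff[OF f[of N] this] have "g \<in> Lp_space 2 M" by simp
  ultimately show ?thesis using that f unfolding Lp_tendsto_2_iff by blast
qed

section \<open>Elementary integrands and their refinement to a common grid\<close>

lemma sum_scaleR_matrix_vector_mult:
  fixes A :: "'i \<Rightarrow> real ^ 'k ^ 'm"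
  shows "(\<Sum>i\<in>I. c i *\<^sub>R A i) *v x = (\<Sum>i\<in>I. A i *v (c i *\<^sub>R x))"
  by (induction I rule: infinite_finite_induct)
    (simp_all add: matrix_vector_mult_add_rdistrib scaleR_matrix_vector_assoc[symmetric] matrix_vector_mult_scaleR)

lemma less_of_Suc_less:
  fixes \<sigma> :: "nat \<Rightarrow> real"
  assumes "\<And>k. k < K \<Longrightarrow> \<sigma> k < \<sigma> (Suc k)" "i < j" "j \<le> K"
  shows "\<sigma> i < \<sigma> j"
  using assms(2,3)
proof (induction j)
  case (Suc j)
  then have "\<sigma> i \<le> \<sigma> j" by (cases "i = j") auto
  also have "\<dots> < \<sigma> (Suc j)" using Suc.prems by (intro assms(1)) simp
  finally show ?case .
qed simp

lemma ex_strict_enumeration: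
  fixes P :: "real set"
  assumes "finite P" "P \<noteq> {}"
  shows "\<exists>K \<sigma>. (\<forall>k<K. \<sigma> k < \<sigma> (Suc k)) \<and> \<sigma> ` {..K::nat} = P"
proof -
  let ?xs = "sorted_list_of_set P"
  have len: "length ?xs = card P" "card P > 0" using assms by (auto simp: card_gt_0_iff)
  have "(!) ?xs ` {..card P - 1} = (!) ?xs ` {..<length ?xs}"
    using len by (intro arg_cong2[of _ _ _ _ "(`)"]) auto
  also have "\<dots> = P" using assms(1) nth_image[of "length ?xs" ?xs] by (simp add: lessThan_atLeast0)
  finally have "(!) ?xs ` {..card P - 1} = P" .
  moreover have "?xs ! k < ?xs ! Suc k" if "k < card P - 1" for k
    using sorted_wrt_nth_less[of "(<)" ?xs k "Suc k"] that len by simp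
  ultimately show ?thesis by blast
qed

lemma le_of_Suc_le:
  fixes \<sigma> :: "nat \<Rightarrow> real"
  assumes "\<And>k. k < K \<Longrightarrow> \<sigma> k \<le> \<sigma> (Suc k)" "i \<le> j" "j \<le> K"
  shows "\<sigma> i \<le> \<sigma> j"
  using assms(2,3)
proof (induction rule: dec_induct)
  case (step n)
  then show ?case using assms(1)[of n] by simp
qed simp

text \<open>A grid interval lies between \<open>\<sigma> a\<close> and \<open>\<sigma> b\<close>
  exactly if its right end does, so the indicators keep the indices from \<open>a\<close> to
  \<open>b - 1\<close>. It is used twice: with a Wiener path as \<open>G\<close> for the integrals,
  and with a step function as \<open>G\<close> for the integrands.\<close>

lemma sum_partition_telescope:
  fixes G :: "real \<Rightarrow> 'v::real_vector"
  assumes \<sigma>: "\<And>k. k < K \<Longrightarrow> \<sigma> k < \<sigma> (Suc k)" and ab: "a \<le> b" "b \<le> K"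
  shows "(\<Sum>k<K. indicator {\<sigma> a<..\<sigma> b} (\<sigma> (Suc k)) *\<^sub>R (G (\<sigma> (Suc k)) - G (\<sigma> k))) = G (\<sigma> b) - G (\<sigma> a)"
proof -
  have mono: "\<sigma> i < \<sigma> j" if "i < j" "j \<le> K" for i j
    using less_of_Suc_less[of K \<sigma>, OF \<sigma>] that by blast
  have iff: "\<sigma> i < \<sigma> j \<longleftrightarrow> i < j" if "i \<le> K" "j \<le> K" for i j
    using mono[of i j] mono[of j i] that by (metis less_asym less_irrefl nat_neq_iff)
  have "(\<Sum>k<K. indicator {\<sigma> a<..\<sigma> b} (\<sigma> (Suc k)) *\<^sub>R (G (\<sigma> (Suc k)) - G (\<sigma> k))) =
      (\<Sum>k\<in>{a..<b}. G (\<sigma> (Suc k)) - G (\<sigma> k))"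
  proof (rule sum.mono_neutral_cong_right)
    show "\<forall>k\<in>{..<K} - {a..<b}. indicator {\<sigma> a<..\<sigma> b} (\<sigma> (Suc k)) *\<^sub>R (G (\<sigma> (Suc k)) - G (\<sigma> k)) = 0"
    proof
      fix k assume "k \<in> {..<K} - {a..<b}"
      then have "\<not> (\<sigma> a < \<sigma> (Suc k) \<and> \<sigma> (Suc k) \<le> \<sigma> b)"
        using iff[of a "Suc k"] iff[of b "Suc k"] ab by (auto simp: not_le[symmetric])
      then show "indicator {\<sigma> a<..\<sigma> b} (\<sigma> (Suc k)) *\<^sub>R (G (\<sigma> (Suc k)) - G (\<sigma> k)) = 0" by auto
    qed
    fix k assume "k \<in> {a..<b}"
    then show "indicator {\<sigma> a<..\<sigma> b} (\<sigma> (Suc k)) *\<^sub>R (G (\<sigma> (Suc k)) - G (\<sigma> k)) = G (\<sigma> (Suc k)) - G (\<sigma> k)"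
      using iff[of a "Suc k"] iff[of b "Suc k"] ab by (auto simp: indicator_def not_less[symmetric])
  qed (use ab in auto)
  also have "\<dots> = G (\<sigma> b) - G (\<sigma> a)"
    using sum_Suc_diff'[of a b "\<lambda>k. G (\<sigma> k)"] ab by simp
  finally show ?thesis .
qed

text \<open>The intervals are disjoint, so at most one summand is nonzero and squaring produces no
  mixed terms.\<close>

lemma norm_elementary_value_sq:
  assumes "\<And>k. k < K \<Longrightarrow> \<sigma> k \<le> \<sigma> (Suc k)"
  shows "(norm (elementary_value K \<sigma> \<zeta> s w))\<^sup>2 = (\<Sum>k<K. indicator {\<sigma> k<..\<sigma> (Suc k)} s * (norm (\<zeta> k w))\<^sup>2)"
  using assms
proof (induction K)
  case (Suc K)
  have mono: "\<sigma> i \<le> \<sigma> j" if "i \<le> j" "j \<le> Suc K" for i j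
    using le_of_Suc_le[of "Suc K" \<sigma>, OF Suc.prems] that by blast
  show ?case
  proof (cases "s \<le> \<sigma> K")
    case True
    then show ?thesis using Suc by (simp add: elementary_value_def indicator_def)
  next
    case False
    then have "\<not> s \<le> \<sigma> (Suc k)" if "k < K" for k using mono[of "Suc k" K] that by auto
    then show ?thesis by (simp add: elementary_value_def indicator_def power_mult_distrib)
  qed
qed (simp add: elementary_value_def)

lemma borel_measurable_elementary_value [measurable]:
  assumes "\<And>i. i < N \<Longrightarrow> \<xi> i \<in> borel_measurable M"
  shows "(\<lambda>(s, w). elementary_value N \<tau> \<xi> s w) \<in> borel_measurable (lborel_on S \<Otimes>\<^sub>M M)"
proof -
  have "(\<lambda>x. \<Sum>i<N. indicator {\<tau> i<..\<tau> (Suc i)} (fst x) *\<^sub>R \<xi> i (snd x)) \<in> borel_measurable (lborel_on S \<Otimes>\<^sub>M M)"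
  proof (intro borel_measurable_sum borel_measurable_scaleR)
    fix i assume "i \<in> {..<N}"
    then have [measurable]: "\<xi> i \<in> borel_measurable M" using assms by auto
    show "(\<lambda>x. indicator {\<tau> i<..\<tau> (Suc i)} (fst x) :: real) \<in> borel_measurable (lborel_on S \<Otimes>\<^sub>M M)"
      by (rule measurable_compose[OF measurable_fst]) (simp add: measurable_restrict_space1)
    show "(\<lambda>x. \<xi> i (snd x)) \<in> borel_measurable (lborel_on S \<Otimes>\<^sub>M M)" by measurable
  qed
  then show ?thesis by (simp add: elementary_value_def case_prod_beta')
qed

lemma sigma_finite_lborel_on: "S \<in> sets borel \<Longrightarrow> sigma_finite_measure (lborel_on S)"
  by (rule sigma_finite_measure_restrict_space) (auto simp: sigma_finite_lborel)

context wiener_space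
begin

lemma sqnorm_elementary_value:
  fixes \<zeta> :: "nat \<Rightarrow> 'a \<Rightarrow> real ^ 'k ^ 'm"
  assumes e: "elementary_process M F t K \<sigma> \<zeta>" and t: "t \<le> T"
  shows "sqnorm (lborel_on {0..t} \<Otimes>\<^sub>M M) (\<lambda>(s, w). elementary_value K \<sigma> \<zeta> s w) =
    (\<Sum>k<K. ennreal (\<sigma> (Suc k) - \<sigma> k) * sqnorm M (\<zeta> k))"
proof -
  interpret L: sigma_finite_measure "lborel_on {0..t}" by (rule sigma_finite_lborel_on) simp
  have \<sigma>: "0 \<le> \<sigma> k" "\<sigma> k \<le> \<sigma> (Suc k)" "\<sigma> (Suc k) \<le> t" if "k < K" for k
    using elementary_process_range[OF e, of k] elementary_process_range[OF e, of "Suc k"] elementary_process_times[OF e, of k "Suc k"] that by auto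
  have zm: "\<zeta> k \<in> borel_measurable M" if "k < K" for k
    using e \<sigma>[OF that] that t unfolding elementary_process_def by (auto intro!: measurable_F_M[of "\<sigma> k"])
  have im: "(\<lambda>x. indicator {\<sigma> k<..\<sigma> (Suc k)} (fst x) :: ennreal) \<in> borel_measurable (lborel_on {0..t} \<Otimes>\<^sub>M M)" for k
    by (rule measurable_compose[OF measurable_fst]) (simp add: measurable_restrict_space1)
  have "sqnorm (lborel_on {0..t} \<Otimes>\<^sub>M M) (\<lambda>(s, w). elementary_value K \<sigma> \<zeta> s w) =
    (\<integral>\<^sup>+x. (\<Sum>k<K. indicator {\<sigma> k<..\<sigma> (Suc k)} (fst x) * ennreal ((norm (\<zeta> k (snd x)))\<^sup>2)) \<partial>(lborel_on {0..t} \<Otimes>\<^sub>M M))"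
    unfolding sqnorm_def case_prod_beta
    by (subst norm_elementary_value_sq[of K \<sigma>, OF \<sigma>(2)], simp)
      (auto simp: sum_ennreal[symmetric] ennreal_mult' ennreal_indicator intro!: nn_integral_cong sum.cong simp del: sum_ennreal)
  also have "\<dots> = (\<Sum>k<K. \<integral>\<^sup>+x. indicator {\<sigma> k<..\<sigma> (Suc k)} (fst x) * ennreal ((norm (\<zeta> k (snd x)))\<^sup>2) \<partial>(lborel_on {0..t} \<Otimes>\<^sub>M M))"
    by (rule nn_integral_sum) (use zm im in \<open>auto intro!: borel_measurable_times_ennreal\<close>)
  also have "\<dots> = (\<Sum>k<K. ennreal (\<sigma> (Suc k) - \<sigma> k) * sqnorm M (\<zeta> k))"
  proof (rule sum.cong[OF refl])
    fix k assume "k \<in> {..<K}"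
    then have k: "k < K" by simp
    note [measurable] = zm[OF k]
    have "(\<integral>\<^sup>+x. indicator {\<sigma> k<..\<sigma> (Suc k)} (fst x) * ennreal ((norm (\<zeta> k (snd x)))\<^sup>2) \<partial>(lborel_on {0..t} \<Otimes>\<^sub>M M)) =
      (\<integral>\<^sup>+s. (\<integral>\<^sup>+w. indicator {\<sigma> k<..\<sigma> (Suc k)} s * ennreal ((norm (\<zeta> k w))\<^sup>2) \<partial>M) \<partial>(lborel_on {0..t}))"
      by (subst nn_integral_fst[symmetric]) (use im in \<open>auto intro!: borel_measurable_times_ennreal\<close>)
    also have "\<dots> = (\<integral>\<^sup>+s. indicator {\<sigma> k<..\<sigma> (Suc k)} s * sqnorm M (\<zeta> k) \<partial>(lborel_on {0..t}))"
      unfolding sqnorm_def by (simp add: nn_integral_cmult)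
    also have "\<dots> = (\<integral>\<^sup>+s. sqnorm M (\<zeta> k) * indicator {\<sigma> k<..\<sigma> (Suc k)} s \<partial>lborel)"
      using \<sigma>[OF k] by (subst nn_integral_restrict_space) (auto intro!: nn_integral_cong simp: indicator_def)
    also have "\<dots> = ennreal (\<sigma> (Suc k) - \<sigma> k) * sqnorm M (\<zeta> k)"
      using \<sigma>[OF k] by (subst nn_integral_cmult_indicator) (auto simp: mult.commute)
    finally show "(\<integral>\<^sup>+x. indicator {\<sigma> k<..\<sigma> (Suc k)} (fst x) * ennreal ((norm (\<zeta> k (snd x)))\<^sup>2) \<partial>(lborel_on {0..t} \<Otimes>\<^sub>M M)) = ennreal (\<sigma> (Suc k) - \<sigma> k) * sqnorm M (\<zeta> k)" .
  qed
  finally show ?thesis .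
qed

lemma ito_bound:
  fixes \<zeta> :: "nat \<Rightarrow> 'a \<Rightarrow> real ^ 'k ^ 'm"
  assumes e: "elementary_process M F t K \<sigma> \<zeta>" and t: "t \<le> T"
  shows "elementary_integral W K \<sigma> \<zeta> \<in> Lp_space 2 M"
    and "sqnorm M (elementary_integral W K \<sigma> \<zeta>) \<le>
      of_nat CARD('k) * sqnorm (lborel_on {0..t} \<Otimes>\<^sub>M M) (\<lambda>(s, w). elementary_value K \<sigma> \<zeta> s w)"
    and "(\<lambda>(s, w). elementary_value K \<sigma> \<zeta> s w) \<in> Lp_space 2 (lborel_on {0..t} \<Otimes>\<^sub>M M)"
proof -
  let ?I = "elementary_integral W K \<sigma> \<zeta>"
  have \<sigma>: "0 \<le> \<sigma> k" "\<sigma> k \<le> \<sigma> (Suc k)" "\<sigma> (Suc k) \<le> t" if "k < K" for k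
    using elementary_process_range[OF e, of k] elementary_process_range[OF e, of "Suc k"] elementary_process_times[OF e, of k "Suc k"] that by auto
  have zm: "\<zeta> k \<in> borel_measurable M" if "k < K" for k
    using e \<sigma>[OF that] that t unfolding elementary_process_def by (auto intro!: measurable_F_M[of "\<sigma> k"])
  have zi: "integrable M (\<lambda>w. (norm (\<zeta> k w))\<^sup>2)" if k: "k < K" for k
  proof -
    obtain C where "\<And>w. w \<in> space M \<Longrightarrow> norm (\<zeta> k w) \<le> C"
      using e k unfolding elementary_process_def by blast
    then show ?thesis using zm[OF k]
      by (intro integrable_const_bound[where B="C\<^sup>2"]) (auto intro!: AE_I2 power_mono)
  qed
  have zs: "sqnorm M (\<zeta> k) = ennreal (expectation (\<lambda>w. (norm (\<zeta> k w))\<^sup>2))" if k: "k < K" for k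
    unfolding sqnorm_def by (rule nn_integral_eq_integral[OF zi[OF k]]) simp
  have r: "0 \<le> \<sigma> K" "\<sigma> K \<le> T" using elementary_process_range[OF e, of K] t by auto
  note S = ito_sum[OF e t order_refl]
  have Im: "?I \<in> borel_measurable M" using S r by (auto intro: measurable_F_M[of "\<sigma> K"])
  have "sqnorm M ?I = ennreal (expectation (\<lambda>w. (norm (?I w))\<^sup>2))"
    unfolding sqnorm_def using S by (intro nn_integral_eq_integral) auto
  then have le: "sqnorm M ?I \<le> ennreal (real CARD('k) * (\<Sum>i<K. (\<sigma> (Suc i) - \<sigma> i) * expectation (\<lambda>w. (norm (\<zeta> i w))\<^sup>2)))"
    using S by (simp add: ennreal_leI)
  have v: "sqnorm (lborel_on {0..t} \<Otimes>\<^sub>M M) (\<lambda>(s, w). elementary_value K \<sigma> \<zeta> s w) =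
    ennreal (\<Sum>i<K. (\<sigma> (Suc i) - \<sigma> i) * expectation (\<lambda>w. (norm (\<zeta> i w))\<^sup>2))"
    unfolding sqnorm_elementary_value[OF e t]
    by (subst sum_ennreal[symmetric]) (auto simp: zs \<sigma> ennreal_mult' intro!: sum.cong)
  show "sqnorm M ?I \<le> of_nat CARD('k) * sqnorm (lborel_on {0..t} \<Otimes>\<^sub>M M) (\<lambda>(s, w). elementary_value K \<sigma> \<zeta> s w)"
    using le unfolding v by (simp add: ennreal_mult' ennreal_of_nat_eq_real_of_nat)
  show "?I \<in> Lp_space 2 M"
    unfolding Lp_space_2_iff using Im le_less_trans[OF le] by simp
  show "(\<lambda>(s, w). elementary_value K \<sigma> \<zeta> s w) \<in> Lp_space 2 (lborel_on {0..t} \<Otimes>\<^sub>M M)"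
    unfolding Lp_space_2_iff v using zm by (simp add: borel_measurable_elementary_value)
qed

text \<open>On a finer grid the integrand is constant on each interval, and its value there may be
  read off at the right end, since the intervals contain their right ends. Integrand and integral
  are unchanged by telescoping over the fine intervals inside each coarse one.\<close>

lemma elementary_refine:
  fixes \<xi> :: "nat \<Rightarrow> 'a \<Rightarrow> real ^ 'k ^ 'm"
  assumes e: "elementary_process M F t N \<tau> \<xi>" and t: "t \<le> T"
    and \<sigma>: "\<And>k. k < K \<Longrightarrow> \<sigma> k < \<sigma> (Suc k)" "0 \<le> \<sigma> 0" "\<sigma> K \<le> t"
    and sub: "\<tau> ` {..N} \<subseteq> \<sigma> ` {..K}"
  defines "\<zeta> \<equiv> \<lambda>k. elementary_value N \<tau> \<xi> (\<sigma> (Suc k))"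
  shows "elementary_process M F t K \<sigma> \<zeta>"
    and "elementary_value K \<sigma> \<zeta> = elementary_value N \<tau> \<xi>"
    and "elementary_integral W K \<sigma> \<zeta> = elementary_integral W N \<tau> \<xi>"
proof -
  have smono: "\<sigma> i < \<sigma> j" if "i < j" "j \<le> K" for i j
    using less_of_Suc_less[of K \<sigma>, OF \<sigma>(1)] that by blast
  have mono: "\<sigma> i \<le> \<sigma> j" if "i \<le> j" "j \<le> K" for i j
    using smono[of i j] that by (cases "i = j") auto
  define a where "a i = (SOME k. k \<le> K \<and> \<tau> i = \<sigma> k)" for i
  have a: "a i \<le> K" "\<tau> i = \<sigma> (a i)" if "i \<le> N" for i
  proof -
    have "\<exists>k. k \<le> K \<and> \<tau> i = \<sigma> k" using sub that by fastforce
    from someI_ex[OF this] show "a i \<le> K" "\<tau> i = \<sigma> (a i)" unfolding a_def by auto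
  qed
  have \<tau>: "\<tau> i \<le> \<tau> (Suc i)" if "i < N" for i using elementary_process_times[OF e, of i "Suc i"] that by auto
  have aS: "a i \<le> a (Suc i)" if "i < N" for i
    using smono[of "a (Suc i)" "a i"] a[of i] a[of "Suc i"] that \<tau>[OF that] by (auto simp: not_le[symmetric])
  have tele: "(\<Sum>k<K. indicator {\<tau> i<..\<tau> (Suc i)} (\<sigma> (Suc k)) *\<^sub>R (G (\<sigma> (Suc k)) - G (\<sigma> k))) = G (\<tau> (Suc i)) - G (\<tau> i)"
    if "i < N" for i and G :: "real \<Rightarrow> real"
    using sum_partition_telescope[of K \<sigma> "a i" "a (Suc i)" G, OF \<sigma>(1) aS[OF that] a(1)[of "Suc i"]] a[of i] a[of "Suc i"] that by simp
  have teleW: "(\<Sum>k<K. indicator {\<tau> i<..\<tau> (Suc i)} (\<sigma> (Suc k)) *\<^sub>R (W (\<sigma> (Suc k)) w - W (\<sigma> k) w)) = W (\<tau> (Suc i)) w - W (\<tau> i) w"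
    if "i < N" for i w
    using sum_partition_telescope[of K \<sigma> "a i" "a (Suc i)" "\<lambda>x. W x w", OF \<sigma>(1) aS[OF that] a(1)[of "Suc i"]] a[of i] a[of "Suc i"] that by simp
  show "elementary_process M F t K \<sigma> \<zeta>"
    unfolding elementary_process_def
  proof (intro conjI allI impI)
    fix k assume k: "k < K"
    show "\<sigma> k \<le> \<sigma> (Suc k)" using \<sigma>(1)[OF k] by simp
    have r: "0 \<le> \<sigma> k" "\<sigma> k \<le> T" using mono[of 0 k] mono[of k K] k \<sigma> t by auto
    show "\<zeta> k \<in> borel_measurable (F (\<sigma> k))"
      unfolding \<zeta>_def elementary_value_def
    proof (rule borel_measurable_sum)
      fix i assume i: "i \<in> {..<N}"
      show "(\<lambda>w. indicator {\<tau> i<..\<tau> (Suc i)} (\<sigma> (Suc k)) *\<^sub>R \<xi> i w) \<in> borel_measurable (F (\<sigma> k))"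
      proof (cases "\<tau> i < \<sigma> (Suc k)")
        case True
        \<comment> \<open>Adaptedness after reading off at the right end: a coarse point below
          \<open>\<sigma> (Suc k)\<close> is itself a fine grid point, hence at most
          \<open>\<sigma> k\<close>.\<close>
        then have "a i < Suc k" using a[of i] i mono[of "Suc k" "a i"] by (auto simp: not_le[symmetric])
        then have "\<tau> i \<le> \<sigma> k" using a[of i] i mono[of "a i" k] k by auto
        moreover have "0 \<le> \<tau> i" using elementary_process_range[OF e, of i] i by auto
        moreover have "\<xi> i \<in> borel_measurable (F (\<tau> i))" using e i unfolding elementary_process_def by auto
        ultimately have [measurable]: "\<xi> i \<in> borel_measurable (F (\<sigma> k))" using r by (intro measurable_F_mono[of "\<tau> i" "\<sigma> k"])
        show ?thesis by measurable
      qed (simp add: indicator_def)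
    qed
    have "\<exists>C. \<forall>i<N. \<forall>w\<in>space M. norm (\<xi> i w) \<le> C i" using e unfolding elementary_process_def by metis
    then obtain C where C: "\<And>i w. i < N \<Longrightarrow> w \<in> space M \<Longrightarrow> norm (\<xi> i w) \<le> C i" by blast
    show "\<exists>C. \<forall>w\<in>space M. norm (\<zeta> k w) \<le> C"
    proof (intro exI ballI)
      fix w assume w: "w \<in> space M"
      show "norm (\<zeta> k w) \<le> (\<Sum>i<N. C i)"
        unfolding \<zeta>_def elementary_value_def
        by (intro sum_norm_le) (use C w in \<open>auto simp: indicator_def intro: order_trans[OF norm_ge_zero]\<close>)
    qed
  qed (use \<sigma> in auto)
  show "elementary_value K \<sigma> \<zeta> = elementary_value N \<tau> \<xi>"
  proof (intro ext)
    fix s w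
    have ind: "indicator {\<sigma> k<..\<sigma> (Suc k)} s = (if s \<le> \<sigma> (Suc k) then 1 else 0) - (if s \<le> \<sigma> k then 1 else 0 :: real)"
      if "k < K" for k
      using \<sigma>(1)[OF that] by (auto simp: indicator_def)
    have "elementary_value K \<sigma> \<zeta> s w = (\<Sum>k<K. \<Sum>i<N. (indicator {\<tau> i<..\<tau> (Suc i)} (\<sigma> (Suc k)) *\<^sub>R ((if s \<le> \<sigma> (Suc k) then 1 else 0) - (if s \<le> \<sigma> k then 1 else 0 :: real))) *\<^sub>R \<xi> i w)"
      unfolding elementary_value_def \<zeta>_def scaleR_sum_right
      by (intro sum.cong refl) (simp add: ind)
    also have "\<dots> = (\<Sum>i<N. (\<Sum>k<K. indicator {\<tau> i<..\<tau> (Suc i)} (\<sigma> (Suc k)) *\<^sub>R ((if s \<le> \<sigma> (Suc k) then 1 else 0) - (if s \<le> \<sigma> k then 1 else 0 :: real))) *\<^sub>R \<xi> i w)"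
      unfolding scaleR_sum_left by (rule sum.swap)
    also have "\<dots> = elementary_value N \<tau> \<xi> s w"
      unfolding elementary_value_def
    proof (intro sum.cong refl)
      fix i assume "i \<in> {..<N}"
      then have i: "i < N" by simp
      show "(\<Sum>k<K. indicator {\<tau> i<..\<tau> (Suc i)} (\<sigma> (Suc k)) *\<^sub>R ((if s \<le> \<sigma> (Suc k) then 1 else 0) - (if s \<le> \<sigma> k then 1 else 0 :: real))) *\<^sub>R \<xi> i w =
        indicator {\<tau> i<..\<tau> (Suc i)} s *\<^sub>R \<xi> i w"
        unfolding tele[OF i, of "\<lambda>x. if s \<le> x then 1 else 0"] using \<tau>[OF i] by (auto simp: indicator_def)
    qed
    finally show "elementary_value K \<sigma> \<zeta> s w = elementary_value N \<tau> \<xi> s w" .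
  qed
  show "elementary_integral W K \<sigma> \<zeta> = elementary_integral W N \<tau> \<xi>"
  proof (intro ext)
    fix w
    have "elementary_integral W K \<sigma> \<zeta> w = (\<Sum>k<K. \<Sum>i<N. \<xi> i w *v (indicator {\<tau> i<..\<tau> (Suc i)} (\<sigma> (Suc k)) *\<^sub>R (W (\<sigma> (Suc k)) w - W (\<sigma> k) w)))"
      unfolding elementary_integral_def \<zeta>_def elementary_value_def sum_scaleR_matrix_vector_mult ..
    also have "\<dots> = (\<Sum>i<N. \<xi> i w *v (\<Sum>k<K. indicator {\<tau> i<..\<tau> (Suc i)} (\<sigma> (Suc k)) *\<^sub>R (W (\<sigma> (Suc k)) w - W (\<sigma> k) w)))"
      unfolding linear_sum[OF matrix_vector_mul_linear] by (rule sum.swap)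
    also have "\<dots> = elementary_integral W N \<tau> \<xi> w"
      unfolding elementary_integral_def
      by (intro sum.cong refl) (subst teleW, auto)
    finally show "elementary_integral W K \<sigma> \<zeta> w = elementary_integral W N \<tau> \<xi> w" .
  qed
qed


text \<open>On the grid merged from both, the difference of the integrands is again elementary, and
  \<open>ito_bound\<close> applies to it.\<close>

lemma ito_inequality:
  fixes \<xi> \<xi>' :: "nat \<Rightarrow> 'a \<Rightarrow> real ^ 'k ^ 'm"
  assumes e: "elementary_process M F t N \<tau> \<xi>" and e': "elementary_process M F t N' \<tau>' \<xi>'" and t: "t \<le> T"
  shows "sqnorm M (\<lambda>w. elementary_integral W N \<tau> \<xi> w - elementary_integral W N' \<tau>' \<xi>' w) \<le>
    of_nat CARD('k) * sqnorm (lborel_on {0..t} \<Otimes>\<^sub>M M)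
      (\<lambda>(s, w). elementary_value N \<tau> \<xi> s w - elementary_value N' \<tau>' \<xi>' s w)"
proof -
  define P where "P = \<tau> ` {..N} \<union> \<tau>' ` {..N'}"
  have P: "finite P" "P \<noteq> {}" by (auto simp: P_def)
  have P_range: "P \<subseteq> {0..t}"
    using elementary_process_range[OF e] elementary_process_range[OF e'] by (auto simp: P_def)
  obtain K \<sigma> where \<sigma>: "\<And>k. k < K \<Longrightarrow> \<sigma> k < \<sigma> (Suc k)" and \<sigma>P: "\<sigma> ` {..K} = P"
    using ex_strict_enumeration[OF P] by blast
  have b: "0 \<le> \<sigma> 0" "\<sigma> K \<le> t" using P_range \<sigma>P by auto
  define \<zeta> where "\<zeta> = (\<lambda>k. elementary_value N \<tau> \<xi> (\<sigma> (Suc k)))"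
  define \<zeta>' where "\<zeta>' = (\<lambda>k. elementary_value N' \<tau>' \<xi>' (\<sigma> (Suc k)))"
  have sub: "\<tau> ` {..N} \<subseteq> \<sigma> ` {..K}" "\<tau>' ` {..N'} \<subseteq> \<sigma> ` {..K}" unfolding \<sigma>P P_def by auto
  note r = elementary_refine[OF e t \<sigma> b sub(1), folded \<zeta>_def]
  note r' = elementary_refine[OF e' t \<sigma> b sub(2), folded \<zeta>'_def]
  define \<delta> where "\<delta> = (\<lambda>k w. \<zeta> k w - \<zeta>' k w)"
  have d: "elementary_process M F t K \<sigma> \<delta>"
    unfolding elementary_process_def
  proof (intro conjI allI impI)
    fix k assume k: "k < K"
    have "\<zeta> k \<in> borel_measurable (F (\<sigma> k))" "\<zeta>' k \<in> borel_measurable (F (\<sigma> k))"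
      using r(1) r'(1) k unfolding elementary_process_def by auto
    then show "\<delta> k \<in> borel_measurable (F (\<sigma> k))" unfolding \<delta>_def by measurable
    obtain C where C: "\<And>w. w \<in> space M \<Longrightarrow> norm (\<zeta> k w) \<le> C"
      using r(1) k unfolding elementary_process_def by blast
    obtain C' where C': "\<And>w. w \<in> space M \<Longrightarrow> norm (\<zeta>' k w) \<le> C'"
      using r'(1) k unfolding elementary_process_def by blast
    have "norm (\<delta> k w) \<le> C + C'" if "w \<in> space M" for w
      unfolding \<delta>_def using C[OF that] C'[OF that] norm_triangle_ineq4[of "\<zeta> k w" "\<zeta>' k w"] by linarith
    then show "\<exists>C. \<forall>w\<in>space M. norm (\<delta> k w) \<le> C" by blast
  qed (use r(1) in \<open>auto simp: elementary_process_def\<close>)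
  have v: "elementary_value K \<sigma> \<delta> s w = elementary_value N \<tau> \<xi> s w - elementary_value N' \<tau>' \<xi>' s w" for s w
  proof -
    have "elementary_value K \<sigma> \<delta> s w = elementary_value K \<sigma> \<zeta> s w - elementary_value K \<sigma> \<zeta>' s w"
      by (simp only: elementary_value_def \<delta>_def sum_subtractf scaleR_diff_right)
    then show ?thesis by (simp only: r(2) r'(2))
  qed
  have i: "elementary_integral W K \<sigma> \<delta> w = elementary_integral W N \<tau> \<xi> w - elementary_integral W N' \<tau>' \<xi>' w" for w
  proof -
    have "elementary_integral W K \<sigma> \<delta> w = elementary_integral W K \<sigma> \<zeta> w - elementary_integral W K \<sigma> \<zeta>' w"
      by (simp only: elementary_integral_def \<delta>_def sum_subtractf matrix_vector_mult_diff_rdistrib)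
    then show ?thesis by (simp only: r(3) r'(3))
  qed
  show ?thesis
    using ito_bound(2)[OF d t] unfolding v i[abs_def] .
qed

text \<open>The given elementary integral is compared with those of a sequence defining
  \<open>J\<close>, and the sequence is sent to its limit. Both integrals and integrands use the
  triangle inequality with factor 2, hence the 4.\<close>

lemma has_ito_integral_bound:
  fixes \<xi> :: "nat \<Rightarrow> 'a \<Rightarrow> real ^ 'k ^ 'm"
  assumes J: "has_ito_integral M F W \<phi> t J" and e: "elementary_process M F t N \<tau> \<xi>" and t: "t \<le> T"
  shows "sqnorm M (\<lambda>w. elementary_integral W N \<tau> \<xi> w - J w) \<le>
    4 * of_nat CARD('k) * sqnorm (lborel_on {0..t} \<Otimes>\<^sub>M M) (\<lambda>(s, w). elementary_value N \<tau> \<xi> s w - \<phi> s w)"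
proof -
  let ?Q = "lborel_on {0..t} \<Otimes>\<^sub>M M" and ?k = "of_nat CARD('k) :: ennreal"
  let ?I = "elementary_integral W N \<tau> \<xi>" and ?v = "\<lambda>x. elementary_value N \<tau> \<xi> (fst x) (snd x)"
  obtain N' \<tau>' \<xi>' where e': "\<And>j. elementary_process M F t (N' j) (\<tau>' j) (\<xi>' j)"
    and v': "Lp_tendsto 2 ?Q (\<lambda>j (s, w). elementary_value (N' j) (\<tau>' j) (\<xi>' j) s w) (\<lambda>(s, w). \<phi> s w)"
    and i': "Lp_tendsto 2 M (\<lambda>j. elementary_integral W (N' j) (\<tau>' j) (\<xi>' j)) J"
    using J unfolding has_ito_integral_def by auto
  let ?I' = "\<lambda>j. elementary_integral W (N' j) (\<tau>' j) (\<xi>' j)"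
  let ?v' = "\<lambda>j x. elementary_value (N' j) (\<tau>' j) (\<xi>' j) (fst x) (snd x)"
  let ?\<phi> = "\<lambda>x. \<phi> (fst x) (snd x)"
  have [measurable]: "?I \<in> borel_measurable M" "J \<in> borel_measurable M" "?I' j \<in> borel_measurable M"
    "?v \<in> borel_measurable ?Q" "?v' j \<in> borel_measurable ?Q" "?\<phi> \<in> borel_measurable ?Q" for j
    using ito_bound(1,3)[OF e t] ito_bound(1,3)[OF e' t, of j] v' i'
    unfolding Lp_space_def Lp_tendsto_def by (auto simp: case_prod_beta')
  have lim_v: "(\<lambda>j. sqnorm ?Q (\<lambda>x. ?v' j x - ?\<phi> x)) \<longlonglongrightarrow> 0"
    using v' unfolding Lp_tendsto_2_iff by (simp add: case_prod_beta')
  have lim_i: "(\<lambda>j. sqnorm M (\<lambda>w. ?I' j w - J w)) \<longlonglongrightarrow> 0"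
    using i' unfolding Lp_tendsto_2_iff by simp
  have le: "sqnorm M (\<lambda>w. ?I w - J w) \<le>
      2 * (?k * (2 * sqnorm ?Q (\<lambda>x. ?v x - ?\<phi> x) + 2 * sqnorm ?Q (\<lambda>x. ?v' j x - ?\<phi> x))) + 2 * sqnorm M (\<lambda>w. ?I' j w - J w)" for j
  proof -
    have "sqnorm M (\<lambda>w. ?I w - J w) \<le> 2 * sqnorm M (\<lambda>w. ?I w - ?I' j w) + 2 * sqnorm M (\<lambda>w. ?I' j w - J w)"
      by (rule sqnorm_triangle) measurable
    also have "\<dots> \<le> 2 * (?k * sqnorm ?Q (\<lambda>x. ?v x - ?v' j x)) + 2 * sqnorm M (\<lambda>w. ?I' j w - J w)"
      using ito_inequality[OF e e' t, of j] by (intro add_right_mono mult_left_mono) (auto simp: case_prod_beta')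
    also have "\<dots> \<le> 2 * (?k * (2 * sqnorm ?Q (\<lambda>x. ?v x - ?\<phi> x) + 2 * sqnorm ?Q (\<lambda>x. ?\<phi> x - ?v' j x))) + 2 * sqnorm M (\<lambda>w. ?I' j w - J w)"
      by (intro add_right_mono mult_left_mono sqnorm_triangle) auto
    finally show ?thesis by (simp add: sqnorm_minus_commute[of ?Q ?\<phi>])
  qed
  have "(\<lambda>j. 2 * (?k * (2 * sqnorm ?Q (\<lambda>x. ?v x - ?\<phi> x) + 2 * sqnorm ?Q (\<lambda>x. ?v' j x - ?\<phi> x))) + 2 * sqnorm M (\<lambda>w. ?I' j w - J w))
     \<longlonglongrightarrow> 2 * (?k * (2 * sqnorm ?Q (\<lambda>x. ?v x - ?\<phi> x) + 2 * 0)) + 2 * 0"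
    by (intro tendsto_add ennreal_tendsto_cmult tendsto_const lim_v lim_i) (auto simp: ennreal_mult_less_top of_nat_less_top)
  then have "sqnorm M (\<lambda>w. ?I w - J w) \<le> 2 * (?k * (2 * sqnorm ?Q (\<lambda>x. ?v x - ?\<phi> x) + 2 * 0)) + 2 * 0"
    by (rule LIMSEQ_le_const) (use le in auto)
  also have "\<dots> = 4 * ?k * sqnorm ?Q (\<lambda>x. ?v x - ?\<phi> x)"
    by (simp add: mult.assoc[symmetric] mult.commute[of ?k])
  finally show ?thesis by (simp add: case_prod_beta')
qed

end

section \<open>Existence of the stochastic integral\<close>

context wiener_space
begin

text \<open>Elementary approximations are a hypothesis because the averages over the past supply
  them directly. Their integrals are Cauchy by \<open>ito_inequality\<close>, so a limit exists, and
  the choice behind \<open>ito_integral\<close> then has the defining property.\<close>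

lemma has_ito_integral_exists:
  fixes \<phi> :: "real \<Rightarrow> 'a \<Rightarrow> real ^ 'k ^ 'm"
  assumes \<phi>: "(\<lambda>(s, w). \<phi> s w) \<in> Lp_space 2 (lborel_on {0..t} \<Otimes>\<^sub>M M)" and t: "t \<le> T"
    and approx: "\<And>e. e > 0 \<Longrightarrow> \<exists>N \<tau> \<xi>. elementary_process M F t N \<tau> \<xi> \<and>
      sqnorm (lborel_on {0..t} \<Otimes>\<^sub>M M) (\<lambda>(s, w). elementary_value N \<tau> \<xi> s w - \<phi> s w) \<le> ennreal e"
  shows "has_ito_integral M F W \<phi> t (ito_integral M F W \<phi> t)"
proof -
  let ?Q = "lborel_on {0..t} \<Otimes>\<^sub>M M" and ?k = "of_nat CARD('k) :: ennreal"
  define P where "P = (\<lambda>j (E :: nat \<times> (nat \<Rightarrow> real) \<times> (nat \<Rightarrow> 'a \<Rightarrow> real ^ 'k ^ 'm)).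
      elementary_process M F t (fst E) (fst (snd E)) (snd (snd E)) \<and>
      sqnorm ?Q (\<lambda>(s, w). elementary_value (fst E) (fst (snd E)) (snd (snd E)) s w - \<phi> s w) \<le> ennreal (1 / real (Suc j)))"
  have "\<forall>j. \<exists>E. P j E"
  proof
    fix j :: nat
    have "1 / real (Suc j) > 0" by simp
    from approx[OF this] obtain N \<tau> \<xi> where "elementary_process M F t N \<tau> \<xi>"
      "sqnorm ?Q (\<lambda>(s, w). elementary_value N \<tau> \<xi> s w - \<phi> s w) \<le> ennreal (1 / real (Suc j))" by blast
    then have "P j (N, \<tau>, \<xi>)" unfolding P_def by simp
    then show "\<exists>E. P j E" ..
  qed
  from choice[OF this] obtain E where E: "\<forall>j. P j (E j)" ..
  define N where "N = (\<lambda>j. fst (E j))"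
  define \<tau> where "\<tau> = (\<lambda>j. fst (snd (E j)))"
  define \<xi> where "\<xi> = (\<lambda>j. snd (snd (E j)))"
  have e: "elementary_process M F t (N j) (\<tau> j) (\<xi> j)"
    and le: "sqnorm ?Q (\<lambda>(s, w). elementary_value (N j) (\<tau> j) (\<xi> j) s w - \<phi> s w) \<le> ennreal (1 / real (Suc j))" for j
    using E unfolding P_def N_def \<tau>_def \<xi>_def by auto
  let ?v = "\<lambda>j x. elementary_value (N j) (\<tau> j) (\<xi> j) (fst x) (snd x)" and ?\<phi> = "\<lambda>x. \<phi> (fst x) (snd x)"
  let ?I = "\<lambda>j. elementary_integral W (N j) (\<tau> j) (\<xi> j)"
  have [measurable]: "?v j \<in> borel_measurable ?Q" "?\<phi> \<in> borel_measurable ?Q" for j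
    using ito_bound(3)[OF e t, of j] \<phi> unfolding Lp_space_def by (auto simp: case_prod_beta')
  have lim0: "(\<lambda>j. ennreal (1 / real (Suc j))) \<longlonglongrightarrow> 0"
    using tendsto_ennrealI[OF LIMSEQ_inverse_real_of_nat] unfolding inverse_eq_divide ennreal_0 .
  have lim: "(\<lambda>j. sqnorm ?Q (\<lambda>x. ?v j x - ?\<phi> x)) \<longlonglongrightarrow> 0"
    by (rule tendsto_sandwich[OF _ _ tendsto_const lim0]) (use le in \<open>auto simp: case_prod_beta'\<close>)
  have "\<exists>N. \<forall>i\<ge>N. \<forall>j\<ge>N. sqnorm M (\<lambda>w. ?I i w - ?I j w) \<le> ennreal \<epsilon>" if "\<epsilon> > 0" for \<epsilon>
  proof -
    \<comment> \<open>Two integrands within \<open>\<delta>\<close> of the limit differ by at most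
      \<open>2 * \<delta> + 2 * \<delta>\<close>, multiplied by \<open>CARD('k)\<close> in the bound
      for the integrals.\<close>
    define \<delta> where "\<delta> = \<epsilon> / (4 * real CARD('k))"
    have \<delta>: "\<delta> > 0" unfolding \<delta>_def using that by simp
    have "\<forall>\<^sub>F j in sequentially. sqnorm ?Q (\<lambda>x. ?v j x - ?\<phi> x) < ennreal \<delta>"
      using \<delta> by (intro order_tendstoD(2)[OF lim]) simp
    then obtain n where n: "\<And>j. j \<ge> n \<Longrightarrow> sqnorm ?Q (\<lambda>x. ?v j x - ?\<phi> x) < ennreal \<delta>"
      unfolding eventually_sequentially by blast
    have "sqnorm M (\<lambda>w. ?I i w - ?I j w) \<le> ennreal \<epsilon>" if ij: "i \<ge> n" "j \<ge> n" for i j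
    proof -
      have "sqnorm M (\<lambda>w. ?I i w - ?I j w) \<le> ?k * sqnorm ?Q (\<lambda>x. ?v i x - ?v j x)"
        using ito_inequality[OF e e t, of i j] by (simp add: case_prod_beta')
      also have "\<dots> \<le> ?k * (2 * sqnorm ?Q (\<lambda>x. ?v i x - ?\<phi> x) + 2 * sqnorm ?Q (\<lambda>x. ?v j x - ?\<phi> x))"
        using sqnorm_triangle[of "?v i" ?Q ?\<phi> "?v j"]
        by (intro mult_left_mono) (auto simp: sqnorm_minus_commute[of ?Q ?\<phi>])
      also have "\<dots> \<le> ?k * (2 * ennreal \<delta> + 2 * ennreal \<delta>)"
        by (intro mult_left_mono add_mono less_imp_le[OF n] ij) auto
      also have "2 * ennreal \<delta> + 2 * ennreal \<delta> = 4 * ennreal \<delta>"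
        by (simp add: distrib_right[symmetric])
      also have "?k * (4 * ennreal \<delta>) = ennreal (real CARD('k) * (4 * \<delta>))"
        by (simp add: ennreal_mult' ennreal_of_nat_eq_real_of_nat)
      also have "real CARD('k) * (4 * \<delta>) = \<epsilon>"
        unfolding \<delta>_def by simp
      finally show ?thesis .
    qed
    then show ?thesis by blast
  qed
  then obtain J where "Lp_tendsto 2 M ?I J"
    using L2_complete[of ?I] ito_bound(1)[OF e t] by blast
  moreover have "Lp_tendsto 2 ?Q (\<lambda>j (s, w). elementary_value (N j) (\<tau> j) (\<xi> j) s w) (\<lambda>(s, w). \<phi> s w)"
    unfolding Lp_tendsto_2_iff
  proof (intro conjI allI)
    show "(\<lambda>j. sqnorm ?Q (\<lambda>x. (case x of (s, w) \<Rightarrow> elementary_value (N j) (\<tau> j) (\<xi> j) s w) - (case x of (s, w) \<Rightarrow> \<phi> s w))) \<longlonglongrightarrow> 0"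
      using lim by (simp only: case_prod_beta')
  qed (rule ito_bound(3)[OF e t] \<phi>)+
  ultimately have "has_ito_integral M F W \<phi> t J"
    unfolding has_ito_integral_def
    by (intro exI[of _ N] exI[of _ \<tau>] exI[of _ \<xi>] conjI allI e)
  then have "\<exists>J. has_ito_integral M F W \<phi> t J" by (rule exI[of "has_ito_integral M F W \<phi> t"])
  then show ?thesis unfolding ito_integral_def by (rule someI_ex)
qed

end

section \<open>Approximation by averages over the past\<close>

text \<open>The mean over the grid interval preceding the one with number \<open>i\<close>, so that
  it is known at time \<open>i * h\<close>. The interval with number 0 has no predecessor and gets
  0.\<close>

definition average_before :: "real \<Rightarrow> (real \<Rightarrow> 'e::euclidean_space) \<Rightarrow> nat \<Rightarrow> 'e" where
  "average_before h x i =
    (if i = 0 then 0 else (1 / h) *\<^sub>R (\<integral>u. indicator {real (i - 1) * h<..real i * h} u *\<^sub>R x u \<partial>lborel))"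

text \<open>Substituting \<open>u = s - v\<close> expresses the error as a mean of translation
  differences. As \<open>s\<close> lies in one interval and \<open>u\<close> in the preceding one,
  \<open>0 < v \<le> 2 * h\<close>; the indicator of \<open>v \<le> s\<close> records that
  \<open>u\<close> is not negative.\<close>

lemma average_before_error:
  fixes x :: "real \<Rightarrow> 'e::euclidean_space"
  assumes x: "integrable lborel x" and h: "h > 0" and i: "i > 0"
    and s: "real i * h < s" "s \<le> real (Suc i) * h"
  shows "ennreal (norm (x s - average_before h x i)) \<le>
    ennreal (1 / h) * (\<integral>\<^sup>+v. indicator {0<..2 * h} v * (indicator {v..} s * ennreal (norm (x s - x (s - v)))) \<partial>lborel)"
proof -
  have [measurable]: "x \<in> borel_measurable borel" using x by auto
  let ?I = "{real (i - 1) * h<..real i * h}"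
  have len: "real i * h - real (i - 1) * h = h" using i by (simp add: of_nat_diff left_diff_distrib)
  have emI: "emeasure lborel ?I = ennreal h" using len h by (subst emeasure_lborel_Ioc) (auto intro: mult_right_mono)
  have xi: "integrable lborel (\<lambda>u. indicator ?I u *\<^sub>R x u)"
    using x by (intro integrable_mult_indicator) auto
  have ci: "integrable lborel (\<lambda>u. indicator ?I u *\<^sub>R x s)"
    using emI by (intro integrable_scaleR_left) (auto simp: integrable_indicator_iff)
  have ciE: "(\<integral>u. indicator ?I u *\<^sub>R x s \<partial>lborel) = h *\<^sub>R x s"
    using emI h by (simp add: measure_def)
  have di: "integrable lborel (\<lambda>u. indicator ?I u *\<^sub>R (x s - x u))"
    using Bochner_Integration.integrable_diff[OF ci xi] by (simp add: scaleR_diff_right)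
  have "x s - average_before h x i = (1 / h) *\<^sub>R (\<integral>u. indicator ?I u *\<^sub>R (x s - x u) \<partial>lborel)"
    using Bochner_Integration.integral_diff[OF ci xi] i h unfolding ciE
    by (simp add: average_before_def scaleR_diff_right)
  then have "ennreal (norm (x s - average_before h x i)) = ennreal (1 / h) * ennreal (norm (\<integral>u. indicator ?I u *\<^sub>R (x s - x u) \<partial>lborel))"
    using h by (simp add: ennreal_mult'[symmetric])
  also have "\<dots> \<le> ennreal (1 / h) * (\<integral>\<^sup>+u. ennreal (norm (indicator ?I u *\<^sub>R (x s - x u))) \<partial>lborel)"
    by (intro mult_left_mono integral_norm_bound_ennreal di) auto
  also have "(\<integral>\<^sup>+u. ennreal (norm (indicator ?I u *\<^sub>R (x s - x u))) \<partial>lborel) =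
      (\<integral>\<^sup>+v. ennreal (norm (indicator ?I (s - v) *\<^sub>R (x s - x (s - v)))) \<partial>lborel)"
    using nn_integral_real_affine[of "\<lambda>u. ennreal (norm (indicator ?I u *\<^sub>R (x s - x u)))" "-1" s] by simp
  also have "\<dots> \<le> (\<integral>\<^sup>+v. indicator {0<..2 * h} v * (indicator {v..} s * ennreal (norm (x s - x (s - v)))) \<partial>lborel)"
  proof (rule nn_integral_mono)
    fix v
    show "ennreal (norm (indicator ?I (s - v) *\<^sub>R (x s - x (s - v)))) \<le> indicator {0<..2 * h} v * (indicator {v..} s * ennreal (norm (x s - x (s - v))))"
    proof (cases "s - v \<in> ?I")
      case True
      then have "0 < v" using s by auto
      moreover have "v \<le> 2 * h" using True s i len by (simp add: algebra_simps)
      moreover have "0 \<le> real (i - 1) * h" using h by simp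
      then have "v \<le> s" using True by auto
      ultimately show ?thesis using True by simp
    qed simp
  qed
  finally show ?thesis by (simp add: mult_left_mono)
qed

lemma elementary_value_eq:
  assumes h: "h > 0" and i: "i < N" and s: "real i * h < s" "s \<le> real (Suc i) * h"
  shows "elementary_value N (\<lambda>i. real i * h) \<xi> s w = \<xi> i w"
proof -
  have uniq: "j = i" if "real j * h < s" "s \<le> real (Suc j) * h" for j
  proof -
    have "real j * h < real (Suc i) * h" "real i * h < real (Suc j) * h" using that s by linarith+
    then show ?thesis using h by (simp add: mult_less_cancel_right_pos)
  qed
  have "elementary_value N (\<lambda>i. real i * h) \<xi> s w = (\<Sum>j<N. if j = i then \<xi> i w else 0)"
    unfolding elementary_value_def
  proof (rule sum.cong[OF refl])
    fix j
    show "indicator {real j * h<..real (Suc j) * h} s *\<^sub>R \<xi> j w = (if j = i then \<xi> i w else 0)"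
    proof (cases "j = i")
      case True
      then show ?thesis using s by simp
    next
      case False
      then have "s \<notin> {real j * h<..real (Suc j) * h}" using uniq[of j] by (simp only: greaterThanAtMost_iff) blast
      then show ?thesis using False by simp
    qed
  qed
  then show ?thesis using i by simp
qed

lemma ex_partition_interval:
  assumes h: "h > 0" and s: "0 < s" "s \<le> real N * h"
  obtains i where "i < N" "real i * h < s" "s \<le> real (Suc i) * h"
proof -
  \<comment> \<open>Intervals open on the left and closed on the right call for the ceiling minus
    one.\<close>
  define i where "i = nat (\<lceil>s / h\<rceil> - 1)"
  have "\<lceil>s / h\<rceil> \<ge> 1" using s h by (simp add: less_ceiling_iff)
  then have i: "real i = of_int \<lceil>s / h\<rceil> - 1" unfolding i_def by simp
  have "real i < s / h" "s / h \<le> real i + 1" unfolding i by linarith+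
  then have 1: "real i * h < s" "s \<le> real (Suc i) * h" using h by (simp_all add: field_simps)
  have "real i * h < real N * h" using 1 s by linarith
  then have "i < N" using h by simp
  with 1 show ?thesis using that by blast
qed

text \<open>Projection to a ball makes the integrand bounded, and it is a continuous contraction
  that fixes vectors of norm at most \<open>R\<close>, which keeps convergence and error estimates
  intact.\<close>

definition truncated_average :: "real \<Rightarrow> real \<Rightarrow> (real \<Rightarrow> 'a \<Rightarrow> 'e::euclidean_space) \<Rightarrow> nat \<Rightarrow> 'a \<Rightarrow> 'e" where
  "truncated_average h R Y i w = closest_point (cball 0 R) (average_before h (\<lambda>s. Y s w) i)"

lemma norm_truncated_average: "R \<ge> 0 \<Longrightarrow> norm (truncated_average h R Y i w) \<le> R"
  unfolding truncated_average_def using closest_point_in_set[of "cball 0 R"] by auto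

section \<open>Pointwise errors of truncation\<close>

lemma powr_tail:
  fixes a R p :: real
  assumes "p > 2" "R > 0" "R \<le> a"
  shows "a\<^sup>2 \<le> R powr (2 - p) * a powr p"
proof -
  have "a\<^sup>2 = a powr (2 - p) * a powr p" using assms by (simp add: powr_add[symmetric])
  also have "\<dots> \<le> R powr (2 - p) * a powr p"
    using assms by (intro mult_right_mono powr_mono2') auto
  finally show ?thesis .
qed

text \<open>This is how a mean error becomes a mean square error. If \<open>norm y \<le> R\<close>,
  the projection does not increase the distance to \<open>y\<close>, and both points lie in the
  ball, so one factor of the square is at most \<open>2 * R\<close>. Otherwise the error is at most
  \<open>2 * norm y\<close> and the moment of order \<open>p\<close> takes over.\<close>

lemma truncation_error:
  fixes y a :: "'e::euclidean_space"
  assumes p: "p > 2" and R: "R > 0"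
  shows "(norm (closest_point (cball 0 R) a - y))\<^sup>2 \<le> 2 * R * norm (y - a) + 4 * R powr (2 - p) * norm y powr p"
proof -
  let ?c = "closest_point (cball 0 R :: 'e set)"
  have c: "norm (?c a) \<le> R" using closest_point_in_set[of "cball 0 R" a] R by auto
  show ?thesis
  proof (cases "norm y \<le> R")
    case True
    then have "?c y = y" by (intro closest_point_self) auto
    then have 1: "norm (?c a - y) \<le> norm (y - a)"
      using closest_point_lipschitz[of "cball 0 R" a y] R by (auto simp: dist_norm norm_minus_commute)
    have 2: "norm (?c a - y) \<le> 2 * R" using norm_triangle_ineq4[of "?c a" y] c True by linarith
    have "(norm (?c a - y))\<^sup>2 \<le> (2 * R) * norm (y - a)"
      unfolding power2_eq_square by (intro mult_mono 1 2) (use R in auto)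
    then show ?thesis by (simp add: add_increasing2)
  next
    case False
    then have "norm (?c a - y) \<le> 2 * norm y" using norm_triangle_ineq4[of "?c a" y] c by linarith
    then have "(norm (?c a - y))\<^sup>2 \<le> (2 * norm y)\<^sup>2" by (intro power_mono) auto
    also have "\<dots> \<le> 4 * (R powr (2 - p) * norm y powr p)"
      using powr_tail[OF p R, of "norm y"] False by (simp add: power_mult_distrib)
    finally show ?thesis using R by (simp add: add_increasing)
  qed
qed

text \<open>The error of the approximant 0, which is used on the first grid interval. With
  \<open>R = 1\<close> it also yields square integrability in \<open>Y_L2\<close>.\<close>

lemma truncation_error_zero:
  fixes y :: "'e::euclidean_space"
  assumes p: "p > 2" and R: "R > 0"
  shows "(norm y)\<^sup>2 \<le> R\<^sup>2 + R powr (2 - p) * norm y powr p"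
proof (cases "norm y \<le> R")
  case True
  then have "(norm y)\<^sup>2 \<le> R\<^sup>2" by (intro power_mono) auto
  then show ?thesis by (simp add: add_increasing2)
next
  case False
  then show ?thesis using powr_tail[OF p R, of "norm y"] by (simp add: add_increasing)
qed

section \<open>Approximation of processes with moment and translation bounds\<close>

lemma borel_measurable_indicator_atLeastAtMost [measurable]:
  fixes f g :: "'z \<Rightarrow> real"
  assumes [measurable]: "f \<in> borel_measurable K" "g \<in> borel_measurable K"
  shows "(\<lambda>x. indicator {f x..T} (g x) :: ennreal) \<in> borel_measurable K"
proof -
  have "(\<lambda>x. indicator {f x..T} (g x) :: ennreal) = (\<lambda>x. if f x \<le> g x \<and> g x \<le> T then 1 else 0)"
    by (auto simp: indicator_def fun_eq_iff)
  then show ?thesis by simp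
qed

text \<open>Exactly what the error estimate consumes, with the bounds \<open>C\<close> and
  \<open>\<kappa>\<close> as parameters: one instance for each \<open>n\<close> and one for the
  limit, all with the same bounds, give a common error. Extension by 0 outside \<open>{0..T}\<close>
  permits integration over the whole line.\<close>

locale moment_process = prob_space M for M :: "'a measure" +
  fixes T p :: real and C :: ennreal and \<kappa> :: "real \<Rightarrow> ennreal" and Y :: "real \<Rightarrow> 'a \<Rightarrow> real ^ 'k::finite ^ 'm::finite"
  assumes p: "p > 2"
    and Y_measurable [measurable]: "case_prod Y \<in> borel_measurable (lborel \<Otimes>\<^sub>M M)"
    and Y_support: "\<And>s w. s \<notin> {0..T} \<Longrightarrow> Y s w = 0"
    and C: "C < \<infinity>" and Y_moment: "(\<integral>\<^sup>+w. (\<integral>\<^sup>+s. ennreal (norm (Y s w) powr p) \<partial>lborel) \<partial>M) \<le> C"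
    and Y_translation: "\<And>v. v > 0 \<Longrightarrow>
      (\<integral>\<^sup>+w. (\<integral>\<^sup>+s. indicator {v..T} s * ennreal (norm (Y s w - Y (s - v) w)) \<partial>lborel) \<partial>M) \<le> \<kappa> v"
begin

lemma Y_section_measurable: "w \<in> space M \<Longrightarrow> (\<lambda>s. Y s w) \<in> borel_measurable borel"
  using measurable_Pair2[OF measurable_pair_swap[OF Y_measurable], of w] by simp

lemma AE_Y_integrable: "AE w in M. integrable lborel (\<lambda>s. Y s w)"
proof -
  have "AE w in M. (\<integral>\<^sup>+s. ennreal (norm (Y s w) powr p) \<partial>lborel) \<noteq> \<infinity>"
    using Y_moment C by (intro nn_integral_PInf_AE) auto
  with AE_space show ?thesis
  proof eventually_elim
    case (elim w)
    note [measurable] = Y_section_measurable[OF elim(1)]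
    have "(\<integral>\<^sup>+s. ennreal (norm (Y s w)) \<partial>lborel) \<le> (\<integral>\<^sup>+s. indicator {0..T} s + ennreal (norm (Y s w) powr p) \<partial>lborel)"
    proof (rule nn_integral_mono)
      fix s
      show "ennreal (norm (Y s w)) \<le> indicator {0..T} s + ennreal (norm (Y s w) powr p)"
      proof (cases "s \<in> {0..T}")
        case True
        have "norm (Y s w) \<le> 1 + norm (Y s w) powr p"
        proof (cases "norm (Y s w) \<le> 1")
          case False
          then have "norm (Y s w) powr 1 \<le> norm (Y s w) powr p" using p by (intro powr_mono) auto
          then show ?thesis by simp
        qed (simp add: add_increasing2)
        then show ?thesis using True by (simp add: ennreal_leI flip: ennreal_1 ennreal_plus)
      qed (simp add: Y_support)
    qed
    also have "\<dots> = emeasure lborel {0..T} + (\<integral>\<^sup>+s. ennreal (norm (Y s w) powr p) \<partial>lborel)"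
      by (subst nn_integral_add) auto
    also have "\<dots> < \<infinity>"
      using elim(2) by (cases "0 \<le> T") (auto simp: less_top)
    finally show ?case by (intro integrableI_bounded) auto
  qed
qed

lemma average_before_measurable [measurable]:
  "(\<lambda>w. average_before h (\<lambda>s. Y s w) i) \<in> borel_measurable M"
proof -
  have "(\<lambda>w. \<integral>u. indicator {real (i - 1) * h<..real i * h} u *\<^sub>R Y u w \<partial>lborel) \<in> borel_measurable M"
    by (rule lborel.borel_measurable_lebesgue_integral) measurable
  then show ?thesis unfolding average_before_def by (cases "i = 0") auto
qed

lemma truncated_average_measurable [measurable]:
  assumes "R > 0"
  shows "truncated_average h R Y i \<in> borel_measurable M"
proof -
  have "continuous_on UNIV (closest_point (cball 0 R :: (real ^ 'k ^ 'm) set))"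
    using assms by (intro continuous_on_closest_point) auto
  then have "closest_point (cball 0 R :: (real ^ 'k ^ 'm) set) \<in> borel_measurable borel"
    by (rule borel_measurable_continuous_onI)
  from measurable_compose[OF average_before_measurable this] show ?thesis
    unfolding truncated_average_def[abs_def] .
qed

lemma iterated_cmult:
  assumes [measurable]: "case_prod f \<in> borel_measurable (lborel \<Otimes>\<^sub>M M)"
  shows "(\<integral>\<^sup>+w. (\<integral>\<^sup>+s. c * f s w \<partial>lborel) \<partial>M) = c * (\<integral>\<^sup>+w. (\<integral>\<^sup>+s. f s w \<partial>lborel) \<partial>M)"
proof -
  have "(\<integral>\<^sup>+w. (\<integral>\<^sup>+s. c * f s w \<partial>lborel) \<partial>M) = (\<integral>\<^sup>+w. c * (\<integral>\<^sup>+s. f s w \<partial>lborel) \<partial>M)"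
  proof (rule nn_integral_cong)
    fix w assume w: "w \<in> space M"
    have "(\<lambda>s. f s w) \<in> borel_measurable lborel"
      using measurable_Pair2[OF measurable_pair_swap[OF assms] w] by simp
    then show "(\<integral>\<^sup>+s. c * f s w \<partial>lborel) = c * (\<integral>\<^sup>+s. f s w \<partial>lborel)"
      by (rule nn_integral_cmult)
  qed
  also have "\<dots> = c * (\<integral>\<^sup>+w. (\<integral>\<^sup>+s. f s w \<partial>lborel) \<partial>M)"
    by (rule nn_integral_cmult) measurable
  finally show ?thesis .
qed

text \<open>By Tonelli the translation parameter \<open>v\<close> is integrated last, over an
  interval of length \<open>2 * h\<close>, where the inner integrals are at most \<open>e\<close>;
  division by \<open>h\<close> leaves \<open>2 * e\<close>. The first interval is left out because
  there the average is 0 by definition and says nothing about \<open>Y\<close>.\<close>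

lemma average_error:
  assumes h: "h > 0" and t: "real N * h \<le> T" and \<kappa>: "\<And>v. 0 < v \<Longrightarrow> v \<le> 2 * h \<Longrightarrow> \<kappa> v \<le> e"
  shows "(\<integral>\<^sup>+w. (\<integral>\<^sup>+s. indicator {h<..real N * h} s *
      ennreal (norm (Y s w - elementary_value N (\<lambda>i. real i * h) (\<lambda>i w. average_before h (\<lambda>s. Y s w) i) s w)) \<partial>lborel) \<partial>M) \<le> 2 * e"
proof -
  let ?A = "elementary_value N (\<lambda>i. real i * h) (\<lambda>i w. average_before h (\<lambda>s. Y s w) i)"
  let ?D = "\<lambda>w s v. indicator {0<..2 * h} v * (indicator {v..T} s * ennreal (norm (Y s w - Y (s - v) w)))"
  interpret M_lborel: pair_sigma_finite M lborel ..
  have pt: "indicator {h<..real N * h} s * ennreal (norm (Y s w - ?A s w)) \<le> ennreal (1 / h) * (\<integral>\<^sup>+v. ?D w s v \<partial>lborel)"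
    if i: "integrable lborel (\<lambda>s. Y s w)" for s w
  proof (cases "s \<in> {h<..real N * h}")
    case True
    then obtain i where i': "i < N" "real i * h < s" "s \<le> real (Suc i) * h"
      using ex_partition_interval[of h s N] h by auto
    have "i > 0" using True i' by (cases i) auto
    have "ennreal (norm (Y s w - ?A s w)) \<le> ennreal (1 / h) * (\<integral>\<^sup>+v. indicator {0<..2 * h} v * (indicator {v..} s * ennreal (norm (Y s w - Y (s - v) w))) \<partial>lborel)"
      unfolding elementary_value_eq[OF h i'] by (rule average_before_error[OF i h \<open>i > 0\<close> i'(2,3)])
    also have "\<dots> = ennreal (1 / h) * (\<integral>\<^sup>+v. ?D w s v \<partial>lborel)"
      using True t by (intro arg_cong2[of _ _ _ _ "(*)"] nn_integral_cong refl) (auto simp: indicator_def)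
    finally show ?thesis using True by simp
  qed simp
  have "(\<integral>\<^sup>+w. (\<integral>\<^sup>+s. indicator {h<..real N * h} s * ennreal (norm (Y s w - ?A s w)) \<partial>lborel) \<partial>M) \<le>
      (\<integral>\<^sup>+w. (\<integral>\<^sup>+s. ennreal (1 / h) * (\<integral>\<^sup>+v. ?D w s v \<partial>lborel) \<partial>lborel) \<partial>M)"
  proof (rule nn_integral_mono_AE)
    show "AE w in M. (\<integral>\<^sup>+s. indicator {h<..real N * h} s * ennreal (norm (Y s w - ?A s w)) \<partial>lborel) \<le>
        (\<integral>\<^sup>+s. ennreal (1 / h) * (\<integral>\<^sup>+v. ?D w s v \<partial>lborel) \<partial>lborel)"
      using AE_Y_integrable by eventually_elim (intro nn_integral_mono pt)
  qed
  also have "\<dots> = ennreal (1 / h) * (\<integral>\<^sup>+w. (\<integral>\<^sup>+s. (\<integral>\<^sup>+v. ?D w s v \<partial>lborel) \<partial>lborel) \<partial>M)"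
    by (rule iterated_cmult) measurable
  also have "(\<integral>\<^sup>+w. (\<integral>\<^sup>+s. (\<integral>\<^sup>+v. ?D w s v \<partial>lborel) \<partial>lborel) \<partial>M) = (\<integral>\<^sup>+w. (\<integral>\<^sup>+v. (\<integral>\<^sup>+s. ?D w s v \<partial>lborel) \<partial>lborel) \<partial>M)"
  proof (rule nn_integral_cong)
    fix w assume "w \<in> space M"
    note [measurable] = Y_section_measurable[OF this]
    show "(\<integral>\<^sup>+s. (\<integral>\<^sup>+v. ?D w s v \<partial>lborel) \<partial>lborel) = (\<integral>\<^sup>+v. (\<integral>\<^sup>+s. ?D w s v \<partial>lborel) \<partial>lborel)"
      by (rule lborel_pair.Fubini'[symmetric]) measurable
  qed
  also have "\<dots> = (\<integral>\<^sup>+v. (\<integral>\<^sup>+w. (\<integral>\<^sup>+s. ?D w s v \<partial>lborel) \<partial>M) \<partial>lborel)"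
    by (rule M_lborel.Fubini'[symmetric]) measurable
  also have "\<dots> = (\<integral>\<^sup>+v. indicator {0<..2 * h} v * (\<integral>\<^sup>+w. (\<integral>\<^sup>+s. indicator {v..T} s * ennreal (norm (Y s w - Y (s - v) w)) \<partial>lborel) \<partial>M) \<partial>lborel)"
    by (intro nn_integral_cong iterated_cmult) measurable
  also have "\<dots> \<le> (\<integral>\<^sup>+v. e * indicator {0<..2 * h} v \<partial>lborel)"
  proof (rule nn_integral_mono)
    fix v
    show "indicator {0<..2 * h} v * (\<integral>\<^sup>+w. (\<integral>\<^sup>+s. indicator {v..T} s * ennreal (norm (Y s w - Y (s - v) w)) \<partial>lborel) \<partial>M) \<le> e * indicator {0<..2 * h} v"
      using order_trans[OF Y_translation \<kappa>, of v] by (auto simp: indicator_def)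
  qed
  also have "\<dots> = e * ennreal (2 * h)" using h by (subst nn_integral_cmult_indicator) auto
  finally have "(\<integral>\<^sup>+w. (\<integral>\<^sup>+s. indicator {h<..real N * h} s * ennreal (norm (Y s w - ?A s w)) \<partial>lborel) \<partial>M) \<le> ennreal (1 / h) * (e * ennreal (2 * h))"
    by (simp add: mult_left_mono)
  also have "\<dots> = e * ennreal (1 / h * (2 * h))" using h by (subst ennreal_mult') (auto simp: mult_ac)
  also have "1 / h * (2 * h) = 2" using h by simp
  finally show ?thesis by (simp add: mult.commute)
qed

end

lemma tendsto_0_ennrealI:
  fixes f :: "nat \<Rightarrow> ennreal"
  assumes "\<And>e. e > 0 \<Longrightarrow> \<forall>\<^sub>F n in sequentially. f n \<le> ennreal e"
  shows "f \<longlonglongrightarrow> 0"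
proof (rule tendsto_0_if_Limsup_eq_0_ennreal)
  have "limsup f \<le> 0"
  proof (rule ennreal_le_epsilon)
    fix e :: real assume "e > 0"
    then show "limsup f \<le> 0 + ennreal e" using assms by (simp add: Limsup_bounded)
  qed
  then show "limsup f = 0" by simp
qed

lemma measurable_restrict_pair:
  assumes "f \<in> borel_measurable (lborel \<Otimes>\<^sub>M M)"
  shows "f \<in> borel_measurable (lborel_on S \<Otimes>\<^sub>M M)"
proof -
  have "fst \<in> lborel_on S \<Otimes>\<^sub>M M \<rightarrow>\<^sub>M lborel"
    by (rule measurable_compose[OF measurable_fst]) (simp add: measurable_restrict_space1)
  then have "(\<lambda>x. (fst x, snd x)) \<in> lborel_on S \<Otimes>\<^sub>M M \<rightarrow>\<^sub>M lborel \<Otimes>\<^sub>M M"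
    by (intro measurable_Pair measurable_snd)
  from measurable_compose[OF this assms] show ?thesis by simp
qed

lemma (in prob_space) sqnorm_lborel_on:
  assumes f: "case_prod f \<in> borel_measurable (lborel \<Otimes>\<^sub>M M)" and S: "S \<in> sets borel"
  shows "sqnorm (lborel_on S \<Otimes>\<^sub>M M) (case_prod f) = (\<integral>\<^sup>+w. (\<integral>\<^sup>+s. indicator S s * ennreal ((norm (f s w))\<^sup>2) \<partial>lborel) \<partial>M)"
proof -
  interpret L: sigma_finite_measure "lborel_on S" using S by (rule sigma_finite_lborel_on)
  interpret P: pair_sigma_finite "lborel_on S" M ..
  have [measurable]: "case_prod f \<in> borel_measurable (lborel_on S \<Otimes>\<^sub>M M)" by (rule measurable_restrict_pair[OF f])
  have "sqnorm (lborel_on S \<Otimes>\<^sub>M M) (case_prod f) = (\<integral>\<^sup>+w. (\<integral>\<^sup>+s. ennreal ((norm (case_prod f (s, w)))\<^sup>2) \<partial>(lborel_on S)) \<partial>M)"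
    unfolding sqnorm_def by (rule P.nn_integral_snd[symmetric]) measurable
  also have "\<dots> = (\<integral>\<^sup>+w. (\<integral>\<^sup>+s. indicator S s * ennreal ((norm (f s w))\<^sup>2) \<partial>lborel) \<partial>M)"
    using S by (simp add: nn_integral_restrict_space mult.commute)
  finally show ?thesis .
qed

context moment_process
begin

lemma elementary_value_measurable:
  assumes [measurable]: "\<And>i. \<xi> i \<in> borel_measurable M"
  shows "case_prod (elementary_value N \<tau> \<xi> :: real \<Rightarrow> 'a \<Rightarrow> real ^ 'k ^ 'm) \<in> borel_measurable (lborel \<Otimes>\<^sub>M M)"
  unfolding elementary_value_def[abs_def] by measurable

text \<open>The three terms are the first interval of length \<open>h\<close>, where
  \<open>Y\<close> is compared with 0, the part of \<open>Y\<close> beyond \<open>R\<close>, and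
  \<open>2 * R\<close> times the mean error of the averages.\<close>

lemma truncated_error:
  assumes h: "h > 0" and t: "real N * h \<le> T" and \<kappa>: "\<And>v. 0 < v \<Longrightarrow> v \<le> 2 * h \<Longrightarrow> \<kappa> v \<le> e" and R: "R > 0"
  shows "sqnorm (lborel_on {0..real N * h} \<Otimes>\<^sub>M M)
      (\<lambda>(s, w). elementary_value N (\<lambda>i. real i * h) (truncated_average h R Y) s w - Y s w) \<le>
    ennreal (R\<^sup>2 * h) + ennreal (4 * R powr (2 - p)) * C + ennreal (2 * R) * (2 * e)"
proof -
  let ?Z = "elementary_value N (\<lambda>i. real i * h) (truncated_average h R Y)"
  let ?A = "elementary_value N (\<lambda>i. real i * h) (\<lambda>i w. average_before h (\<lambda>s. Y s w) i)"
  have [measurable]: "case_prod ?Z \<in> borel_measurable (lborel \<Otimes>\<^sub>M M)" "case_prod ?A \<in> borel_measurable (lborel \<Otimes>\<^sub>M M)"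
    by (intro elementary_value_measurable truncated_average_measurable R average_before_measurable)+
  have pt: "indicator {0..real N * h} s * ennreal ((norm (?Z s w - Y s w))\<^sup>2) \<le>
      (ennreal (R\<^sup>2) * indicator {0..h} s + ennreal (4 * R powr (2 - p)) * ennreal (norm (Y s w) powr p)) +
      ennreal (2 * R) * (indicator {h<..real N * h} s * ennreal (norm (Y s w - ?A s w)))" (is "?l \<le> ?r") for s w
  proof (cases "s \<in> {0..real N * h}")
    case True
    show ?thesis
    proof (cases "s \<le> h")
      case s: True
      \<comment> \<open>The time 0 belongs to no grid interval; up to \<open>h\<close> the average
        with number 0 is projected to itself.\<close>
      have "?Z s w = 0"
      proof (cases "s = 0")
        case True
        have "0 \<notin> {real i * h<..real (Suc i) * h}" for i using h by (simp add: not_less)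
        then show ?thesis unfolding elementary_value_def True by (intro sum.neutral) auto
      next
        case False
        then have "0 < s" "s \<le> real N * h" using True by auto
        then have "0 < N" by (cases N) auto
        then have "?Z s w = truncated_average h R Y 0 w"
          using \<open>0 < s\<close> s by (intro elementary_value_eq[OF h]) auto
        also have "\<dots> = 0" unfolding truncated_average_def average_before_def using R by (simp add: closest_point_self)
        finally show ?thesis .
      qed
      then have "(norm (?Z s w - Y s w))\<^sup>2 \<le> R\<^sup>2 + R powr (2 - p) * norm (Y s w) powr p"
        using truncation_error_zero[OF p R, of "Y s w"] by simp
      also have "\<dots> \<le> R\<^sup>2 + 4 * R powr (2 - p) * norm (Y s w) powr p" by simp
      finally have "ennreal ((norm (?Z s w - Y s w))\<^sup>2) \<le> ennreal (R\<^sup>2) + ennreal (4 * R powr (2 - p)) * ennreal (norm (Y s w) powr p)"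
        by (simp add: ennreal_leI flip: ennreal_mult' ennreal_plus)
      then show ?thesis using True s by (simp add: add_increasing2)
    next
      case s: False
      then have "0 < s" "s \<le> real N * h" using h True by auto
      then obtain i where i: "i < N" "real i * h < s" "s \<le> real (Suc i) * h" using ex_partition_interval[OF h] by blast
      have "(norm (?Z s w - Y s w))\<^sup>2 \<le> 2 * R * norm (Y s w - ?A s w) + 4 * R powr (2 - p) * norm (Y s w) powr p"
        unfolding elementary_value_eq[OF h i] truncated_average_def by (rule truncation_error[OF p R])
      then have "ennreal ((norm (?Z s w - Y s w))\<^sup>2) \<le> ennreal (2 * R * norm (Y s w - ?A s w) + 4 * R powr (2 - p) * norm (Y s w) powr p)"
        by (rule ennreal_leI)
      also have "\<dots> = ennreal (2 * R) * ennreal (norm (Y s w - ?A s w)) + ennreal (4 * R powr (2 - p)) * ennreal (norm (Y s w) powr p)"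
        using R by (simp flip: ennreal_mult' ennreal_plus)
      finally show ?thesis using True s by (simp add: add.commute)
    qed
  qed simp
  have "case_prod (\<lambda>s w. ?Z s w - Y s w) \<in> borel_measurable (lborel \<Otimes>\<^sub>M M)" by measurable
  then have "sqnorm (lborel_on {0..real N * h} \<Otimes>\<^sub>M M) (\<lambda>(s, w). ?Z s w - Y s w) =
      (\<integral>\<^sup>+w. (\<integral>\<^sup>+s. indicator {0..real N * h} s * ennreal ((norm (?Z s w - Y s w))\<^sup>2) \<partial>lborel) \<partial>M)"
    by (rule sqnorm_lborel_on) simp
  also have "\<dots> \<le> (\<integral>\<^sup>+w. (\<integral>\<^sup>+s. (ennreal (R\<^sup>2) * indicator {0..h} s + ennreal (4 * R powr (2 - p)) * ennreal (norm (Y s w) powr p)) +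
      ennreal (2 * R) * (indicator {h<..real N * h} s * ennreal (norm (Y s w - ?A s w))) \<partial>lborel) \<partial>M)"
    by (intro nn_integral_mono pt)
  also have "\<dots> = (\<integral>\<^sup>+w. (\<integral>\<^sup>+s. ennreal (R\<^sup>2) * indicator {0..h} s \<partial>lborel) \<partial>M) +
      (\<integral>\<^sup>+w. (\<integral>\<^sup>+s. ennreal (4 * R powr (2 - p)) * ennreal (norm (Y s w) powr p) \<partial>lborel) \<partial>M) +
      (\<integral>\<^sup>+w. (\<integral>\<^sup>+s. ennreal (2 * R) * (indicator {h<..real N * h} s * ennreal (norm (Y s w - ?A s w))) \<partial>lborel) \<partial>M)"
  proof -
    have "(\<integral>\<^sup>+s. (ennreal (R\<^sup>2) * indicator {0..h} s + ennreal (4 * R powr (2 - p)) * ennreal (norm (Y s w) powr p)) +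
        ennreal (2 * R) * (indicator {h<..real N * h} s * ennreal (norm (Y s w - ?A s w))) \<partial>lborel) =
      (\<integral>\<^sup>+s. ennreal (R\<^sup>2) * indicator {0..h} s \<partial>lborel) +
      (\<integral>\<^sup>+s. ennreal (4 * R powr (2 - p)) * ennreal (norm (Y s w) powr p) \<partial>lborel) +
      (\<integral>\<^sup>+s. ennreal (2 * R) * (indicator {h<..real N * h} s * ennreal (norm (Y s w - ?A s w))) \<partial>lborel)"
      if w: "w \<in> space M" for w
    proof -
      note [measurable] = Y_section_measurable[OF w]
      have [measurable]: "(\<lambda>s. ?A s w) \<in> borel_measurable borel" unfolding elementary_value_def by measurable
      show ?thesis by (subst nn_integral_add, measurable, subst nn_integral_add, measurable)
    qed
    then have "(\<integral>\<^sup>+w. (\<integral>\<^sup>+s. (ennreal (R\<^sup>2) * indicator {0..h} s + ennreal (4 * R powr (2 - p)) * ennreal (norm (Y s w) powr p)) +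
        ennreal (2 * R) * (indicator {h<..real N * h} s * ennreal (norm (Y s w - ?A s w))) \<partial>lborel) \<partial>M) =
      (\<integral>\<^sup>+w. ((\<integral>\<^sup>+s. ennreal (R\<^sup>2) * indicator {0..h} s \<partial>lborel) +
      (\<integral>\<^sup>+s. ennreal (4 * R powr (2 - p)) * ennreal (norm (Y s w) powr p) \<partial>lborel)) +
      (\<integral>\<^sup>+s. ennreal (2 * R) * (indicator {h<..real N * h} s * ennreal (norm (Y s w - ?A s w))) \<partial>lborel) \<partial>M)"
      by (rule nn_integral_cong)
    then show ?thesis by (simp only:) (subst nn_integral_add, measurable, subst nn_integral_add, measurable)
  qed
  also have "(\<integral>\<^sup>+w. (\<integral>\<^sup>+s. ennreal (R\<^sup>2) * indicator {0..h} s \<partial>lborel) \<partial>M) = ennreal (R\<^sup>2 * h)"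
    using h by (simp add: nn_integral_cmult_indicator emeasure_space_1 ennreal_mult')
  also have "(\<integral>\<^sup>+w. (\<integral>\<^sup>+s. ennreal (4 * R powr (2 - p)) * ennreal (norm (Y s w) powr p) \<partial>lborel) \<partial>M) =
      ennreal (4 * R powr (2 - p)) * (\<integral>\<^sup>+w. (\<integral>\<^sup>+s. ennreal (norm (Y s w) powr p) \<partial>lborel) \<partial>M)"
    by (rule iterated_cmult) measurable
  also have "(\<integral>\<^sup>+w. (\<integral>\<^sup>+s. ennreal (2 * R) * (indicator {h<..real N * h} s * ennreal (norm (Y s w - ?A s w))) \<partial>lborel) \<partial>M) =
      ennreal (2 * R) * (\<integral>\<^sup>+w. (\<integral>\<^sup>+s. indicator {h<..real N * h} s * ennreal (norm (Y s w - ?A s w)) \<partial>lborel) \<partial>M)"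
    by (rule iterated_cmult) measurable
  also have "ennreal (R\<^sup>2 * h) + ennreal (4 * R powr (2 - p)) * (\<integral>\<^sup>+w. (\<integral>\<^sup>+s. ennreal (norm (Y s w) powr p) \<partial>lborel) \<partial>M) +
     ennreal (2 * R) * (\<integral>\<^sup>+w. (\<integral>\<^sup>+s. indicator {h<..real N * h} s * ennreal (norm (Y s w - ?A s w)) \<partial>lborel) \<partial>M) \<le>
     ennreal (R\<^sup>2 * h) + ennreal (4 * R powr (2 - p)) * C + ennreal (2 * R) * (2 * e)"
    using average_error[OF h t \<kappa>] Y_moment by (intro add_mono mult_left_mono) auto
  finally show ?thesis .
qed

lemma Y_L2:
  assumes t: "t \<le> T"
  shows "(\<lambda>(s, w). Y s w) \<in> Lp_space 2 (lborel_on {0..t} \<Otimes>\<^sub>M M)"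
  unfolding Lp_space_2_iff
proof
  show "(\<lambda>(s, w). Y s w) \<in> borel_measurable (lborel_on {0..t} \<Otimes>\<^sub>M M)"
    by (rule measurable_restrict_pair[OF Y_measurable])
  have pt: "indicator {0..t} s * ennreal ((norm (Y s w))\<^sup>2) \<le> indicator {0..t} s + ennreal (norm (Y s w) powr p)" for s w
  proof -
    have "(norm (Y s w))\<^sup>2 \<le> 1 + norm (Y s w) powr p" using truncation_error_zero[OF p, of 1 "Y s w"] by simp
    then have "ennreal ((norm (Y s w))\<^sup>2) \<le> 1 + ennreal (norm (Y s w) powr p)"
      by (simp add: ennreal_leI flip: ennreal_1 ennreal_plus)
    then show ?thesis by (simp add: indicator_def)
  qed
  have "sqnorm (lborel_on {0..t} \<Otimes>\<^sub>M M) (\<lambda>(s, w). Y s w) = (\<integral>\<^sup>+w. (\<integral>\<^sup>+s. indicator {0..t} s * ennreal ((norm (Y s w))\<^sup>2) \<partial>lborel) \<partial>M)"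
    by (rule sqnorm_lborel_on[OF Y_measurable]) simp
  also have "\<dots> \<le> (\<integral>\<^sup>+w. (\<integral>\<^sup>+s. indicator {0..t} s + ennreal (norm (Y s w) powr p) \<partial>lborel) \<partial>M)"
    by (intro nn_integral_mono pt)
  also have "\<dots> = (\<integral>\<^sup>+w. emeasure lborel {0..t} + (\<integral>\<^sup>+s. ennreal (norm (Y s w) powr p) \<partial>lborel) \<partial>M)"
  proof (rule nn_integral_cong)
    fix w assume w: "w \<in> space M"
    note [measurable] = Y_section_measurable[OF w]
    show "(\<integral>\<^sup>+s. indicator {0..t} s + ennreal (norm (Y s w) powr p) \<partial>lborel) = emeasure lborel {0..t} + (\<integral>\<^sup>+s. ennreal (norm (Y s w) powr p) \<partial>lborel)"
      by (subst nn_integral_add) auto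
  qed
  also have "\<dots> = emeasure lborel {0..t} + (\<integral>\<^sup>+w. (\<integral>\<^sup>+s. ennreal (norm (Y s w) powr p) \<partial>lborel) \<partial>M)"
    by (subst nn_integral_add) (auto simp: emeasure_space_1)
  also have "\<dots> < \<infinity>"
    using le_less_trans[OF Y_moment C] by (cases "0 \<le> t") (auto simp: less_top)
  finally show "sqnorm (lborel_on {0..t} \<Otimes>\<^sub>M M) (\<lambda>(s, w). Y s w) < \<infinity>" .
qed

end

section \<open>Weak lower semicontinuity along a path\<close>

lemma ennreal_le_liminf:
  fixes a :: "nat \<Rightarrow> real" and b :: "nat \<Rightarrow> ennreal"
  assumes "a \<longlonglongrightarrow> l" "\<And>n. ennreal (a n) \<le> b n"
  shows "ennreal l \<le> liminf b"
proof -
  have "ennreal l = liminf (\<lambda>n. ennreal (a n))"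
    using tendsto_ennrealI[OF assms(1)] by (intro lim_imp_Liminf[symmetric]) auto
  also have "\<dots> \<le> liminf b" by (intro Liminf_mono) (simp add: assms(2))
  finally show ?thesis .
qed

lemma ennreal_integral_le:
  fixes f :: "'x \<Rightarrow> real"
  assumes f: "integrable M f" and le: "\<And>x. f x \<le> g x"
  shows "ennreal (\<integral>x. f x \<partial>M) \<le> (\<integral>\<^sup>+x. ennreal (g x) \<partial>M)"
proof -
  have i: "integrable M (\<lambda>x. max 0 (f x))" using f by simp
  have "ennreal (\<integral>x. f x \<partial>M) \<le> ennreal (\<integral>x. max 0 (f x) \<partial>M)"
    by (intro ennreal_leI integral_mono f i) simp
  also have "\<dots> = (\<integral>\<^sup>+x. ennreal (max 0 (f x)) \<partial>M)" by (rule nn_integral_eq_integral[symmetric, OF i]) simp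
  also have "\<dots> \<le> (\<integral>\<^sup>+x. ennreal (g x) \<partial>M)"
  proof (rule nn_integral_mono)
    fix x show "ennreal (max 0 (f x)) \<le> ennreal (g x)"
      using le[of x] by (cases "f x \<ge> 0") (auto simp: max_def ennreal_leI)
  qed
  finally show ?thesis .
qed

text \<open>
  A substitute for Young's inequality with weights chosen so that the term in \<open>a\<close> can be absorbed.
\<close>

lemma powr_absorb:
  fixes a b p :: real
  assumes "a \<ge> 0" "b \<ge> 0" "p > 1"
  shows "2 * (a powr (p - 1) * b) - a powr p \<le> 2 powr p * b powr p"
proof (cases "2 * b \<le> a")
  case True
  have "2 * (a powr (p - 1) * b) \<le> a powr (p - 1) * a" using mult_left_mono[OF True, of "a powr (p - 1)"] by (simp add: mult_ac)
  also have "\<dots> = a powr p" using assms by (cases "a = 0") (auto simp: powr_diff)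
  finally have "2 * (a powr (p - 1) * b) \<le> a powr p" .
  moreover have "0 \<le> 2 powr p * b powr p" by simp
  ultimately show ?thesis by linarith
next
  case False
  then have "2 * (a powr (p - 1) * b) \<le> (2 * b) powr (p - 1) * (2 * b)"
    using assms by (simp add: mult_mono powr_mono2)
  also have "\<dots> = (2 * b) powr p" using False assms by (simp add: powr_diff)
  also have "\<dots> = 2 powr p * b powr p" using assms by (simp add: powr_mult)
  finally have "2 * (a powr (p - 1) * b) \<le> 2 powr p * b powr p" .
  moreover have "0 \<le> a powr p" by simp
  ultimately show ?thesis by linarith
qed

context
  fixes y :: "real \<Rightarrow> 'e::euclidean_space" and yn :: "nat \<Rightarrow> real \<Rightarrow> 'e"
  assumes y: "integrable lborel y" and yn: "\<And>n. integrable lborel (yn n)"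
    and weak: "\<And>g B. g \<in> borel_measurable borel \<Longrightarrow> (\<And>s. norm (g s) \<le> B) \<Longrightarrow>
      (\<lambda>n. \<integral>s. g s \<bullet> yn n s \<partial>lborel) \<longlonglongrightarrow> (\<integral>s. g s \<bullet> y s \<partial>lborel)"
begin

lemma integrable_bounded_inner:
  fixes g z :: "real \<Rightarrow> 'e"
  assumes [measurable]: "g \<in> borel_measurable borel" and B: "\<And>s. norm (g s) \<le> B" and z: "integrable lborel z"
  shows "integrable lborel (\<lambda>s. g s \<bullet> z s)"
proof (rule Bochner_Integration.integrable_bound)
  show "integrable lborel (\<lambda>s. B * norm (z s))" using z by simp
  have [measurable]: "z \<in> borel_measurable borel" using z by auto
  show "(\<lambda>s. g s \<bullet> z s) \<in> borel_measurable lborel" by measurable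
  have "0 \<le> B" using B[of 0] norm_ge_zero[of "g 0"] by linarith
  then show "AE s in lborel. norm (g s \<bullet> z s) \<le> norm (B * norm (z s))"
    using B by (intro AE_I2) (auto intro!: order_trans[OF Cauchy_Schwarz_ineq2] mult_right_mono)
qed

text \<open>The norm of the translation difference is attained by testing with its direction. A
  substitution moves the shift from the path to the test function, which stays bounded, so weak
  convergence of the paths themselves is enough.\<close>

lemma weak_lsc_translation:
  "(\<integral>\<^sup>+s. indicator {v..T} s * ennreal (norm (y s - y (s - v))) \<partial>lborel) \<le>
    liminf (\<lambda>n. \<integral>\<^sup>+s. indicator {v..T} s * ennreal (norm (yn n s - yn n (s - v))) \<partial>lborel)"
proof -
  have [measurable]: "y \<in> borel_measurable borel" "yn n \<in> borel_measurable borel" for n using y yn[of n] by auto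
  define g where "g s = indicator {v..T} s *\<^sub>R sgn (y s - y (s - v))" for s
  have g [measurable]: "g \<in> borel_measurable borel" unfolding g_def[abs_def] sgn_div_norm by measurable
  have gb: "norm (g s) \<le> 1" for s unfolding g_def by (simp add: norm_sgn indicator_def)
  \<comment> \<open>The adjoint of the difference operator applied to \<open>g\<close>.\<close>
  define g' where "g' s = g s - g (s + v)" for s
  have g' [measurable]: "g' \<in> borel_measurable borel" unfolding g'_def[abs_def] by measurable
  have g'b: "norm (g' s) \<le> 2" for s unfolding g'_def using norm_triangle_ineq4[of "g s" "g (s + v)"] gb[of s] gb[of "s + v"] by linarith
  have shift_i: "integrable lborel (\<lambda>s. z (s - v))" if "integrable lborel z" for z :: "real \<Rightarrow> 'e"
    using lborel_integrable_real_affine[OF that, of 1 "- v"] by (simp add: algebra_simps)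
  have gi: "integrable lborel (\<lambda>s. g s \<bullet> (z s - z (s - v)))" if z: "integrable lborel z" for z :: "real \<Rightarrow> 'e"
    by (intro integrable_bounded_inner[OF g gb] Bochner_Integration.integrable_diff z shift_i)
  have eq: "(\<integral>s. g s \<bullet> (z s - z (s - v)) \<partial>lborel) = (\<integral>s. g' s \<bullet> z s \<partial>lborel)" if z: "integrable lborel z" for z :: "real \<Rightarrow> 'e"
  proof -
    have i1: "integrable lborel (\<lambda>s. g s \<bullet> z s)" by (rule integrable_bounded_inner[OF g gb z])
    have i2: "integrable lborel (\<lambda>s. g s \<bullet> z (s - v))" by (rule integrable_bounded_inner[OF g gb shift_i[OF z]])
    have i3: "integrable lborel (\<lambda>s. g (s + v) \<bullet> z s)" by (rule integrable_bounded_inner[OF _ gb z]) measurable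
    have "(\<integral>s. g s \<bullet> z (s - v) \<partial>lborel) = (\<integral>s. g (s + v) \<bullet> z s \<partial>lborel)"
      using lborel_integral_real_affine[of 1 "\<lambda>s. g s \<bullet> z (s - v)" v] by (simp add: add.commute)
    then show ?thesis using i1 i2 i3 unfolding g'_def by (simp add: inner_diff_left inner_diff_right)
  qed
  have "(\<integral>\<^sup>+s. indicator {v..T} s * ennreal (norm (y s - y (s - v))) \<partial>lborel) = (\<integral>\<^sup>+s. ennreal (g s \<bullet> (y s - y (s - v))) \<partial>lborel)"
  proof (rule nn_integral_cong)
    fix s
    show "indicator {v..T} s * ennreal (norm (y s - y (s - v))) = ennreal (g s \<bullet> (y s - y (s - v)))"
    proof (cases "y s = y (s - v)")
      case False
      then have "sgn (y s - y (s - v)) \<bullet> (y s - y (s - v)) = norm (y s - y (s - v))"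
        by (simp add: sgn_div_norm power2_norm_eq_inner[symmetric] power2_eq_square)
      then show ?thesis by (simp add: g_def indicator_def)
    qed simp
  qed
  also have "\<dots> = ennreal (\<integral>s. g s \<bullet> (y s - y (s - v)) \<partial>lborel)"
    by (rule nn_integral_eq_integral[OF gi[OF y]]) (simp add: g_def indicator_def sgn_div_norm)
  also have "\<dots> \<le> liminf (\<lambda>n. \<integral>\<^sup>+s. indicator {v..T} s * ennreal (norm (yn n s - yn n (s - v))) \<partial>lborel)"
  proof (rule ennreal_le_liminf)
    show "(\<lambda>n. \<integral>s. g s \<bullet> (yn n s - yn n (s - v)) \<partial>lborel) \<longlonglongrightarrow> (\<integral>s. g s \<bullet> (y s - y (s - v)) \<partial>lborel)"
      unfolding eq[OF y] eq[OF yn] by (rule weak[OF g' g'b])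
    fix n
    have "ennreal (\<integral>s. g s \<bullet> (yn n s - yn n (s - v)) \<partial>lborel) \<le> (\<integral>\<^sup>+s. ennreal (indicator {v..T} s * norm (yn n s - yn n (s - v))) \<partial>lborel)"
    proof (rule ennreal_integral_le[OF gi[OF yn]])
      fix s
      have "norm (g s) \<le> indicator {v..T} s" unfolding g_def by (simp add: norm_sgn indicator_def)
      then show "g s \<bullet> (yn n s - yn n (s - v)) \<le> indicator {v..T} s * norm (yn n s - yn n (s - v))"
        by (intro order_trans[OF norm_cauchy_schwarz] mult_right_mono) auto
    qed
    then show "ennreal (\<integral>s. g s \<bullet> (yn n s - yn n (s - v)) \<partial>lborel) \<le> (\<integral>\<^sup>+s. indicator {v..T} s * ennreal (norm (yn n s - yn n (s - v))) \<partial>lborel)"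
      by (simp add: ennreal_mult' ennreal_indicator)
  qed
  finally show ?thesis .
qed

text \<open>With the dual function \<open>g = norm y powr (p - 2) *\<^sub>R y\<close>, cut off where
  \<open>norm y > K\<close>, the integrals of \<open>2 * (g \<bullet> yn n) - g \<bullet> y\<close>
  converge to that of \<open>g \<bullet> y\<close>, the moment of the cut-off path, while
  \<open>powr_absorb\<close> bounds the integrand by
  \<open>2 powr p * norm (yn n) powr p\<close>.\<close>

lemma weak_lsc_moment:
  assumes p: "p > 1"
  shows "(\<integral>\<^sup>+s. ennreal (norm (y s) powr p) \<partial>lborel) \<le> liminf (\<lambda>n. \<integral>\<^sup>+s. ennreal (2 powr p * norm (yn n s) powr p) \<partial>lborel)"
    (is "_ \<le> ?L")
proof -
  have [measurable]: "y \<in> borel_measurable borel" "yn n \<in> borel_measurable borel" for n using y yn[of n] by auto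
  have K: "(\<integral>\<^sup>+s. ennreal (indicator {s. norm (y s) \<le> real K} s * norm (y s) powr p) \<partial>lborel) \<le> ?L" for K :: nat
  proof -
    let ?I = "indicator {s. norm (y s) \<le> real K} :: real \<Rightarrow> real"
    \<comment> \<open>The cut-off makes \<open>g\<close> bounded, hence admissible in
      \<open>weak\<close>; it is removed at the end by Fatou as \<open>K\<close> grows.\<close>
    define g where "g s = (?I s * norm (y s) powr (p - 2)) *\<^sub>R y s" for s
    have g [measurable]: "g \<in> borel_measurable borel" unfolding g_def[abs_def] by measurable
    have ng: "norm (g s) = ?I s * norm (y s) powr (p - 1)" for s
    proof (cases "y s = 0")
      case False
      then have "norm (y s) powr (p - 2) * norm (y s) = norm (y s) powr (p - 1)"
        using powr_add[of "norm (y s)" "p - 2" 1] by (simp add: add.commute)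
      then show ?thesis unfolding g_def by (simp add: abs_mult)
    qed (simp add: g_def)
    have gb: "norm (g s) \<le> real K powr (p - 1)" for s
      unfolding ng using p by (auto simp: indicator_def intro: powr_mono2)
    have gy: "g s \<bullet> y s = ?I s * norm (y s) powr p" for s
    proof (cases "y s = 0")
      case False
      have "norm (y s) powr (p - 2) * (y s \<bullet> y s) = norm (y s) powr p"
        using False powr_add[of "norm (y s)" "p - 2" 2] by (simp add: power2_norm_eq_inner)
      then show ?thesis unfolding g_def by simp
    qed (simp add: g_def)
    have i1: "integrable lborel (\<lambda>s. g s \<bullet> y s)" by (rule integrable_bounded_inner[OF g gb y])
    have i2: "integrable lborel (\<lambda>s. g s \<bullet> yn n s)" for n by (rule integrable_bounded_inner[OF g gb yn])
    have i3: "integrable lborel (\<lambda>s. 2 * (g s \<bullet> yn n s) - g s \<bullet> y s)" for n using i1 i2 by simp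
    have "(\<integral>\<^sup>+s. ennreal (?I s * norm (y s) powr p) \<partial>lborel) = ennreal (\<integral>s. g s \<bullet> y s \<partial>lborel)"
      using nn_integral_eq_integral[OF i1] by (simp add: gy)
    also have "\<dots> \<le> ?L"
    proof (rule ennreal_le_liminf)
      have "(\<lambda>n. 2 * (\<integral>s. g s \<bullet> yn n s \<partial>lborel) - (\<integral>s. g s \<bullet> y s \<partial>lborel)) \<longlonglongrightarrow> 2 * (\<integral>s. g s \<bullet> y s \<partial>lborel) - (\<integral>s. g s \<bullet> y s \<partial>lborel)"
        by (intro tendsto_intros weak[OF g gb])
      then show "(\<lambda>n. \<integral>s. 2 * (g s \<bullet> yn n s) - g s \<bullet> y s \<partial>lborel) \<longlonglongrightarrow> (\<integral>s. g s \<bullet> y s \<partial>lborel)"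
        using i1 i2 by simp
      fix n
      show "ennreal (\<integral>s. 2 * (g s \<bullet> yn n s) - g s \<bullet> y s \<partial>lborel) \<le> (\<integral>\<^sup>+s. ennreal (2 powr p * norm (yn n s) powr p) \<partial>lborel)"
      proof (rule ennreal_integral_le[OF i3])
        fix s
        have "g s \<bullet> yn n s \<le> norm (g s) * norm (yn n s)" by (rule norm_cauchy_schwarz)
        then have "2 * (g s \<bullet> yn n s) - g s \<bullet> y s \<le> ?I s * (2 * (norm (y s) powr (p - 1) * norm (yn n s)) - norm (y s) powr p)"
          unfolding ng gy by (simp add: algebra_simps)
        also have "\<dots> \<le> 2 powr p * norm (yn n s) powr p"
          using powr_absorb[of "norm (y s)" "norm (yn n s)" p] p by (simp add: indicator_def)
        finally show "2 * (g s \<bullet> yn n s) - g s \<bullet> y s \<le> 2 powr p * norm (yn n s) powr p" .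
      qed
    qed
    finally show ?thesis .
  qed
  have "(\<integral>\<^sup>+s. ennreal (norm (y s) powr p) \<partial>lborel) =
      (\<integral>\<^sup>+s. liminf (\<lambda>K. ennreal (indicator {s. norm (y s) \<le> real K} s * norm (y s) powr p)) \<partial>lborel)"
  proof (rule nn_integral_cong)
    fix s
    obtain K0 :: nat where K0: "norm (y s) \<le> real K0" using real_arch_simple[of "norm (y s)"] by (elim exE)
    have "(\<lambda>K. ennreal (indicator {s. norm (y s) \<le> real K} s * norm (y s) powr p)) \<longlonglongrightarrow> ennreal (norm (y s) powr p)"
      by (rule tendsto_eventually, rule eventually_mono[OF eventually_ge_at_top[of K0]]) (use K0 in simp)
    then show "ennreal (norm (y s) powr p) = liminf (\<lambda>K. ennreal (indicator {s. norm (y s) \<le> real K} s * norm (y s) powr p))"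
      by (intro lim_imp_Liminf[symmetric]) auto
  qed
  also have "\<dots> \<le> liminf (\<lambda>K. \<integral>\<^sup>+s. ennreal (indicator {s. norm (y s) \<le> real K} s * norm (y s) powr p) \<partial>lborel)"
    by (rule nn_integral_liminf) measurable
  also have "\<dots> \<le> ?L"
    by (rule Liminf_le) (simp_all add: K)
  finally show ?thesis .
qed

text \<open>Each component of an average is the pairing with a basis vector times the indicator of
  the interval, which is a bounded test function.\<close>

lemma weak_average_tendsto: "(\<lambda>n. average_before h (yn n) i) \<longlonglongrightarrow> average_before h y i"
proof (cases "i = 0")
  case False
  let ?I = "{real (i - 1) * h<..real i * h}"
  have int: "integrable lborel (\<lambda>u. indicator ?I u *\<^sub>R z u)" if "integrable lborel z" for z :: "real \<Rightarrow> 'e"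
    using that by (intro integrable_mult_indicator) auto
  have comp: "(\<integral>u. indicator ?I u *\<^sub>R z u \<partial>lborel) \<bullet> b = (\<integral>u. (indicator ?I u *\<^sub>R b) \<bullet> z u \<partial>lborel)"
    if "integrable lborel z" for z :: "real \<Rightarrow> 'e" and b
    using integral_inner_left[OF int[OF that], of b] by (simp add: inner_commute)
  have "(\<lambda>n. \<integral>u. indicator ?I u *\<^sub>R yn n u \<partial>lborel) \<longlonglongrightarrow> (\<integral>u. indicator ?I u *\<^sub>R y u \<partial>lborel)"
  proof (subst tendsto_componentwise_iff, intro ballI)
    fix b :: 'e assume b: "b \<in> Basis"
    show "(\<lambda>n. (\<integral>u. indicator ?I u *\<^sub>R yn n u \<partial>lborel) \<bullet> b) \<longlonglongrightarrow> (\<integral>u. indicator ?I u *\<^sub>R y u \<partial>lborel) \<bullet> b"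
      unfolding comp[OF y] comp[OF yn]
      by (rule weak[where B=1]) (use b in \<open>auto simp: indicator_def\<close>)
  qed
  then show ?thesis unfolding average_before_def using False by (simp add: tendsto_scaleR)
qed (simp add: average_before_def)

end

section \<open>From almost sure to mean square convergence of elementary integrals\<close>

lemma closest_point_cball_tendsto:
  fixes a :: "'e::euclidean_space"
  assumes "R \<ge> 0" "an \<longlonglongrightarrow> a"
  shows "(\<lambda>n. closest_point (cball 0 R) (an n)) \<longlonglongrightarrow> closest_point (cball 0 R) a"
proof -
  have "continuous (at a) (closest_point (cball 0 R :: 'e set))"
    using assms by (intro continuous_at_closest_point) auto
  then show ?thesis using assms(2) by (simp add: continuous_at tendsto_compose)
qed

lemma (in prob_space) nn_integral_le_of_liminf:
  assumes [measurable]: "\<And>n. f n \<in> borel_measurable M" and "AE w in M. g w \<le> liminf (\<lambda>n. f n w)"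
    and c: "\<And>n. (\<integral>\<^sup>+w. f n w \<partial>M) \<le> c"
  shows "(\<integral>\<^sup>+w. g w \<partial>M) \<le> c"
proof -
  have "(\<integral>\<^sup>+w. g w \<partial>M) \<le> (\<integral>\<^sup>+w. liminf (\<lambda>n. f n w) \<partial>M)"
    by (intro nn_integral_mono_AE assms)
  also have "\<dots> \<le> liminf (\<lambda>n. \<integral>\<^sup>+w. f n w \<partial>M)" by (rule nn_integral_liminf) measurable
  also have "\<dots> \<le> c" by (rule Liminf_le) (simp_all add: c)
  finally show ?thesis .
qed

text \<open>The square cut at \<open>L\<^sup>2\<close> tends to 0 in mean by dominated convergence;
  what exceeds the cut is at most the fourth power divided by \<open>L\<^sup>2\<close>, uniformly
  small in \<open>n\<close>.\<close>

lemma (in prob_space) sqnorm_tendsto_zero: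
  fixes f :: "nat \<Rightarrow> 'a \<Rightarrow> 'b::euclidean_space"
  assumes f [measurable]: "\<And>n. f n \<in> borel_measurable M"
    and lim: "AE w in M. (\<lambda>n. f n w) \<longlonglongrightarrow> 0"
    and K: "\<And>n. (\<integral>\<^sup>+w. ennreal (norm (f n w) ^ 4) \<partial>M) \<le> ennreal K" "K \<ge> 0"
  shows "(\<lambda>n. sqnorm M (f n)) \<longlonglongrightarrow> 0"
proof (rule tendsto_0_ennrealI)
  fix e :: real assume e: "e > 0"
  \<comment> \<open>Chosen so that \<open>K / L\<^sup>2 \<le> e / 2\<close>; the 1 added to
    \<open>K\<close> keeps \<open>L\<close> positive.\<close>
  define L where "L = sqrt (2 * (K + 1) / e)"
  have L: "L > 0" "K / L\<^sup>2 \<le> e / 2" unfolding L_def using e K(2) by (auto simp: field_simps)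
  let ?m = "\<lambda>n w. min ((norm (f n w))\<^sup>2) (L\<^sup>2)"
  have mi: "integrable M (?m n)" for n
    by (rule integrable_const_bound[where B="L\<^sup>2"]) auto
  have "(\<lambda>n. expectation (?m n)) \<longlonglongrightarrow> expectation (\<lambda>w. 0)"
  proof (rule integral_dominated_convergence[where w="\<lambda>_. L\<^sup>2"])
    show "AE w in M. (\<lambda>n. ?m n w) \<longlonglongrightarrow> 0"
      using lim
    proof eventually_elim
      case (elim w)
      then have "(\<lambda>n. ?m n w) \<longlonglongrightarrow> min ((norm (0::'b))\<^sup>2) (L\<^sup>2)" by (intro tendsto_min tendsto_intros)
      then show ?case by simp
    qed
  qed auto
  then have "\<forall>\<^sub>F n in sequentially. expectation (?m n) < e / 2"
    using e by (intro order_tendstoD(2)[of _ 0]) auto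
  then show "\<forall>\<^sub>F n in sequentially. sqnorm M (f n) \<le> ennreal e"
  proof eventually_elim
    case (elim n)
    have pt: "ennreal ((norm (f n w))\<^sup>2) \<le> ennreal (?m n w) + ennreal (1 / L\<^sup>2) * ennreal (norm (f n w) ^ 4)" for w
    proof -
      have "(norm (f n w))\<^sup>2 \<le> ?m n w + 1 / L\<^sup>2 * norm (f n w) ^ 4"
      proof (cases "(norm (f n w))\<^sup>2 \<le> L\<^sup>2")
        case False
        then have "(norm (f n w))\<^sup>2 * L\<^sup>2 \<le> (norm (f n w))\<^sup>2 * (norm (f n w))\<^sup>2" by (intro mult_left_mono) auto
        also have "\<dots> = norm (f n w) ^ 4" by (simp flip: power_add)
        finally have "(norm (f n w))\<^sup>2 \<le> 1 / L\<^sup>2 * norm (f n w) ^ 4" using L by (simp add: field_simps)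
        then show ?thesis by (simp add: add_increasing)
      qed simp
      then show ?thesis using L by (simp add: ennreal_leI flip: ennreal_mult' ennreal_plus)
    qed
    have "sqnorm M (f n) \<le> (\<integral>\<^sup>+w. ennreal (?m n w) + ennreal (1 / L\<^sup>2) * ennreal (norm (f n w) ^ 4) \<partial>M)"
      unfolding sqnorm_def by (intro nn_integral_mono pt)
    also have "\<dots> = ennreal (expectation (?m n)) + ennreal (1 / L\<^sup>2) * (\<integral>\<^sup>+w. ennreal (norm (f n w) ^ 4) \<partial>M)"
      by (subst nn_integral_add, simp, simp, subst nn_integral_cmult, simp, subst nn_integral_eq_integral[OF mi]) auto
    also have "\<dots> \<le> ennreal (e / 2) + ennreal (1 / L\<^sup>2) * ennreal K"
      using elim K(1)[of n] by (intro add_mono mult_left_mono ennreal_leI) auto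
    also have "\<dots> = ennreal (e / 2 + K / L\<^sup>2)" using e K(2) by (simp flip: ennreal_mult' ennreal_plus)
    also have "\<dots> \<le> ennreal e" by (intro ennreal_leI) (use L(2) in linarith)
    finally show ?case .
  qed
qed

text \<open>Cauchy-Schwarz for sums, applied twice.\<close>

lemma power4_sum_le:
  fixes a :: "'i \<Rightarrow> real"
  shows "(\<Sum>i\<in>I. a i) ^ 4 \<le> real (card I) ^ 3 * (\<Sum>i\<in>I. a i ^ 4)"
proof -
  have "(\<Sum>i\<in>I. a i) ^ 4 = ((\<Sum>i\<in>I. a i)\<^sup>2)\<^sup>2" by simp
  also have "\<dots> \<le> ((\<Sum>i\<in>I. (a i)\<^sup>2) * card I)\<^sup>2"
    by (intro power_mono sum_squared_le_sum_of_squares) simp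
  also have "\<dots> = (real (card I))\<^sup>2 * (\<Sum>i\<in>I. (a i)\<^sup>2)\<^sup>2" by (simp add: power_mult_distrib)
  also have "\<dots> \<le> (real (card I))\<^sup>2 * ((\<Sum>i\<in>I. ((a i)\<^sup>2)\<^sup>2) * card I)"
    by (intro mult_left_mono sum_squared_le_sum_of_squares) simp
  also have "\<dots> = real (card I) ^ 3 * (\<Sum>i\<in>I. ((a i)\<^sup>2)\<^sup>2)"
    by (simp only: power2_eq_square[of "real (card I)"] power3_eq_cube mult_ac)
  also have "\<dots> = real (card I) ^ 3 * (\<Sum>i\<in>I. a i ^ 4)"
    by simp
  finally show ?thesis .
qed

context wiener_space
begin

text \<open>A crude estimate that sums the norms of all increments. Its growth with \<open>N\<close>
  does no harm, since the grid stays fixed while the sequence index tends to infinity.\<close>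

lemma elementary_integral_moment4:
  fixes \<xi> :: "nat \<Rightarrow> 'a \<Rightarrow> real ^ 'k ^ 'm"
  assumes e: "elementary_process M F t N \<tau> \<xi>" and t: "t \<le> T"
    and R: "\<And>i w. i < N \<Longrightarrow> norm (\<xi> i w) \<le> R" "R \<ge> 0"
  shows "(\<integral>\<^sup>+w. ennreal (norm (elementary_integral W N \<tau> \<xi> w) ^ 4) \<partial>M) \<le>
    ennreal (real N ^ 3 * R ^ 4 * (real N * (3 * (real CARD('k) * T)\<^sup>2)))"
proof -
  have \<tau>: "0 \<le> \<tau> i" "\<tau> i \<le> \<tau> (Suc i)" "\<tau> (Suc i) \<le> T" if "i < N" for i
    using elementary_process_range[OF e, of i] elementary_process_range[OF e, of "Suc i"] elementary_process_times[OF e, of i "Suc i"] that t by auto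
  let ?D = "\<lambda>i w. norm (W (\<tau> (Suc i)) w - W (\<tau> i) w)"
  note m = increment_norm_moments[OF \<tau>]
  have pt: "norm (elementary_integral W N \<tau> \<xi> w) ^ 4 \<le> real N ^ 3 * R ^ 4 * (\<Sum>i<N. ?D i w ^ 4)" for w
  proof -
    have "norm (elementary_integral W N \<tau> \<xi> w) \<le> (\<Sum>i<N. R * ?D i w)"
      unfolding elementary_integral_def
      by (intro sum_norm_le order_trans[OF norm_matrix_vector_mult_le] mult_right_mono) (auto intro: R)
    then have "norm (elementary_integral W N \<tau> \<xi> w) ^ 4 \<le> (\<Sum>i<N. R * ?D i w) ^ 4" by (intro power_mono) auto
    also have "\<dots> \<le> real (card {..<N}) ^ 3 * (\<Sum>i<N. (R * ?D i w) ^ 4)" by (rule power4_sum_le)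
    also have "\<dots> = real N ^ 3 * R ^ 4 * (\<Sum>i<N. ?D i w ^ 4)"
      by (simp add: power_mult_distrib sum_distrib_left mult.assoc)
    finally show ?thesis .
  qed
  have i: "integrable M (\<lambda>w. real N ^ 3 * R ^ 4 * (\<Sum>i<N. ?D i w ^ 4))"
    using m(3) by (intro integrable_mult_right Bochner_Integration.integrable_sum) auto
  have "(\<integral>\<^sup>+w. ennreal (norm (elementary_integral W N \<tau> \<xi> w) ^ 4) \<partial>M) \<le> (\<integral>\<^sup>+w. ennreal (real N ^ 3 * R ^ 4 * (\<Sum>i<N. ?D i w ^ 4)) \<partial>M)"
    by (intro nn_integral_mono ennreal_leI pt)
  also have "\<dots> = ennreal (expectation (\<lambda>w. real N ^ 3 * R ^ 4 * (\<Sum>i<N. ?D i w ^ 4)))"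
    using R(2) by (intro nn_integral_eq_integral[OF i]) (auto intro!: mult_nonneg_nonneg sum_nonneg)
  also have "expectation (\<lambda>w. real N ^ 3 * R ^ 4 * (\<Sum>i<N. ?D i w ^ 4)) = real N ^ 3 * R ^ 4 * (\<Sum>i<N. expectation (\<lambda>w. ?D i w ^ 4))"
    using m(3) by (simp add: Bochner_Integration.integral_sum)
  also have "ennreal \<dots> \<le> ennreal (real N ^ 3 * R ^ 4 * (real N * (3 * (real CARD('k) * T)\<^sup>2)))"
  proof (intro ennreal_leI mult_left_mono)
    have "expectation (\<lambda>w. ?D i w ^ 4) \<le> 3 * (real CARD('k) * T)\<^sup>2" if i: "i < N" for i
    proof -
      have "expectation (\<lambda>w. ?D i w ^ 4) \<le> 3 * (real CARD('k) * (\<tau> (Suc i) - \<tau> i))\<^sup>2" by (rule m(4)[OF i i i])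
      also have "\<dots> \<le> 3 * (real CARD('k) * T)\<^sup>2"
        using \<tau>[OF i] by (intro mult_left_mono power_mono) auto
      finally show ?thesis .
    qed
    then have "(\<Sum>i<N. expectation (\<lambda>w. ?D i w ^ 4)) \<le> (\<Sum>i<N. 3 * (real CARD('k) * T)\<^sup>2)" by (intro sum_mono) simp
    then show "(\<Sum>i<N. expectation (\<lambda>w. ?D i w ^ 4)) \<le> real N * (3 * (real CARD('k) * T)\<^sup>2)" by simp
  qed (use R in auto)
  finally show ?thesis .
qed

end

text \<open>The case of two summands, indexed by \<open>bool\<close>, in
  \<open>power4_sum_le\<close>; the factor is 2 to the third power.\<close>

lemma norm_diff_power4_le: "norm (a - b) ^ 4 \<le> 8 * norm a ^ 4 + 8 * norm b ^ 4"
proof -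
  have "norm (a - b) ^ 4 \<le> (norm a + norm b) ^ 4" by (intro power_mono norm_triangle_ineq4) simp
  also have "\<dots> \<le> 8 * (norm a ^ 4 + norm b ^ 4)"
    using power4_sum_le[of "\<lambda>i. if i then norm a else norm b" UNIV] by (simp add: UNIV_bool algebra_simps)
  finally show ?thesis by simp
qed

text \<open>A common grid reduces the integrals to finite sums that converge almost surely term by
  term, since the matrix-vector product is continuous. The uniform fourth moment upgrades this to
  mean square. Adaptedness enters only within each filtration, never across two of them.\<close>

lemma elementary_integral_tendsto:
  fixes \<xi> :: "nat \<Rightarrow> 'a \<Rightarrow> real ^ 'k::finite ^ 'm::finite" and Wn :: "nat \<Rightarrow> real \<Rightarrow> 'a \<Rightarrow> real ^ 'k"
    and W :: "real \<Rightarrow> 'a \<Rightarrow> real ^ 'k"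
  assumes Wn: "\<And>n. wiener_space M T (Fn n) (Wn n)" and W: "wiener_space M T F W"
    and en: "\<And>n. elementary_process M (Fn n) t N \<tau> (\<xi>n n)" and e: "elementary_process M F t N \<tau> \<xi>" and t: "t \<le> T"
    and R: "\<And>n i w. i < N \<Longrightarrow> norm (\<xi>n n i w) \<le> R" "\<And>i w. i < N \<Longrightarrow> norm (\<xi> i w) \<le> R" "R \<ge> 0"
    and \<xi>_lim: "AE w in M. \<forall>i<N. (\<lambda>n. \<xi>n n i w) \<longlonglongrightarrow> \<xi> i w"
    and W_lim: "AE w in M. \<forall>s\<in>{0..T}. (\<lambda>n. Wn n s w) \<longlonglongrightarrow> W s w"
  shows "(\<lambda>n. sqnorm M (\<lambda>w. elementary_integral (Wn n) N \<tau> (\<xi>n n) w - elementary_integral W N \<tau> \<xi> w)) \<longlonglongrightarrow> 0"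
proof -
  interpret W: wiener_space M T F W by (rule W)
  let ?I = "elementary_integral W N \<tau> \<xi>" and ?In = "\<lambda>n. elementary_integral (Wn n) N \<tau> (\<xi>n n)"
  let ?K = "real N ^ 3 * R ^ 4 * (real N * (3 * (real CARD('k) * T)\<^sup>2))"
  have K: "0 \<le> ?K" using R(3) by simp
  have [measurable]: "?I \<in> borel_measurable M" using W.ito_bound(1)[OF e t] by (simp add: Lp_space_def)
  have [measurable]: "?In n \<in> borel_measurable M" for n
    using wiener_space.ito_bound(1)[OF Wn en t] by (simp add: Lp_space_def)
  show ?thesis
  proof (rule W.sqnorm_tendsto_zero)
    show "AE w in M. (\<lambda>n. ?In n w - ?I w) \<longlonglongrightarrow> 0"
      using \<xi>_lim W_lim
    proof eventually_elim
      case (elim w)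
      have "(\<lambda>n. ?In n w) \<longlonglongrightarrow> ?I w"
        unfolding elementary_integral_def
      proof (rule tendsto_sum)
        fix i assume "i \<in> {..<N}"
        then have i: "i < N" by simp
        have r: "\<tau> i \<in> {0..T}" "\<tau> (Suc i) \<in> {0..T}"
          using W.elementary_process_range[OF e, of i] W.elementary_process_range[OF e, of "Suc i"] i t by auto
        have 1: "(\<lambda>n. \<xi>n n i w) \<longlonglongrightarrow> \<xi> i w" using elim(1) i by blast
        have 2: "(\<lambda>n. Wn n (\<tau> (Suc i)) w - Wn n (\<tau> i) w) \<longlonglongrightarrow> W (\<tau> (Suc i)) w - W (\<tau> i) w"
          using elim(2) r by (intro tendsto_diff) auto
        have "continuous_on UNIV (\<lambda>x::(real ^ 'k ^ 'm) \<times> (real ^ 'k). fst x *v snd x)"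
          unfolding matrix_vector_mult_def by (intro continuous_intros)
        then have c: "isCont (\<lambda>x::(real ^ 'k ^ 'm) \<times> (real ^ 'k). fst x *v snd x) z" for z
          unfolding continuous_on_eq_continuous_at[OF open_UNIV] by blast
        show "(\<lambda>n. \<xi>n n i w *v (Wn n (\<tau> (Suc i)) w - Wn n (\<tau> i) w)) \<longlonglongrightarrow> \<xi> i w *v (W (\<tau> (Suc i)) w - W (\<tau> i) w)"
          using isCont_tendsto_compose[OF c tendsto_Pair[OF 1 2]] by simp
      qed
      then show ?case by (simp add: LIM_zero)
    qed
    fix n
    have "(\<integral>\<^sup>+w. ennreal (norm (?In n w - ?I w) ^ 4) \<partial>M) \<le> (\<integral>\<^sup>+w. 8 * ennreal (norm (?In n w) ^ 4) + 8 * ennreal (norm (?I w) ^ 4) \<partial>M)"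
    proof (rule nn_integral_mono)
      fix w
      have "ennreal (norm (?In n w - ?I w) ^ 4) \<le> ennreal (8 * norm (?In n w) ^ 4 + 8 * norm (?I w) ^ 4)"
        by (intro ennreal_leI norm_diff_power4_le)
      also have "\<dots> = 8 * ennreal (norm (?In n w) ^ 4) + 8 * ennreal (norm (?I w) ^ 4)"
        by (simp add: ennreal_mult')
      finally show "ennreal (norm (?In n w - ?I w) ^ 4) \<le> 8 * ennreal (norm (?In n w) ^ 4) + 8 * ennreal (norm (?I w) ^ 4)" .
    qed
    also have "\<dots> = 8 * (\<integral>\<^sup>+w. ennreal (norm (?In n w) ^ 4) \<partial>M) + 8 * (\<integral>\<^sup>+w. ennreal (norm (?I w) ^ 4) \<partial>M)"
      by (simp add: nn_integral_add nn_integral_cmult)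
    also have "\<dots> \<le> 8 * ennreal ?K + 8 * ennreal ?K"
      by (intro add_mono mult_left_mono wiener_space.elementary_integral_moment4[OF Wn en t R(1) R(3)]
          W.elementary_integral_moment4[OF e t R(2) R(3)]) auto
    also have "\<dots> = ennreal (16 * ?K)" 
    proof -
      have "8 * ennreal x + 8 * ennreal x = ennreal (16 * x)" for x
        by (simp add: ennreal_mult' flip: distrib_right)
      then show ?thesis .
    qed
    finally show "(\<integral>\<^sup>+w. ennreal (norm (?In n w - ?I w) ^ 4) \<partial>M) \<le> ennreal (16 * ?K)" .
  qed (use K in auto)
qed

text \<open>A three-term comparison through elementary integrands whose grid and error do not depend
  on \<open>n\<close>. The two outer errors are controlled by \<open>has_ito_integral_bound\<close>,
  the middle one by the convergence in \<open>approx\<close>, and the same approximations prove that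
  all the integrals exist.\<close>

lemma ito_integral_tendsto:
  fixes \<phi>n :: "nat \<Rightarrow> real \<Rightarrow> 'a \<Rightarrow> real ^ 'k::finite ^ 'm::finite" and Wn :: "nat \<Rightarrow> real \<Rightarrow> 'a \<Rightarrow> real ^ 'k"
    and W :: "real \<Rightarrow> 'a \<Rightarrow> real ^ 'k"
  assumes Wn: "\<And>n. wiener_space M T (Fn n) (Wn n)" and W: "wiener_space M T F W" and t: "t \<le> T"
    and \<phi>n: "\<And>n. (\<lambda>(s, w). \<phi>n n s w) \<in> Lp_space 2 (lborel_on {0..t} \<Otimes>\<^sub>M M)"
    and \<phi>: "(\<lambda>(s, w). \<phi> s w) \<in> Lp_space 2 (lborel_on {0..t} \<Otimes>\<^sub>M M)"
    and approx: "\<And>e. e > 0 \<Longrightarrow> \<exists>N \<tau> \<xi>n \<xi>.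
      (\<forall>n. elementary_process M (Fn n) t N \<tau> (\<xi>n n)) \<and> elementary_process M F t N \<tau> \<xi> \<and>
      (\<forall>n. sqnorm (lborel_on {0..t} \<Otimes>\<^sub>M M) (\<lambda>(s, w). elementary_value N \<tau> (\<xi>n n) s w - \<phi>n n s w) \<le> ennreal e) \<and>
      sqnorm (lborel_on {0..t} \<Otimes>\<^sub>M M) (\<lambda>(s, w). elementary_value N \<tau> \<xi> s w - \<phi> s w) \<le> ennreal e \<and>
      (\<lambda>n. sqnorm M (\<lambda>w. elementary_integral (Wn n) N \<tau> (\<xi>n n) w - elementary_integral W N \<tau> \<xi> w)) \<longlonglongrightarrow> 0"
  shows "Lp_tendsto 2 M (\<lambda>n. ito_integral M (Fn n) (Wn n) (\<phi>n n) t) (ito_integral M F W \<phi> t)"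
proof -
  interpret W: wiener_space M T F W by (rule W)
  let ?Jn = "\<lambda>n. ito_integral M (Fn n) (Wn n) (\<phi>n n) t" and ?J = "ito_integral M F W \<phi> t"
  let ?k = "of_nat CARD('k) :: ennreal"
  have Jn: "has_ito_integral M (Fn n) (Wn n) (\<phi>n n) t (?Jn n)" for n
  proof (rule wiener_space.has_ito_integral_exists[OF Wn \<phi>n t])
    fix e :: real assume "e > 0"
    from approx[OF this] obtain N \<tau> \<xi>n where
      "\<forall>n. elementary_process M (Fn n) t N \<tau> (\<xi>n n)"
      "\<forall>n. sqnorm (lborel_on {0..t} \<Otimes>\<^sub>M M) (\<lambda>(s, w). elementary_value N \<tau> (\<xi>n n) s w - \<phi>n n s w) \<le> ennreal e"
      by (elim exE conjE)
    then show "\<exists>N \<tau> \<xi>. elementary_process M (Fn n) t N \<tau> \<xi> \<and>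
        sqnorm (lborel_on {0..t} \<Otimes>\<^sub>M M) (\<lambda>(s, w). elementary_value N \<tau> \<xi> s w - \<phi>n n s w) \<le> ennreal e"
      by (intro exI[of _ N] exI[of _ \<tau>] exI[of _ "\<xi>n n"]) simp
  qed
  have J: "has_ito_integral M F W \<phi> t ?J"
  proof (rule W.has_ito_integral_exists[OF \<phi> t])
    fix e :: real assume "e > 0"
    from approx[OF this] obtain N \<tau> \<xi> where
      "elementary_process M F t N \<tau> \<xi>"
      "sqnorm (lborel_on {0..t} \<Otimes>\<^sub>M M) (\<lambda>(s, w). elementary_value N \<tau> \<xi> s w - \<phi> s w) \<le> ennreal e"
      by (elim exE conjE)
    then show "\<exists>N \<tau> \<xi>. elementary_process M F t N \<tau> \<xi> \<and>
        sqnorm (lborel_on {0..t} \<Otimes>\<^sub>M M) (\<lambda>(s, w). elementary_value N \<tau> \<xi> s w - \<phi> s w) \<le> ennreal e"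
      by (intro exI[of _ N] exI[of _ \<tau>] exI[of _ \<xi>]) simp
  qed
  have L2: "J \<in> Lp_space 2 M" if "has_ito_integral M F W \<phi> t J" for F W \<phi> and J :: "'a \<Rightarrow> real ^ 'm"
    using that unfolding has_ito_integral_def Lp_tendsto_def by (elim exE conjE)
  have [measurable]: "?J \<in> borel_measurable M" "?Jn n \<in> borel_measurable M" for n
    using L2[OF J] L2[OF Jn[of n]] by (auto simp: Lp_space_def)
  have "(\<lambda>n. sqnorm M (\<lambda>w. ?Jn n w - ?J w)) \<longlonglongrightarrow> 0"
  proof (rule tendsto_0_ennrealI)
    fix e :: real assume e: "e > 0"
    \<comment> \<open>With this choice each outer error is at most \<open>e / 8\<close>. The middle
      one is eventually below \<open>e / 16\<close>, and the nested triangle inequalities add up to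
      \<open>2 * (e / 8) + 2 * (2 * (e / 16) + 2 * (e / 8)) = e\<close>.\<close>
    define \<delta> where "\<delta> = e / (32 * real CARD('k))"
    have \<delta>: "\<delta> > 0" unfolding \<delta>_def using e by simp
    from approx[OF this] obtain N \<tau> \<xi>n \<xi> where
      en': "\<forall>n. elementary_process M (Fn n) t N \<tau> (\<xi>n n)" and e0: "elementary_process M F t N \<tau> \<xi>" and
      vn': "\<forall>n. sqnorm (lborel_on {0..t} \<Otimes>\<^sub>M M) (\<lambda>(s, w). elementary_value N \<tau> (\<xi>n n) s w - \<phi>n n s w) \<le> ennreal \<delta>" and
      v: "sqnorm (lborel_on {0..t} \<Otimes>\<^sub>M M) (\<lambda>(s, w). elementary_value N \<tau> \<xi> s w - \<phi> s w) \<le> ennreal \<delta>" and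
      lim: "(\<lambda>n. sqnorm M (\<lambda>w. elementary_integral (Wn n) N \<tau> (\<xi>n n) w - elementary_integral W N \<tau> \<xi> w)) \<longlonglongrightarrow> 0"
      by (elim exE conjE)
    note en = en'[rule_format] and vn = vn'[rule_format]
    let ?I = "elementary_integral W N \<tau> \<xi>" and ?In = "\<lambda>n. elementary_integral (Wn n) N \<tau> (\<xi>n n)"
    have [measurable]: "?I \<in> borel_measurable M" using W.ito_bound(1)[OF e0 t] by (simp add: Lp_space_def)
    have [measurable]: "?In n \<in> borel_measurable M" for n
      using wiener_space.ito_bound(1)[OF Wn en t] by (simp add: Lp_space_def)
    have k\<delta>: "4 * ?k * ennreal \<delta> = ennreal (e / 8)"
      unfolding \<delta>_def using e by (simp add: ennreal_of_nat_eq_real_of_nat flip: ennreal_mult' ennreal_numeral)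
    have bn: "sqnorm M (\<lambda>w. ?In n w - ?Jn n w) \<le> ennreal (e / 8)" for n
    proof -
      have "sqnorm M (\<lambda>w. ?In n w - ?Jn n w) \<le> 4 * ?k * sqnorm (lborel_on {0..t} \<Otimes>\<^sub>M M) (\<lambda>(s, w). elementary_value N \<tau> (\<xi>n n) s w - \<phi>n n s w)"
        by (rule wiener_space.has_ito_integral_bound[OF Wn Jn en t])
      also have "\<dots> \<le> 4 * ?k * ennreal \<delta>" by (intro mult_left_mono vn) simp
      finally show ?thesis unfolding k\<delta> .
    qed
    have b: "sqnorm M (\<lambda>w. ?I w - ?J w) \<le> ennreal (e / 8)"
    proof -
      have "sqnorm M (\<lambda>w. ?I w - ?J w) \<le> 4 * ?k * sqnorm (lborel_on {0..t} \<Otimes>\<^sub>M M) (\<lambda>(s, w). elementary_value N \<tau> \<xi> s w - \<phi> s w)"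
        using W.has_ito_integral_bound[OF J e0 t] .
      also have "\<dots> \<le> 4 * ?k * ennreal \<delta>" by (intro mult_left_mono v) simp
      finally show ?thesis unfolding k\<delta> .
    qed
    have "\<forall>\<^sub>F n in sequentially. sqnorm M (\<lambda>w. ?In n w - ?I w) < ennreal (e / 16)"
      using e by (intro order_tendstoD(2)[OF lim]) simp
    then show "\<forall>\<^sub>F n in sequentially. sqnorm M (\<lambda>w. ?Jn n w - ?J w) \<le> ennreal e"
    proof eventually_elim
      case (elim n)
      have "sqnorm M (\<lambda>w. ?Jn n w - ?J w) \<le> 2 * sqnorm M (\<lambda>w. ?Jn n w - ?In n w) + 2 * sqnorm M (\<lambda>w. ?In n w - ?J w)"
        by (rule sqnorm_triangle) measurable
      also have "\<dots> \<le> 2 * sqnorm M (\<lambda>w. ?Jn n w - ?In n w) + 2 * (2 * sqnorm M (\<lambda>w. ?In n w - ?I w) + 2 * sqnorm M (\<lambda>w. ?I w - ?J w))"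
        by (intro add_left_mono mult_left_mono sqnorm_triangle) measurable
      also have "\<dots> \<le> 2 * ennreal (e / 8) + 2 * (2 * ennreal (e / 16) + 2 * ennreal (e / 8))"
        using bn[of n] b elim unfolding sqnorm_minus_commute[of M "?Jn n"]
        by (intro add_mono mult_left_mono) auto
      also have "\<dots> = ennreal (2 * (e / 8) + 2 * (2 * (e / 16) + 2 * (e / 8)))"
        using e by (simp only: ennreal_plus ennreal_mult' ennreal_numeral zero_le_numeral divide_nonneg_nonneg less_imp_le add_nonneg_nonneg mult_nonneg_nonneg)
      also have "\<dots> = ennreal e" by simp
      finally show ?case .
    qed
  qed
  then show ?thesis unfolding Lp_tendsto_2_iff using L2[OF J] L2[OF Jn] by blast
qed

section \<open>Pairing with a bounded function on the torus\<close>

lemma sqnorm_cong: "(\<And>x. x \<in> space \<mu> \<Longrightarrow> f x = g x) \<Longrightarrow> sqnorm \<mu> f = sqnorm \<mu> g"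
  unfolding sqnorm_def by (intro nn_integral_cong) simp

lemma Lp_norm_one: "Lp_norm 1 \<mu> f = (\<integral>x. norm (f x) \<partial>\<mu>)"
  by (simp add: Lp_norm_def)

lemma Lp_space_one_iff: "f \<in> Lp_space 1 \<mu> \<longleftrightarrow> integrable \<mu> f"
  by (auto simp: Lp_space_def integrable_norm_iff)

text \<open>Splitting at a level \<open>l\<close> gives
  \<open>norm (f x) \<le> l + l powr (1 - r) * norm (f x) powr r\<close>. The level 1 shows
  integrability; the level \<open>Lp_norm r M f\<close> makes both terms proportional to the norm
  and replaces H\<ouml>lder's inequality. Norm 0 is treated apart since the level has to be
  positive.\<close>

lemma (in finite_measure) Lp_space_L1:
  fixes f :: "'a \<Rightarrow> 'b::euclidean_space"
  assumes r: "1 \<le> r" and f: "f \<in> Lp_space r M"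
  shows "integrable M f"
    and "(\<integral>x. norm (f x) \<partial>M) \<le> (measure M (space M) + 1) * Lp_norm r M f"
proof -
  have [measurable]: "f \<in> borel_measurable M" and i: "integrable M (\<lambda>x. norm (f x) powr r)"
    using f by (auto simp: Lp_space_def)
  have le: "norm (f x) \<le> l + l powr (1 - r) * norm (f x) powr r" if l: "l > 0" for x l
  proof (cases "norm (f x) \<le> l")
    case True
    then show ?thesis by (simp add: add_increasing2)
  next
    case False
    have "norm (f x) = norm (f x) powr (1 - r) * norm (f x) powr r"
      using False l by (simp flip: powr_add)
    also have "\<dots> \<le> l powr (1 - r) * norm (f x) powr r"
      using False l r by (intro mult_right_mono powr_mono2') auto
    finally show ?thesis using l by simp
  qed
  have i1: "integrable M (\<lambda>x. l + l powr (1 - r) * norm (f x) powr r)" for l using i by simp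
  show fi: "integrable M f"
  proof (rule Bochner_Integration.integrable_bound[OF i1[of 1]])
    show "AE x in M. norm (f x) \<le> norm (1 + 1 powr (1 - r) * norm (f x) powr r)"
      using le[of 1] by (intro AE_I2) simp
  qed simp
  let ?I = "\<integral>x. norm (f x) powr r \<partial>M"
  have I: "?I \<ge> 0" by simp
  show "(\<integral>x. norm (f x) \<partial>M) \<le> (measure M (space M) + 1) * Lp_norm r M f"
  proof (cases "?I = 0")
    case True
    then have "AE x in M. norm (f x) powr r = 0"
      using i by (subst (asm) integral_nonneg_eq_0_iff_AE) auto
    then have "(\<integral>x. norm (f x) \<partial>M) = (\<integral>x. 0 \<partial>M)" by (intro integral_cong_AE) auto
    then show ?thesis by (simp add: Lp_norm_def)
  next
    case False
    let ?l = "Lp_norm r M f"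
    have l: "?l > 0" "?l powr r = ?I" using I False r unfolding Lp_norm_def by (auto simp: powr_powr)
    have "(\<integral>x. norm (f x) \<partial>M) \<le> (\<integral>x. ?l + ?l powr (1 - r) * norm (f x) powr r \<partial>M)"
      using fi by (intro integral_mono i1 le l) auto
    also have "\<dots> = measure M (space M) * ?l + ?l powr (1 - r) * ?l powr r"
      using i l by simp
    also have "?l powr (1 - r) * ?l powr r = ?l" using l(1) by (simp flip: powr_add)
    finally show ?thesis by (simp add: algebra_simps)
  qed
qed

section \<open>Measurability on the space of integrable functions and of predictable
  processes\<close>

lemma sets_Lp_borelI:
  assumes "U \<subseteq> Lp_space p \<mu>"
    and "\<And>f. f \<in> U \<Longrightarrow> \<exists>e>0. \<forall>g\<in>Lp_space p \<mu>. Lp_norm p \<mu> (\<lambda>x. g x - f x) < e \<longrightarrow> g \<in> U"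
  shows "U \<in> sets (Lp_borel p \<mu>)"
  unfolding Lp_borel_def using assms by (subst sets_measure_of) auto

lemma space_Lp_borel [simp]: "space (Lp_borel p \<mu>) = Lp_space p \<mu>"
  unfolding Lp_borel_def by (rule space_measure_of) auto

lemma integrable_scaleR_bounded:
  fixes f :: "'x \<Rightarrow> 'e::euclidean_space" and b :: "'x \<Rightarrow> real"
  assumes [measurable]: "b \<in> borel_measurable \<mu>" and B: "\<And>x. \<bar>b x\<bar> \<le> B" and f: "integrable \<mu> f"
  shows "integrable \<mu> (\<lambda>x. b x *\<^sub>R f x)"
    and "norm (\<integral>x. b x *\<^sub>R f x \<partial>\<mu>) \<le> B * (\<integral>x. norm (f x) \<partial>\<mu>)"
proof -
  have [measurable]: "f \<in> borel_measurable \<mu>" using f by auto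
  have B0: "0 \<le> B" using B[of undefined] by linarith
  have le: "norm (b x *\<^sub>R f x) \<le> B * norm (f x)" for x using B by (simp add: mult_right_mono)
  show i: "integrable \<mu> (\<lambda>x. b x *\<^sub>R f x)"
  proof (rule Bochner_Integration.integrable_bound)
    show "integrable \<mu> (\<lambda>x. B * norm (f x))" using f by simp
    show "AE x in \<mu>. norm (b x *\<^sub>R f x) \<le> norm (B * norm (f x))"
      using le B0 by (intro AE_I2) (simp add: abs_mult)
  qed measurable
  have "norm (\<integral>x. b x *\<^sub>R f x \<partial>\<mu>) \<le> (\<integral>x. norm (b x *\<^sub>R f x) \<partial>\<mu>)" by (rule integral_norm_bound)
  also have "\<dots> \<le> (\<integral>x. B * norm (f x) \<partial>\<mu>)" by (intro integral_mono le integrable_norm[OF i] integrable_mult_right integrable_norm[OF f])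
  finally show "norm (\<integral>x. b x *\<^sub>R f x \<partial>\<mu>) \<le> B * (\<integral>x. norm (f x) \<partial>\<mu>)" by simp
qed

text \<open>The pairing is Lipschitz with constant \<open>B\<close> for the seminorm, so preimages
  of open sets are open. The radius uses \<open>B + 1\<close> to allow \<open>B = 0\<close>.\<close>

lemma measurable_pairing:
  fixes b :: "'x \<Rightarrow> real"
  assumes b: "b \<in> borel_measurable \<mu>" and B: "\<And>x. \<bar>b x\<bar> \<le> B"
  shows "(\<lambda>f :: 'x \<Rightarrow> 'e::euclidean_space. \<integral>x. b x *\<^sub>R f x \<partial>\<mu>) \<in> Lp_borel 1 \<mu> \<rightarrow>\<^sub>M borel"
proof (rule borel_measurableI)
  fix U :: "'e set" assume U: "open U"
  let ?F = "\<lambda>f :: 'x \<Rightarrow> 'e. \<integral>x. b x *\<^sub>R f x \<partial>\<mu>"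
  have B0: "0 \<le> B" using B[of undefined] by linarith
  show "?F -` U \<inter> space (Lp_borel 1 \<mu>) \<in> sets (Lp_borel 1 \<mu>)"
  proof (rule sets_Lp_borelI)
    fix f assume f: "f \<in> ?F -` U \<inter> space (Lp_borel 1 \<mu>)"
    then obtain e where e: "e > 0" "ball (?F f) e \<subseteq> U" using U open_contains_ball by blast
    have "g \<in> ?F -` U \<inter> space (Lp_borel 1 \<mu>)"
      if g: "g \<in> Lp_space 1 \<mu>" and d: "Lp_norm 1 \<mu> (\<lambda>x. g x - f x) < e / (B + 1)" for g
    proof -
      have fi: "integrable \<mu> f" "integrable \<mu> g" using f g by (auto simp: Lp_space_one_iff)
      have "?F g - ?F f = ?F (\<lambda>x. g x - f x)"
        using Bochner_Integration.integral_diff[OF integrable_scaleR_bounded(1)[OF b B fi(2)] integrable_scaleR_bounded(1)[OF b B fi(1)]]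
        by (simp add: scaleR_diff_right)
      then have "norm (?F g - ?F f) \<le> B * (\<integral>x. norm (g x - f x) \<partial>\<mu>)"
        using integrable_scaleR_bounded(2)[OF b B, of "\<lambda>x. g x - f x"] fi by simp
      also have "\<dots> \<le> (B + 1) * (\<integral>x. norm (g x - f x) \<partial>\<mu>)" by (intro mult_right_mono) auto
      also have "\<dots> < e" using d B0 by (simp add: Lp_norm_one field_simps)
      finally have "?F g \<in> ball (?F f) e" by (simp add: dist_norm norm_minus_commute)
      then show ?thesis using e g by auto
    qed
    then show "\<exists>e>0. \<forall>g\<in>Lp_space 1 \<mu>. Lp_norm 1 \<mu> (\<lambda>x. g x - f x) < e \<longrightarrow> g \<in> ?F -` U \<inter> space (Lp_borel 1 \<mu>)"
      using e B0 by (intro exI[of _ "e / (B + 1)"]) auto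
  qed auto
qed

text \<open>It suffices to trace the generators on times up to \<open>u\<close>: a rectangle
  starting at \<open>s \<le> u\<close> involves an event of \<open>F s\<close>, contained in
  \<open>G\<close>, and one starting later has empty trace. \<open>G\<close> is kept general to
  serve both for \<open>F u\<close>, which gives adaptedness, and for \<open>M\<close>, which gives
  joint measurability.\<close>

lemma measurable_predictable_progressive:
  assumes F: "filtration_on M T F" and f: "f \<in> predictable_sigma M T F \<rightarrow>\<^sub>M N" and u: "0 \<le> u" "u \<le> T"
    and G: "space G = space M" "\<And>s. 0 \<le> s \<Longrightarrow> s \<le> u \<Longrightarrow> sets (F s) \<subseteq> sets G"
  shows "f \<in> lborel_on {0..u} \<Otimes>\<^sub>M G \<rightarrow>\<^sub>M N"
proof -
  have Gsub: "A \<subseteq> space M" if "A \<in> sets G" for A using sets.sets_into_space[OF that] G(1) by simp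
  have "(\<lambda>x. x) \<in> lborel_on {0..u} \<Otimes>\<^sub>M G \<rightarrow>\<^sub>M predictable_sigma M T F"
    unfolding predictable_sigma_def
  proof (rule measurable_measure_of)
    show "{{0} \<times> A |A. A \<in> sets (F 0)} \<union> {{s<..t} \<times> A |s t A. 0 \<le> s \<and> s < t \<and> t \<le> T \<and> A \<in> sets (F s)} \<subseteq> Pow ({0..T} \<times> space M)"
    proof -
      have "A \<subseteq> space M" if "A \<in> sets (F s)" "0 \<le> s" "s \<le> T" for A s
        using F that sets.sets_into_space[of A "F s"] unfolding filtration_on_def subalgebra_def by auto
      then show ?thesis using u by fastforce
    qed
    show "(\<lambda>x. x) \<in> space (lborel_on {0..u} \<Otimes>\<^sub>M G) \<rightarrow> {0..T} \<times> space M"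
      using u G by (auto simp: space_pair_measure space_restrict_space)
    fix y assume "y \<in> {{0} \<times> A |A. A \<in> sets (F 0)} \<union> {{s<..t} \<times> A |s t A. 0 \<le> s \<and> s < t \<and> t \<le> T \<and> A \<in> sets (F s)}"
    then consider A where "y = {0} \<times> A" "A \<in> sets (F 0)"
      | s t A where "y = {s<..t} \<times> A" "0 \<le> s" "s < t" "A \<in> sets (F s)" by blast
    then show "(\<lambda>x. x) -` y \<inter> space (lborel_on {0..u} \<Otimes>\<^sub>M G) \<in> sets (lborel_on {0..u} \<Otimes>\<^sub>M G)"
    proof cases
      case 1
      then have A: "A \<in> sets G" using G(2)[of 0] u by auto
      have "(\<lambda>x. x) -` y \<inter> space (lborel_on {0..u} \<Otimes>\<^sub>M G) = ({0} \<inter> {0..u}) \<times> A"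
        using 1 Gsub[OF A] G(1) by (auto simp: space_pair_measure space_restrict_space)
      also have "\<dots> \<in> sets (lborel_on {0..u} \<Otimes>\<^sub>M G)"
        by (intro pair_measureI A) (auto simp: sets_restrict_space_iff)
      finally show ?thesis .
    next
      case 2
      show ?thesis
      proof (cases "s \<le> u")
        case True
        then have A: "A \<in> sets G" using G(2)[of s] 2 by auto
        have "(\<lambda>x. x) -` y \<inter> space (lborel_on {0..u} \<Otimes>\<^sub>M G) = ({s<..t} \<inter> {0..u}) \<times> A"
          using 2 Gsub[OF A] G(1) by (auto simp: space_pair_measure space_restrict_space)
        also have "\<dots> \<in> sets (lborel_on {0..u} \<Otimes>\<^sub>M G)"
          by (intro pair_measureI A) (auto simp: sets_restrict_space_iff)
        finally show ?thesis .
      next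
        case False
        then have "(\<lambda>x. x) -` y \<inter> space (lborel_on {0..u} \<Otimes>\<^sub>M G) = {}"
          using 2 by (auto simp: space_pair_measure space_restrict_space)
        then show ?thesis by simp
      qed
    qed
  qed
  from measurable_compose[OF this f] show ?thesis .
qed

lemma borel_measurable_extend_zero:
  fixes f :: "real \<times> 'a \<Rightarrow> 'e::euclidean_space"
  assumes f: "f \<in> borel_measurable (lborel_on S \<Otimes>\<^sub>M G)" and S: "S \<in> sets borel"
  shows "(\<lambda>x. indicator S (fst x) *\<^sub>R f x) \<in> borel_measurable (lborel \<Otimes>\<^sub>M G)"
proof -
  let ?\<Omega> = "{x. fst x \<in> S}" and ?P = "lborel \<Otimes>\<^sub>M G :: (real \<times> 'a) measure"
  have \<Omega>: "?\<Omega> \<inter> space ?P \<in> sets ?P"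
    using measurable_sets[OF measurable_fst[of "lborel :: real measure" G], of S] S by (simp add: vimage_def)
  have "fst \<in> restrict_space ?P ?\<Omega> \<rightarrow>\<^sub>M lborel_on S"
    by (rule measurable_restrict_space2) (auto intro: measurable_restrict_space1 measurable_fst simp: space_restrict_space)
  then have "(\<lambda>x. (fst x, snd x)) \<in> restrict_space ?P ?\<Omega> \<rightarrow>\<^sub>M lborel_on S \<Otimes>\<^sub>M G"
    by (intro measurable_Pair) (auto intro: measurable_restrict_space1 measurable_snd)
  from measurable_compose[OF this f] have "f \<in> borel_measurable (restrict_space ?P ?\<Omega>)" by simp
  then have "(\<lambda>x. indicator ?\<Omega> x *\<^sub>R f x) \<in> borel_measurable ?P"
    using borel_measurable_restrict_space_iff[OF \<Omega>] by blast
  moreover have "(\<lambda>x. indicator ?\<Omega> x *\<^sub>R f x) = (\<lambda>x. indicator S (fst x) *\<^sub>R f x)"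
    by (simp add: indicator_def fun_eq_iff)
  ultimately show ?thesis by simp
qed

text \<open>The map \<open>\<lambda>(s, x). V s x\<close> need not be jointly measurable, so Fubini
  is applied to the version \<open>v\<close>, and the result is carried to \<open>V\<close> for
  almost every time. The paired path thus becomes accessible to weak convergence of
  \<open>v\<close>.\<close>

lemma space_time_pairing:
  fixes v :: "real \<times> (real ^ 'd::finite) \<Rightarrow> real ^ 'k::finite ^ 'm::finite"
  assumes b: "b \<in> borel_measurable torus" and B: "\<And>x. \<bar>b x\<bar> \<le> B"
    and r: "1 \<le> r" and v: "v \<in> Lp_space r (lborel_on {0..T} \<Otimes>\<^sub>M torus)"
    and version: "space_time_version T v V" and V: "\<And>s. s \<in> {0..T} \<Longrightarrow> V s \<in> Lp_space 1 torus"
    and ym: "(\<lambda>s. indicator {0..T} s *\<^sub>R (\<integral>x. b x *\<^sub>R V s x \<partial>torus)) \<in> borel_measurable borel"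
    and g [measurable]: "g \<in> borel_measurable borel" and G: "\<And>s. norm (g s) \<le> G"
  shows "integrable lborel (\<lambda>s. indicator {0..T} s *\<^sub>R (\<integral>x. b x *\<^sub>R V s x \<partial>torus))"
    and "(\<integral>s. g s \<bullet> (indicator {0..T} s *\<^sub>R (\<integral>x. b x *\<^sub>R V s x \<partial>torus)) \<partial>lborel) =
      (\<integral>z. b (snd z) * (g (fst z) \<bullet> v z) \<partial>(lborel_on {0..T} \<Otimes>\<^sub>M torus))"
proof -
  let ?L = "lborel_on {0..T}" and ?T = "torus :: (real ^ 'd) measure"
  let ?Q = "?L \<Otimes>\<^sub>M ?T"
  interpret t: finite_measure ?T by (rule finite_measure_torus)
  interpret L: finite_measure ?L
    by (rule finite_measureI) (simp add: emeasure_restrict_space space_restrict_space emeasure_lborel_Icc_eq)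
  interpret P: pair_sigma_finite ?L ?T ..
  interpret Q: finite_measure ?Q by (rule finite_measure_pair_measure) unfold_locales
  note [measurable] = b
  have vi: "integrable ?Q v" by (rule Q.Lp_space_L1(1)[OF r v])
  have [measurable]: "v \<in> borel_measurable ?Q" using vi by auto
  have bm: "(\<lambda>z. b (snd z)) \<in> borel_measurable ?Q" by measurable
  have bvi: "integrable ?Q (\<lambda>z. b (snd z) *\<^sub>R v z)" by (rule integrable_scaleR_bounded(1)[OF bm B vi])
  have gm: "(\<lambda>z. g (fst z)) \<in> borel_measurable ?Q"
    by (rule measurable_compose[OF measurable_fst]) (simp add: measurable_restrict_space1)
  have bgvi: "integrable ?Q (\<lambda>z. b (snd z) * (g (fst z) \<bullet> v z))"
  proof (rule Bochner_Integration.integrable_bound)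
    have G0: "0 \<le> G" using G[of 0] norm_ge_zero[of "g 0"] by linarith
    show "integrable ?Q (\<lambda>z. G * norm (b (snd z) *\<^sub>R v z))" by (intro integrable_mult_right integrable_norm bvi)
    show "(\<lambda>z. b (snd z) * (g (fst z) \<bullet> v z)) \<in> borel_measurable ?Q" using gm by measurable
    have "norm (b (snd z) * (g (fst z) \<bullet> v z)) \<le> norm (G * norm (b (snd z) *\<^sub>R v z))" for z
    proof -
      have "\<bar>g (fst z) \<bullet> v z\<bar> \<le> G * norm (v z)"
        by (intro order_trans[OF Cauchy_Schwarz_ineq2] mult_right_mono G) auto
      then have "\<bar>b (snd z)\<bar> * \<bar>g (fst z) \<bullet> v z\<bar> \<le> \<bar>b (snd z)\<bar> * (G * norm (v z))" by (intro mult_left_mono) auto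
      then show ?thesis using G0 by (simp add: abs_mult mult_ac)
    qed
    then show "AE z in ?Q. norm (b (snd z) * (g (fst z) \<bullet> v z)) \<le> norm (G * norm (b (snd z) *\<^sub>R v z))" by simp
  qed
  have AE1: "AE s in ?L. integrable ?T (\<lambda>x. b x *\<^sub>R v (s, x))"
    using P.AE_integrable_fst'[OF bvi] by simp
  have vers: "AE s in ?L. AE x in ?T. v (s, x) = V s x" using version unfolding space_time_version_def .
  \<comment> \<open>Pairing depends only on almost-everywhere classes in \<open>x\<close>, so the
    choice of representatives at each time disappears here.\<close>
  have eqX: "AE s in ?L. (\<integral>x. b x *\<^sub>R v (s, x) \<partial>?T) = (\<integral>x. b x *\<^sub>R V s x \<partial>?T)"
    using vers AE_space
  proof eventually_elim
    case (elim s)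
    then have s: "s \<in> {0..T}" by (simp add: space_restrict_space)
    have [measurable]: "V s \<in> borel_measurable ?T" using V[OF s] by (simp add: Lp_space_def)
    have [measurable]: "(\<lambda>x. v (s, x)) \<in> borel_measurable ?T"
      by (rule measurable_Pair2[of v ?L]) (use s in \<open>simp_all add: space_restrict_space\<close>)
    show ?case using elim(1) by (intro integral_cong_AE) (auto elim: eventually_mono)
  qed
  have XL: "(\<lambda>s. \<integral>x. b x *\<^sub>R V s x \<partial>?T) \<in> borel_measurable ?L"
    using ym by (subst borel_measurable_restrict_space_iff) auto
  have "integrable ?L (\<lambda>s. \<integral>x. b x *\<^sub>R v (s, x) \<partial>?T)"
    using P.integrable_fst'[OF bvi] by simp
  then have "integrable ?L (\<lambda>s. \<integral>x. b x *\<^sub>R V s x \<partial>?T)"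
    using integrable_cong_AE[OF _ XL eqX] by auto
  then show "integrable lborel (\<lambda>s. indicator {0..T} s *\<^sub>R (\<integral>x. b x *\<^sub>R V s x \<partial>?T))"
    by (subst (asm) integrable_restrict_space) auto
  have "(\<integral>z. b (snd z) * (g (fst z) \<bullet> v z) \<partial>?Q) = (\<integral>s. (\<integral>x. b x * (g s \<bullet> v (s, x)) \<partial>?T) \<partial>?L)"
    using P.integral_fst'[OF bgvi] by simp
  also have "\<dots> = (\<integral>s. g s \<bullet> (\<integral>x. b x *\<^sub>R V s x \<partial>?T) \<partial>?L)"
  proof (rule integral_cong_AE)
    show "(\<lambda>s. \<integral>x. b x * (g s \<bullet> v (s, x)) \<partial>?T) \<in> borel_measurable ?L"
      using P.integrable_fst'[OF bgvi] by auto
    have "g \<in> borel_measurable ?L" by (simp add: measurable_restrict_space1)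
    with XL show "(\<lambda>s. g s \<bullet> (\<integral>x. b x *\<^sub>R V s x \<partial>?T)) \<in> borel_measurable ?L" by measurable
    show "AE s in ?L. (\<integral>x. b x * (g s \<bullet> v (s, x)) \<partial>?T) = g s \<bullet> (\<integral>x. b x *\<^sub>R V s x \<partial>?T)"
      using AE1 eqX
    proof eventually_elim
      case (elim s)
      have "(\<integral>x. b x * (g s \<bullet> v (s, x)) \<partial>?T) = (\<integral>x. g s \<bullet> (b x *\<^sub>R v (s, x)) \<partial>?T)" by simp
      also have "\<dots> = g s \<bullet> (\<integral>x. b x *\<^sub>R v (s, x) \<partial>?T)" using elim(1) by (intro integral_inner_right)
      finally show ?case using elim(2) by simp
    qed
  qed
  also have "\<dots> = (\<integral>s. g s \<bullet> (indicator {0..T} s *\<^sub>R (\<integral>x. b x *\<^sub>R V s x \<partial>?T)) \<partial>lborel)"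
    by (subst integral_restrict_space) auto
  finally show "(\<integral>s. g s \<bullet> (indicator {0..T} s *\<^sub>R (\<integral>x. b x *\<^sub>R V s x \<partial>?T)) \<partial>lborel) =
      (\<integral>z. b (snd z) * (g (fst z) \<bullet> v z) \<partial>?Q)" by simp
qed

text \<open>A bounded weight is paired with an integrable function, and on a finite measure space
  the integral norm is controlled by the norm of order \<open>r\<close>. So weak convergence in
  space and time may be tested with \<open>b (snd z)\<close> times a bounded function of
  time.\<close>

lemma pairing_Lp_dual:
  fixes b :: "real ^ 'd::finite \<Rightarrow> real" and g :: "real \<Rightarrow> real ^ 'k::finite ^ 'm::finite"
  assumes b: "b \<in> borel_measurable torus" and B: "\<And>x. \<bar>b x\<bar> \<le> B" and r: "1 \<le> r"
    and g [measurable]: "g \<in> borel_measurable borel" and G: "\<And>s. norm (g s) \<le> G"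
  shows "(\<lambda>f. \<integral>z. b (snd z) * (g (fst z) \<bullet> f z) \<partial>(lborel_on {0..T} \<Otimes>\<^sub>M torus)) \<in> Lp_dual r (lborel_on {0..T} \<Otimes>\<^sub>M torus)"
proof -
  let ?L = "lborel_on {0..T}" and ?T = "torus :: (real ^ 'd) measure"
  let ?Q = "?L \<Otimes>\<^sub>M ?T"
  interpret t: finite_measure ?T by (rule finite_measure_torus)
  interpret L: finite_measure ?L
    by (rule finite_measureI) (simp add: emeasure_restrict_space space_restrict_space emeasure_lborel_Icc_eq)
  interpret Q: finite_measure ?Q by (rule finite_measure_pair_measure) unfold_locales
  note [measurable] = b
  have gm [measurable]: "(\<lambda>z. g (fst z)) \<in> borel_measurable ?Q"
    by (rule measurable_compose[OF measurable_fst]) (simp add: measurable_restrict_space1)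
  have G0: "0 \<le> G" using G[of 0] norm_ge_zero[of "g 0"] by linarith
  have B0: "0 \<le> B" using B[of 0] by linarith
  have le: "\<bar>b (snd z) * (g (fst z) \<bullet> y)\<bar> \<le> B * G * norm y" for z :: "real \<times> (real ^ 'd)" and y
  proof -
    have "\<bar>g (fst z) \<bullet> y\<bar> \<le> G * norm y"
      by (intro order_trans[OF Cauchy_Schwarz_ineq2] mult_right_mono G) auto
    then have "\<bar>b (snd z)\<bar> * \<bar>g (fst z) \<bullet> y\<bar> \<le> B * (G * norm y)" using B B0 by (intro mult_mono) auto
    then show ?thesis by (simp add: abs_mult mult.assoc)
  qed
  have i: "integrable ?Q (\<lambda>z. b (snd z) * (g (fst z) \<bullet> f z))" if f: "f \<in> Lp_space r ?Q" for f :: "real \<times> (real ^ 'd) \<Rightarrow> real ^ 'k ^ 'm"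
  proof (rule Bochner_Integration.integrable_bound)
    have [measurable]: "f \<in> borel_measurable ?Q" using f by (simp add: Lp_space_def)
    show "integrable ?Q (\<lambda>z. B * G * norm (f z))" using Q.Lp_space_L1(1)[OF r f] by simp
    show "(\<lambda>z. b (snd z) * (g (fst z) \<bullet> f z)) \<in> borel_measurable ?Q" by measurable
    show "AE z in ?Q. norm (b (snd z) * (g (fst z) \<bullet> f z)) \<le> norm (B * G * norm (f z))"
      unfolding real_norm_def by (intro AE_I2 order_trans[OF le abs_ge_self])
  qed
  let ?\<Lambda> = "\<lambda>f :: real \<times> (real ^ 'd) \<Rightarrow> real ^ 'k ^ 'm. \<integral>z. b (snd z) * (g (fst z) \<bullet> f z) \<partial>?Q"
  show ?thesis
    unfolding Lp_dual_def mem_Collect_eq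
  proof (intro conjI ballI allI exI)
    fix f h :: "real \<times> (real ^ 'd) \<Rightarrow> real ^ 'k ^ 'm" assume "f \<in> Lp_space r ?Q" "h \<in> Lp_space r ?Q"
    then show "?\<Lambda> (\<lambda>x. f x + h x) = ?\<Lambda> f + ?\<Lambda> h"
      using i by (simp add: inner_add_right distrib_left)
  next
    fix c and f :: "real \<times> (real ^ 'd) \<Rightarrow> real ^ 'k ^ 'm" assume "f \<in> Lp_space r ?Q"
    have "?\<Lambda> (\<lambda>x. c *\<^sub>R f x) = (\<integral>z. c * (b (snd z) * (g (fst z) \<bullet> f z)) \<partial>?Q)"
      by (simp add: mult_ac)
    then show "?\<Lambda> (\<lambda>x. c *\<^sub>R f x) = c * ?\<Lambda> f" by simp
  next
    fix f :: "real \<times> (real ^ 'd) \<Rightarrow> real ^ 'k ^ 'm" assume f: "f \<in> Lp_space r ?Q"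
    have fi: "integrable ?Q f" by (rule Q.Lp_space_L1(1)[OF r f])
    have "\<bar>?\<Lambda> f\<bar> \<le> (\<integral>z. \<bar>b (snd z) * (g (fst z) \<bullet> f z)\<bar> \<partial>?Q)" by (rule integral_abs_bound)
    also have "\<dots> \<le> (\<integral>z. B * G * norm (f z) \<partial>?Q)"
      using i[OF f] fi by (intro integral_mono le) auto
    also have "\<dots> = B * G * (\<integral>z. norm (f z) \<partial>?Q)" by simp
    also have "\<dots> \<le> B * G * ((measure ?Q (space ?Q) + 1) * Lp_norm r ?Q f)"
      using B0 G0 by (intro mult_left_mono Q.Lp_space_L1(2)[OF r f]) auto
    finally show "\<bar>?\<Lambda> f\<bar> \<le> (B * G * (measure ?Q (space ?Q) + 1)) * Lp_norm r ?Q f" by (simp add: mult.assoc)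
  qed
qed

lemma measurable_Lp_norm_one:
  "(\<lambda>f :: 'x \<Rightarrow> 'e::euclidean_space. Lp_norm 1 \<mu> f) \<in> borel_measurable (Lp_borel 1 \<mu>)"
proof (rule borel_measurableI)
  fix U :: "real set" assume U: "open U"
  let ?F = "\<lambda>f :: 'x \<Rightarrow> 'e. Lp_norm 1 \<mu> f"
  show "?F -` U \<inter> space (Lp_borel 1 \<mu>) \<in> sets (Lp_borel 1 \<mu>)"
  proof (rule sets_Lp_borelI)
    fix f assume f: "f \<in> ?F -` U \<inter> space (Lp_borel 1 \<mu>)"
    then obtain e where e: "e > 0" "ball (?F f) e \<subseteq> U" using U open_contains_ball by blast
    have "g \<in> ?F -` U \<inter> space (Lp_borel 1 \<mu>)"
      if g: "g \<in> Lp_space 1 \<mu>" and d: "Lp_norm 1 \<mu> (\<lambda>x. g x - f x) < e" for g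
    proof -
      have fi: "integrable \<mu> f" "integrable \<mu> g" using f g by (auto simp: Lp_space_one_iff)
      have "\<bar>?F f - ?F g\<bar> = \<bar>\<integral>x. norm (f x) - norm (g x) \<partial>\<mu>\<bar>"
        using fi by (simp add: Lp_norm_one)
      also have "\<dots> \<le> (\<integral>x. \<bar>norm (f x) - norm (g x)\<bar> \<partial>\<mu>)" by (rule integral_abs_bound)
      also have "\<dots> \<le> (\<integral>x. norm (g x - f x) \<partial>\<mu>)"
        using fi by (intro integral_mono) (auto simp: norm_minus_commute[of "g _"] norm_triangle_ineq3)
      also have "\<dots> < e" using d by (simp add: Lp_norm_one)
      finally have "?F g \<in> ball (?F f) e" by (simp add: dist_real_def)
      then show ?thesis using e g by auto
    qed
    then show "\<exists>e>0. \<forall>g\<in>Lp_space 1 \<mu>. Lp_norm 1 \<mu> (\<lambda>x. g x - f x) < e \<longrightarrow> g \<in> ?F -` U \<inter> space (Lp_borel 1 \<mu>)"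
      using e by blast
  qed auto
qed

section \<open>The paired process and its adapted averages\<close>

context
  fixes M :: "'a measure" and T B :: real and F :: "real \<Rightarrow> 'a measure"
    and U :: "real \<Rightarrow> 'a \<Rightarrow> real ^ 'd::finite \<Rightarrow> real ^ 'k::finite ^ 'm::finite" and b :: "real ^ 'd \<Rightarrow> real"
  assumes F: "filtration_on M T F"
    and U: "(\<lambda>(t, w). U t w) \<in> predictable_sigma M T F \<rightarrow>\<^sub>M Lp_borel 1 torus"
    and b: "b \<in> borel_measurable torus" and B: "\<And>x. \<bar>b x\<bar> \<le> B"
begin

lemma predictable_in_L1: "s \<in> {0..T} \<Longrightarrow> w \<in> space M \<Longrightarrow> U s w \<in> Lp_space 1 torus"
  using measurable_space[OF U, of "(s, w)"] by (simp add: predictable_sigma_def space_measure_of_conv)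

lemma pairing_progressive:
  assumes u: "0 \<le> u" "u \<le> T" and G: "space G = space M" "\<And>s. 0 \<le> s \<Longrightarrow> s \<le> u \<Longrightarrow> sets (F s) \<subseteq> sets G"
  shows "(\<lambda>x. indicator {0..u} (fst x) *\<^sub>R (\<integral>z. b z *\<^sub>R U (fst x) (snd x) z \<partial>torus)) \<in> borel_measurable (lborel \<Otimes>\<^sub>M G)"
proof (rule borel_measurable_extend_zero)
  have "(\<lambda>(t, w). U t w) \<in> lborel_on {0..u} \<Otimes>\<^sub>M G \<rightarrow>\<^sub>M Lp_borel 1 torus"
    by (rule measurable_predictable_progressive[OF F U u G])
  from measurable_compose[OF this measurable_pairing[OF b B]]
  show "(\<lambda>x. \<integral>z. b z *\<^sub>R U (fst x) (snd x) z \<partial>torus) \<in> borel_measurable (lborel_on {0..u} \<Otimes>\<^sub>M G)"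
    by (simp add: case_prod_beta')
qed simp

text \<open>Cut off to \<open>{0..T}\<close>, the time range on which predictability of
  \<open>U\<close> gives information.\<close>

definition "ext_pairing s w = indicator {0..T} s *\<^sub>R (\<integral>z. b z *\<^sub>R U s w z \<partial>torus)"

lemma ext_pairing_measurable:
  assumes "0 \<le> T"
  shows "case_prod ext_pairing \<in> borel_measurable (lborel \<Otimes>\<^sub>M M)"
  using pairing_progressive[of T M] assms F
  unfolding ext_pairing_def[abs_def] filtration_on_def subalgebra_def by (simp add: case_prod_beta')

lemma ext_pairing_section: "0 \<le> T \<Longrightarrow> w \<in> space M \<Longrightarrow> (\<lambda>s. ext_pairing s w) \<in> borel_measurable borel"
  using measurable_Pair2[OF measurable_pair_swap[OF ext_pairing_measurable], of w] by simp

text \<open>The average with number \<open>i\<close> involves only times up to \<open>i * h\<close>,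
  so progressive measurability at that time and measurability of parameter integrals place it in
  \<open>F (real i * h)\<close>. This is why the average looks backwards.\<close>

lemma truncated_average_adapted:
  assumes h: "h > 0" and i: "real i * h \<le> T" and R: "R > 0"
  shows "truncated_average h R ext_pairing i \<in> borel_measurable (F (real i * h))"
proof -
  let ?u = "real i * h" and ?I = "{real (i - 1) * h<..real i * h}"
  have u: "0 \<le> ?u" "?u \<le> T" using h i by auto
  have [measurable]: "(\<lambda>x. indicator {0..?u} (fst x) *\<^sub>R (\<integral>z. b z *\<^sub>R U (fst x) (snd x) z \<partial>torus)) \<in> borel_measurable (lborel \<Otimes>\<^sub>M F ?u)"
    by (rule pairing_progressive[OF u]) (use F u in \<open>auto simp: filtration_on_def subalgebra_def\<close>)
  \<comment> \<open>On the averaging interval the cut-off at \<open>T\<close> may be exchanged for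
    one at \<open>?u\<close>, where progressive measurability is available.\<close>
  have eq: "indicator ?I s *\<^sub>R ext_pairing s w = indicator ?I s *\<^sub>R (indicator {0..?u} s *\<^sub>R (\<integral>z. b z *\<^sub>R U s w z \<partial>torus))" for s w
  proof -
    have "0 \<le> real (i - 1) * h" using h by simp
    then show ?thesis using u unfolding ext_pairing_def by (auto simp: indicator_def)
  qed
  have "(\<lambda>x. indicator ?I (fst x) *\<^sub>R (indicator {0..?u} (fst x) *\<^sub>R (\<integral>z. b z *\<^sub>R U (fst x) (snd x) z \<partial>torus))) \<in> borel_measurable (lborel \<Otimes>\<^sub>M F ?u)"
    by measurable
  from measurable_compose[OF measurable_pair_swap' this]
  have "(\<lambda>(w, s). indicator ?I s *\<^sub>R (indicator {0..?u} s *\<^sub>R (\<integral>z. b z *\<^sub>R U s w z \<partial>torus))) \<in> borel_measurable (F ?u \<Otimes>\<^sub>M lborel)"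
    by (simp add: case_prod_beta')
  from lborel.borel_measurable_lebesgue_integral[OF this]
  have "(\<lambda>w. \<integral>s. indicator ?I s *\<^sub>R ext_pairing s w \<partial>lborel) \<in> borel_measurable (F ?u)" unfolding eq .
  then have avg: "(\<lambda>w. average_before h (\<lambda>s. ext_pairing s w) i) \<in> borel_measurable (F ?u)"
    unfolding average_before_def by (cases "i = 0") auto
  have "continuous_on UNIV (closest_point (cball 0 R :: (real ^ 'k ^ 'm) set))"
    using R by (intro continuous_on_closest_point) auto
  then have "closest_point (cball 0 R :: (real ^ 'k ^ 'm) set) \<in> borel_measurable borel"
    by (rule borel_measurable_continuous_onI)
  from measurable_compose[OF avg this] show ?thesis unfolding truncated_average_def[abs_def] .
qed

lemma truncated_average_elementary:
  assumes h: "h > 0" and t: "real N * h \<le> T" and R: "R > 0"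
  shows "elementary_process M F (real N * h) N (\<lambda>i. real i * h) (truncated_average h R ext_pairing)"
  unfolding elementary_process_def
proof (intro conjI allI impI)
  fix i assume i: "i < N"
  have "real i * h \<le> real N * h" using i h by simp
  then show "truncated_average h R ext_pairing i \<in> borel_measurable (F (real i * h))"
    using t by (intro truncated_average_adapted h R) simp
  show "\<exists>C. \<forall>w\<in>space M. norm (truncated_average h R ext_pairing i w) \<le> C"
    using norm_truncated_average[of R] R by (intro exI[of _ R]) auto
qed (use h in \<open>auto simp: mult_right_mono\<close>)

lemma ext_pairing_bound:
  assumes "w \<in> space M"
  shows "norm (ext_pairing s w) \<le> indicator {0..T} s * (B * Lp_norm 1 torus (U s w))"
proof (cases "s \<in> {0..T}")
  case True
  then have "integrable torus (U s w)" using predictable_in_L1[OF _ assms] by (simp add: Lp_space_one_iff)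
  then show ?thesis
    using integrable_scaleR_bounded(2)[OF b B] True by (simp add: ext_pairing_def Lp_norm_one)
qed (simp add: ext_pairing_def)

lemma ext_pairing_moment:
  assumes M: "prob_space M" and T: "0 \<le> T" and p: "p > 0"
  shows "(\<integral>\<^sup>+w. (\<integral>\<^sup>+s. ennreal (norm (ext_pairing s w) powr p) \<partial>lborel) \<partial>M) \<le>
    ennreal (B powr p) * (\<integral>\<^sup>+w. (\<integral>\<^sup>+s. ennreal (Lp_norm 1 torus (U s w) powr p) \<partial>lborel_on {0..T}) \<partial>M)"
proof -
  interpret prob_space M by (rule M)
  interpret L: sigma_finite_measure "lborel_on {0..T}" by (rule sigma_finite_lborel_on) simp
  interpret P: pair_sigma_finite "lborel_on {0..T}" M ..
  have B0: "0 \<le> B" using B[of 0] by linarith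
  let ?f = "\<lambda>x. ennreal (Lp_norm 1 torus (U (fst x) (snd x)) powr p)"
  have "(\<lambda>(t, w). U t w) \<in> lborel_on {0..T} \<Otimes>\<^sub>M M \<rightarrow>\<^sub>M Lp_borel 1 torus"
    by (rule measurable_predictable_progressive[OF F U]) (use T F in \<open>auto simp: filtration_on_def subalgebra_def\<close>)
  from measurable_compose[OF this measurable_Lp_norm_one]
  have [measurable]: "(\<lambda>x. Lp_norm 1 torus (U (fst x) (snd x))) \<in> borel_measurable (lborel_on {0..T} \<Otimes>\<^sub>M M)"
    by (simp add: case_prod_beta')
  have pt: "ennreal (norm (ext_pairing s w) powr p) \<le> ennreal (B powr p) * ennreal (Lp_norm 1 torus (U s w) powr p) * indicator {0..T} s"
    if "w \<in> space M" for s w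
  proof (cases "s \<in> {0..T}")
    case True
    have n: "0 \<le> Lp_norm 1 torus (U s w)" by (simp add: Lp_norm_one)
    have "norm (ext_pairing s w) powr p \<le> (B * Lp_norm 1 torus (U s w)) powr p"
      using ext_pairing_bound[OF that, of s] True p by (intro powr_mono2) auto
    also have "\<dots> = B powr p * Lp_norm 1 torus (U s w) powr p" using n B0 by (simp add: powr_mult)
    finally show ?thesis using True by (simp add: ennreal_leI flip: ennreal_mult')
  qed (simp add: ext_pairing_def)
  have "(\<integral>\<^sup>+w. (\<integral>\<^sup>+s. ennreal (norm (ext_pairing s w) powr p) \<partial>lborel) \<partial>M) \<le>
      (\<integral>\<^sup>+w. (\<integral>\<^sup>+s. ennreal (B powr p) * ?f (s, w) \<partial>lborel_on {0..T}) \<partial>M)"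
    using pt by (auto intro!: nn_integral_mono simp: nn_integral_restrict_space)
  also have "\<dots> = integral\<^sup>N (lborel_on {0..T} \<Otimes>\<^sub>M M) (\<lambda>x. ennreal (B powr p) * ?f x)"
    by (rule P.nn_integral_snd) measurable
  also have "\<dots> = ennreal (B powr p) * integral\<^sup>N (lborel_on {0..T} \<Otimes>\<^sub>M M) ?f"
    by (rule nn_integral_cmult) measurable
  also have "integral\<^sup>N (lborel_on {0..T} \<Otimes>\<^sub>M M) ?f = (\<integral>\<^sup>+w. (\<integral>\<^sup>+s. ?f (s, w) \<partial>lborel_on {0..T}) \<partial>M)"
    by (rule P.nn_integral_snd[symmetric]) measurable
  finally show ?thesis by simp
qed

text \<open>For \<open>s\<close> between \<open>v\<close> and \<open>T\<close> both \<open>s\<close>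
  and \<open>s - v\<close> lie in \<open>{0..T}\<close>, so the extension by 0 never enters.\<close>

lemma ext_pairing_translation:
  assumes v: "v > 0"
  shows "(\<integral>\<^sup>+w. (\<integral>\<^sup>+s. indicator {v..T} s * ennreal (norm (ext_pairing s w - ext_pairing (s - v) w)) \<partial>lborel) \<partial>M) =
    (\<integral>\<^sup>+w. (\<integral>\<^sup>+s. ennreal (norm (\<integral>x. b x *\<^sub>R (U s w x - U (s - v) w x) \<partial>torus)) \<partial>lborel_on {v..T}) \<partial>M)"
proof (rule nn_integral_cong)
  fix w assume w: "w \<in> space M"
  have "indicator {v..T} s * ennreal (norm (ext_pairing s w - ext_pairing (s - v) w)) =
      ennreal (norm (\<integral>x. b x *\<^sub>R (U s w x - U (s - v) w x) \<partial>torus)) * indicator {v..T} s" for s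
  proof (cases "s \<in> {v..T}")
    case True
    then have s: "s \<in> {0..T}" "s - v \<in> {0..T}" using v by auto
    then have i: "integrable torus (U s w)" "integrable torus (U (s - v) w)"
      using predictable_in_L1[OF _ w] by (simp_all add: Lp_space_one_iff)
    show ?thesis
      using True s Bochner_Integration.integral_diff[OF integrable_scaleR_bounded(1)[OF b B i(1)] integrable_scaleR_bounded(1)[OF b B i(2)]]
      by (simp add: ext_pairing_def scaleR_diff_right)
  qed simp
  then show "(\<integral>\<^sup>+s. indicator {v..T} s * ennreal (norm (ext_pairing s w - ext_pairing (s - v) w)) \<partial>lborel) =
    (\<integral>\<^sup>+s. ennreal (norm (\<integral>x. b x *\<^sub>R (U s w x - U (s - v) w x) \<partial>torus)) \<partial>lborel_on {v..T})"
    by (simp add: nn_integral_restrict_space)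
qed

end

text \<open>Each of the three errors receives \<open>e / 3\<close>. The tail fixes \<open>R\<close>;
  the translation error, which carries the factor \<open>R\<close>, then demands a bound on
  \<open>\<kappa>\<close> near 0; finally \<open>N\<close> is taken large. The step \<open>h\<close>
  is \<open>t / N\<close>, so that the grid ends exactly at \<open>t\<close>.\<close>

lemma ex_truncation_parameters:
  fixes \<kappa> :: "real \<Rightarrow> ennreal"
  assumes e: "e > 0" and t: "t > 0" and p: "p > 2" and C: "C < \<infinity>" and \<kappa>: "(\<kappa> \<longlongrightarrow> 0) (at_right 0)"
  obtains R h :: real and N :: nat and e' :: ennreal where "R > 0" "h > 0" "real N * h = t"
    "\<And>v. 0 < v \<Longrightarrow> v \<le> 2 * h \<Longrightarrow> \<kappa> v \<le> e'"
    "ennreal (R\<^sup>2 * h) + ennreal (4 * R powr (2 - p)) * C + ennreal (2 * R) * (2 * e') \<le> ennreal e"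
proof -
  define c where "c = enn2real C"
  have Cc: "C = ennreal c" and c: "c \<ge> 0" using C unfolding c_def by auto
  \<comment> \<open>\<open>a\<close> plays the role of \<open>R powr (p - 2)\<close>; it is large
    enough for \<open>4 * c / a \<le> e / 3\<close>, and the added 1 keeps it positive if
    \<open>c = 0\<close>.\<close>
  define a where "a = 12 * c / e + 1"
  have a: "a \<ge> 1" unfolding a_def using c e by simp
  define R where "R = a powr (1 / (p - 2))"
  have R: "R > 0" unfolding R_def using a by simp
  have "R powr (2 - p) = a powr ((1 / (p - 2)) * (2 - p))" unfolding R_def by (simp add: powr_powr)
  also have "(1 / (p - 2)) * (2 - p) = - 1" using p by (simp add: field_simps)
  finally have Rp: "R powr (2 - p) = 1 / a" using a by (simp add: powr_minus divide_inverse)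
  have "12 * c \<le> e * a" unfolding a_def using e by (simp add: field_simps)
  then have 1: "4 * R powr (2 - p) * c \<le> e / 3" unfolding Rp using a by (simp add: field_simps)
  \<comment> \<open>The translation term is \<open>2 * R * (2 * k)\<close>, which this makes equal
    to \<open>e / 3\<close>.\<close>
  define k where "k = e / (12 * R)"
  have k: "k > 0" unfolding k_def using e R by simp
  have "\<forall>\<^sub>F v in at_right 0. \<kappa> v < ennreal k" using k by (intro order_tendstoD(2)[OF \<kappa>]) simp
  then obtain \<delta> where \<delta>: "\<delta> > 0" "\<And>v. 0 < v \<Longrightarrow> v < \<delta> \<Longrightarrow> \<kappa> v < ennreal k"
    unfolding eventually_at_right_field by auto
  obtain N :: nat where N: "max (2 * t / \<delta>) (3 * R\<^sup>2 * t / e) < real N" by (rule exE[OF reals_Archimedean2])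
  have "0 < 2 * t / \<delta>" using t \<delta> by simp
  then have N0: "real N > 0" using N by linarith
  define h where "h = t / real N"
  have h: "h > 0" "real N * h = t" unfolding h_def using t N0 by auto
  have "2 * t / \<delta> < real N" "3 * R\<^sup>2 * t / e < real N" using N by auto
  then have h2: "2 * h < \<delta>" and 2: "R\<^sup>2 * h \<le> e / 3" unfolding h_def using N0 \<delta> e by (simp_all add: field_simps)
  have "ennreal (R\<^sup>2 * h) + ennreal (4 * R powr (2 - p)) * C + ennreal (2 * R) * (2 * ennreal k) =
      ennreal (R\<^sup>2 * h + 4 * R powr (2 - p) * c + 2 * R * (2 * k))"
  proof -
    have "ennreal (4 * R powr (2 - p)) * ennreal c = ennreal (4 * R powr (2 - p) * c)"
      by (rule ennreal_mult'[symmetric]) simp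
    moreover have "2 * ennreal k = ennreal (2 * k)" by (simp add: ennreal_mult')
    moreover have "ennreal (2 * R) * ennreal (2 * k) = ennreal (2 * R * (2 * k))"
      by (rule ennreal_mult'[symmetric]) (use R in simp)
    moreover have "0 \<le> R\<^sup>2 * h" "0 \<le> 4 * R powr (2 - p) * c" "0 \<le> 2 * R * (2 * k)" using R c k h by auto
    ultimately show ?thesis unfolding Cc by (simp only: ennreal_plus add_nonneg_nonneg)
  qed
  also have "\<dots> \<le> ennreal e"
  proof (rule ennreal_leI)
    have "2 * R * (2 * k) = e / 3" unfolding k_def using R by simp
    then show "R\<^sup>2 * h + 4 * R powr (2 - p) * c + 2 * R * (2 * k) \<le> e" using 1 2 by linarith
  qed
  finally show ?thesis
    using that[of R h N "ennreal k"] R h \<delta>(2) h2 by (meson le_less_trans less_imp_le)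
qed

section \<open>Uniform bounds for the paired processes and convergence of their stochastic
  integrals\<close>

theorem corollary4p3:
  fixes M :: "'a measure"
    and T p r q :: real
    and Fn :: "nat \<Rightarrow> real \<Rightarrow> 'a measure" and F :: "real \<Rightarrow> 'a measure"
    and Wn :: "nat \<Rightarrow> real \<Rightarrow> 'a \<Rightarrow> real ^ 'k" and W :: "real \<Rightarrow> 'a \<Rightarrow> real ^ 'k"
    and Vn :: "nat \<Rightarrow> real \<Rightarrow> 'a \<Rightarrow> real ^ 'd \<Rightarrow> real ^ 'k ^ 'm"
    and V :: "real \<Rightarrow> 'a \<Rightarrow> real ^ 'd \<Rightarrow> real ^ 'k ^ 'm"
    and \<beta> :: "real ^ 'd \<Rightarrow> real"
  assumes T: "T > 0"
    and M: "prob_space M"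
    and filtration_n: "\<And>n. filtration_on M T (Fn n)"
    and wiener_n: "\<And>n. wiener_process M T (Fn n) (Wn n)"
    and filtration: "filtration_on M T F"
    and wiener: "wiener_process M T F W"
    and p: "p > 2" and r: "1 \<le> r" "r < p"
    and predictable_n:
      "\<And>n. (\<lambda>(t, \<omega>). Vn n t \<omega>) \<in> predictable_sigma M T (Fn n) \<rightarrow>\<^sub>M Lp_borel 1 torus"
    and predictable:
      "(\<lambda>(t, \<omega>). V t \<omega>) \<in> predictable_sigma M T F \<rightarrow>\<^sub>M Lp_borel 1 torus"
    and weak:
      "AE \<omega> in M. \<exists>vn v.
         (\<forall>n. space_time_version T (vn n) (\<lambda>t. Vn n t \<omega>)) \<and>
         space_time_version T v (\<lambda>t. V t \<omega>) \<and>
         Lp_weak_tendsto r (lborel_on {0..T} \<Otimes>\<^sub>M torus) vn v"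
    and moment:
      "(SUP n. \<integral>\<^sup>+\<omega>. (\<integral>\<^sup>+t. ennreal (Lp_norm 1 torus (Vn n t \<omega>) powr p)
         \<partial>lborel_on {0..T}) \<partial>M) < \<infinity>"
    and uniform:
      "AE \<omega> in M. uniform_limit {0..T} (\<lambda>n t. Wn n t \<omega>) (\<lambda>t. W t \<omega>) sequentially"
    and q: "q > real CARD('d) / 2"
    and \<beta>: "\<beta> \<in> sobolev q"
    and translation:
      "((\<lambda>h. SUP n. \<integral>\<^sup>+\<omega>. (\<integral>\<^sup>+t. ennreal (norm
          (\<integral>x. \<beta> x *\<^sub>R (Vn n t \<omega> x - Vn n (t - h) \<omega> x) \<partial>torus))
         \<partial>lborel_on {h..T}) \<partial>M) \<longlongrightarrow> 0) (at_right 0)"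
  shows "\<forall>t\<in>{0..T}. Lp_tendsto 2 M
    (\<lambda>n. ito_integral M (Fn n) (Wn n) (\<lambda>s \<omega>. \<integral>x. \<beta> x *\<^sub>R Vn n s \<omega> x \<partial>torus) t)
    (ito_integral M F W (\<lambda>s \<omega>. \<integral>x. \<beta> x *\<^sub>R V s \<omega> x \<partial>torus) t)"
proof -
  interpret prob_space M by (rule M)
  have T0: "0 \<le> T" using T by simp
  obtain B where B0: "B \<ge> 0" and B_AE: "AE x in torus. \<bar>\<beta> x\<bar> \<le> B"
    using sobolev_AE_bounded[OF \<beta> q] by blast
  have \<beta>m [measurable]: "\<beta> \<in> borel_measurable torus" using \<beta> by (simp add: sobolev_def Lp_space_def)
  \<comment> \<open>The pairing lemmas ask for a bound at every point; \<open>\<beta>\<close> is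
    bounded almost everywhere, and altering it on a null set leaves all pairings unchanged.\<close>
  define b where "b x = (if \<bar>\<beta> x\<bar> \<le> B then \<beta> x else 0)" for x
  have b [measurable]: "b \<in> borel_measurable torus" unfolding b_def[abs_def] by measurable
  have B: "\<bar>b x\<bar> \<le> B" for x unfolding b_def using B0 by simp
  have \<beta>b: "(\<integral>x. \<beta> x *\<^sub>R f x \<partial>torus) = (\<integral>x. b x *\<^sub>R f x \<partial>torus)" if "integrable torus f" for f :: "real ^ 'd \<Rightarrow> real ^ 'k ^ 'm"
  proof (rule integral_cong_AE)
    have [measurable]: "f \<in> borel_measurable torus" using that by auto
    show "(\<lambda>x. \<beta> x *\<^sub>R f x) \<in> borel_measurable torus" "(\<lambda>x. b x *\<^sub>R f x) \<in> borel_measurable torus" by measurable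
    show "AE x in torus. \<beta> x *\<^sub>R f x = b x *\<^sub>R f x"
      using B_AE by eventually_elim (simp add: b_def)
  qed
  note L1n = predictable_in_L1[OF filtration_n predictable_n b B]
  note L1 = predictable_in_L1[OF filtration predictable b B]
  define Yn where "Yn n = ext_pairing T (Vn n) b" for n
  define Y where "Y = ext_pairing T V b"
  have XYn: "(\<integral>x. \<beta> x *\<^sub>R Vn n s w x \<partial>torus) = Yn n s w" if "s \<in> {0..T}" "w \<in> space M" for n s w
    using \<beta>b L1n[OF that] that unfolding Yn_def ext_pairing_def[OF filtration_n predictable_n b B] by (simp add: Lp_space_one_iff)
  have XY: "(\<integral>x. \<beta> x *\<^sub>R V s w x \<partial>torus) = Y s w" if "s \<in> {0..T}" "w \<in> space M" for s w
    using \<beta>b L1[OF that] that unfolding Y_def ext_pairing_def[OF filtration predictable b B] by (simp add: Lp_space_one_iff)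
  define \<kappa> where "\<kappa> h = (SUP n. \<integral>\<^sup>+\<omega>. (\<integral>\<^sup>+t. ennreal (norm
          (\<integral>x. \<beta> x *\<^sub>R (Vn n t \<omega> x - Vn n (t - h) \<omega> x) \<partial>torus)) \<partial>lborel_on {h..T}) \<partial>M)" for h
  define C0 where "C0 = (SUP n. \<integral>\<^sup>+\<omega>. (\<integral>\<^sup>+t. ennreal (Lp_norm 1 torus (Vn n t \<omega>) powr p) \<partial>lborel_on {0..T}) \<partial>M)"
  \<comment> \<open>The factor \<open>2 powr p\<close> is the loss in
    \<open>weak_lsc_moment\<close>; it is included from the start so that one constant serves the
    sequence and the limit.\<close>
  define C where "C = ennreal (2 powr p) * (ennreal (B powr p) * C0)"
  have C: "C < \<infinity>" unfolding C_def using moment by (simp add: C0_def ennreal_mult_less_top)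
  have Yn_m: "case_prod (Yn n) \<in> borel_measurable (lborel \<Otimes>\<^sub>M M)" for n
    unfolding Yn_def by (rule ext_pairing_measurable[OF filtration_n predictable_n b B T0])
  have Y_m: "case_prod Y \<in> borel_measurable (lborel \<Otimes>\<^sub>M M)"
    unfolding Y_def by (rule ext_pairing_measurable[OF filtration predictable b B T0])
  have Yn_0: "Yn n s w = 0" if "s \<notin> {0..T}" for n s w
    unfolding Yn_def ext_pairing_def[OF filtration_n predictable_n b B] using that by simp
  have Y_0: "Y s w = 0" if "s \<notin> {0..T}" for s w
    unfolding Y_def ext_pairing_def[OF filtration predictable b B] using that by simp
  have mom: "(\<integral>\<^sup>+w. (\<integral>\<^sup>+s. ennreal (norm (Yn n s w) powr p) \<partial>lborel) \<partial>M) \<le> ennreal (B powr p) * C0" for n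
  proof -
    have "(\<integral>\<^sup>+w. (\<integral>\<^sup>+s. ennreal (norm (Yn n s w) powr p) \<partial>lborel) \<partial>M) \<le>
        ennreal (B powr p) * (\<integral>\<^sup>+w. (\<integral>\<^sup>+s. ennreal (Lp_norm 1 torus (Vn n s w) powr p) \<partial>lborel_on {0..T}) \<partial>M)"
      unfolding Yn_def using p by (intro ext_pairing_moment[OF filtration_n predictable_n b B M T0]) simp
    also have "\<dots> \<le> ennreal (B powr p) * C0"
      unfolding C0_def by (intro mult_left_mono SUP_upper) auto
    finally show ?thesis .
  qed
  have trans: "(\<integral>\<^sup>+w. (\<integral>\<^sup>+s. indicator {v..T} s * ennreal (norm (Yn n s w - Yn n (s - v) w)) \<partial>lborel) \<partial>M) \<le> \<kappa> v"
    if v: "v > 0" for n v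
  proof -
    have "(\<integral>\<^sup>+w. (\<integral>\<^sup>+s. indicator {v..T} s * ennreal (norm (Yn n s w - Yn n (s - v) w)) \<partial>lborel) \<partial>M) =
        (\<integral>\<^sup>+w. (\<integral>\<^sup>+s. ennreal (norm (\<integral>x. b x *\<^sub>R (Vn n s w x - Vn n (s - v) w x) \<partial>torus)) \<partial>lborel_on {v..T}) \<partial>M)"
      unfolding Yn_def by (rule ext_pairing_translation[OF filtration_n predictable_n b B v])
    also have "\<dots> = (\<integral>\<^sup>+w. (\<integral>\<^sup>+s. ennreal (norm (\<integral>x. \<beta> x *\<^sub>R (Vn n s w x - Vn n (s - v) w x) \<partial>torus)) \<partial>lborel_on {v..T}) \<partial>M)"
    proof (intro nn_integral_cong)
      fix w s assume w: "w \<in> space M" and s: "s \<in> space (lborel_on {v..T})"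
      then have "s \<in> {0..T}" "s - v \<in> {0..T}" using v by (auto simp: space_restrict_space)
      then have "integrable torus (\<lambda>x. Vn n s w x - Vn n (s - v) w x)"
        using L1n[OF _ w] by (simp add: Lp_space_one_iff)
      from \<beta>b[OF this] show "ennreal (norm (\<integral>x. b x *\<^sub>R (Vn n s w x - Vn n (s - v) w x) \<partial>torus)) =
          ennreal (norm (\<integral>x. \<beta> x *\<^sub>R (Vn n s w x - Vn n (s - v) w x) \<partial>torus))" by simp
    qed
    also have "\<dots> \<le> \<kappa> v" unfolding \<kappa>_def by (intro SUP_upper) simp
    finally show ?thesis .
  qed
  have "ennreal (B powr p) * C0 \<le> C"
  proof -
    have "1 \<le> ennreal (2 powr p)" using p ge_one_powr_ge_zero[of 2 p] by (simp flip: ennreal_1)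
    then show ?thesis unfolding C_def using mult_right_mono[of 1 "ennreal (2 powr p)" "ennreal (B powr p) * C0"] by simp
  qed
  then have mp_n: "moment_process M T p C \<kappa> (Yn n)" for n
    by (intro moment_process.intro moment_process_axioms.intro M p Yn_m Yn_0 C order_trans[OF mom] trans)
  \<comment> \<open>Weak convergence of the versions, translated for almost every outcome into weak
    convergence of the paired paths; outside one null set it holds for all bounded Borel test
    functions at once.\<close>
  have lim: "AE w in M. integrable lborel (\<lambda>s. Y s w) \<and> (\<forall>n. integrable lborel (\<lambda>s. Yn n s w)) \<and>
      (\<forall>g G. g \<in> borel_measurable borel \<longrightarrow> (\<forall>s. norm (g s) \<le> G) \<longrightarrow>
        (\<lambda>n. \<integral>s. g s \<bullet> Yn n s w \<partial>lborel) \<longlonglongrightarrow> (\<integral>s. g s \<bullet> Y s w \<partial>lborel))"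
    using weak AE_space
  proof eventually_elim
    case (elim w)
    then obtain vn v where vn: "\<forall>n. space_time_version T (vn n) (\<lambda>t. Vn n t w)" and v: "space_time_version T v (\<lambda>t. V t w)"
      and wk: "Lp_weak_tendsto r (lborel_on {0..T} \<Otimes>\<^sub>M torus) vn v" by (elim exE conjE)
    have vnL: "vn n \<in> Lp_space r (lborel_on {0..T} \<Otimes>\<^sub>M torus)" and vL: "v \<in> Lp_space r (lborel_on {0..T} \<Otimes>\<^sub>M torus)" for n
      using wk unfolding Lp_weak_tendsto_def by auto
    have w: "w \<in> space M" using elim by simp
    have Yne: "(\<lambda>s. Yn n s w) = (\<lambda>s. indicator {0..T} s *\<^sub>R (\<integral>x. b x *\<^sub>R Vn n s w x \<partial>torus))" for n
      unfolding Yn_def ext_pairing_def[OF filtration_n predictable_n b B] ..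
    have Ye: "(\<lambda>s. Y s w) = (\<lambda>s. indicator {0..T} s *\<^sub>R (\<integral>x. b x *\<^sub>R V s w x \<partial>torus))"
      unfolding Y_def ext_pairing_def[OF filtration predictable b B] ..
    have Ysn: "(\<lambda>s. indicator {0..T} s *\<^sub>R (\<integral>x. b x *\<^sub>R Vn n s w x \<partial>torus)) \<in> borel_measurable borel" for n
      using ext_pairing_section[OF filtration_n predictable_n b B T0 w] unfolding Yne[symmetric] Yn_def .
    have Ys: "(\<lambda>s. indicator {0..T} s *\<^sub>R (\<integral>x. b x *\<^sub>R V s w x \<partial>torus)) \<in> borel_measurable borel"
      using ext_pairing_section[OF filtration predictable b B T0 w] unfolding Ye[symmetric] Y_def .
    have VnL: "Vn n s w \<in> Lp_space 1 torus" if "s \<in> {0..T}" for n s by (rule L1n[OF that w])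
    have VL: "V s w \<in> Lp_space 1 torus" if "s \<in> {0..T}" for s by (rule L1[OF that w])
    \<comment> \<open>A trivial test function, to obtain the integrability part of
      \<open>space_time_pairing\<close>.\<close>
    have zero: "(\<lambda>s. 0) \<in> borel_measurable borel" "norm (0 :: real ^ 'k ^ 'm) \<le> 0" by auto
    have "(\<lambda>n. \<integral>s. g s \<bullet> Yn n s w \<partial>lborel) \<longlonglongrightarrow> (\<integral>s. g s \<bullet> Y s w \<partial>lborel)"
      if g: "g \<in> borel_measurable borel" and G: "\<And>s. norm (g s) \<le> G" for g G
    proof -
      let ?\<Lambda> = "\<lambda>f. \<integral>z. b (snd z) * (g (fst z) \<bullet> f z) \<partial>(lborel_on {0..T} \<Otimes>\<^sub>M torus)"
      have "(\<integral>s. g s \<bullet> Yn n s w \<partial>lborel) = ?\<Lambda> (vn n)" for n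
        unfolding fun_cong[OF Yne]
        by (rule space_time_pairing(2)[OF b B r(1) vnL vn[rule_format] _ Ysn g G]) (rule VnL)
      moreover have "(\<integral>s. g s \<bullet> Y s w \<partial>lborel) = ?\<Lambda> v"
        unfolding fun_cong[OF Ye]
        by (rule space_time_pairing(2)[OF b B r(1) vL v _ Ys g G]) (rule VL)
      moreover have "(\<lambda>n. ?\<Lambda> (vn n)) \<longlonglongrightarrow> ?\<Lambda> v"
      proof -
        have "\<forall>\<Lambda>\<in>Lp_dual r (lborel_on {0..T} \<Otimes>\<^sub>M torus). (\<lambda>n. \<Lambda> (vn n)) \<longlonglongrightarrow> \<Lambda> v"
          using wk unfolding Lp_weak_tendsto_def by simp
        from bspec[OF this pairing_Lp_dual[OF b B r(1) g G]] show ?thesis .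
      qed
      ultimately show ?thesis by (simp only:)
    qed
    moreover have "integrable lborel (\<lambda>s. Yn n s w)" for n
      unfolding Yne
      by (rule space_time_pairing(1)[OF b B r(1) vnL vn[rule_format] _ Ysn zero]) (rule VnL)
    moreover have "integrable lborel (\<lambda>s. Y s w)"
      unfolding Ye
      by (rule space_time_pairing(1)[OF b B r(1) vL v _ Ys zero]) (rule VL)
    ultimately show ?case by blast
  qed
  \<comment> \<open>Both bounds hold for the limit path by path up to a lower limit in
    \<open>n\<close>; Fatou over the outcomes then carries over the uniform bounds.\<close>
  have mp: "moment_process M T p C \<kappa> Y"
  proof (intro moment_process.intro moment_process_axioms.intro M p Y_m Y_0 C)
    note [measurable] = Yn_m
    show "(\<integral>\<^sup>+w. (\<integral>\<^sup>+s. ennreal (norm (Y s w) powr p) \<partial>lborel) \<partial>M) \<le> C"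
    proof (rule nn_integral_le_of_liminf)
      show "(\<lambda>w. \<integral>\<^sup>+s. ennreal (2 powr p * norm (Yn n s w) powr p) \<partial>lborel) \<in> borel_measurable M" for n by measurable
      show "AE w in M. (\<integral>\<^sup>+s. ennreal (norm (Y s w) powr p) \<partial>lborel) \<le> liminf (\<lambda>n. \<integral>\<^sup>+s. ennreal (2 powr p * norm (Yn n s w) powr p) \<partial>lborel)"
        using lim
      proof eventually_elim
        case (elim w)
        show ?case using elim p by (intro weak_lsc_moment) auto
      qed
      fix n
      have "(\<integral>\<^sup>+w. (\<integral>\<^sup>+s. ennreal (2 powr p * norm (Yn n s w) powr p) \<partial>lborel) \<partial>M) =
          (\<integral>\<^sup>+w. (\<integral>\<^sup>+s. ennreal (2 powr p) * ennreal (norm (Yn n s w) powr p) \<partial>lborel) \<partial>M)"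
        by (simp add: ennreal_mult')
      also have "\<dots> = ennreal (2 powr p) * (\<integral>\<^sup>+w. (\<integral>\<^sup>+s. ennreal (norm (Yn n s w) powr p) \<partial>lborel) \<partial>M)"
        by (rule moment_process.iterated_cmult[OF mp_n[of n]]) measurable
      also have "\<dots> \<le> C" unfolding C_def by (intro mult_left_mono mom) simp
      finally show "(\<integral>\<^sup>+w. (\<integral>\<^sup>+s. ennreal (2 powr p * norm (Yn n s w) powr p) \<partial>lborel) \<partial>M) \<le> C" .
    qed
    fix v :: real assume v: "v > 0"
    show "(\<integral>\<^sup>+w. (\<integral>\<^sup>+s. indicator {v..T} s * ennreal (norm (Y s w - Y (s - v) w)) \<partial>lborel) \<partial>M) \<le> \<kappa> v"
    proof (rule nn_integral_le_of_liminf[OF _ _ trans[OF v]])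
      show "(\<lambda>w. \<integral>\<^sup>+s. indicator {v..T} s * ennreal (norm (Yn n s w - Yn n (s - v) w)) \<partial>lborel) \<in> borel_measurable M" for n by measurable
      show "AE w in M. (\<integral>\<^sup>+s. indicator {v..T} s * ennreal (norm (Y s w - Y (s - v) w)) \<partial>lborel) \<le>
          liminf (\<lambda>n. \<integral>\<^sup>+s. indicator {v..T} s * ennreal (norm (Yn n s w - Yn n (s - v) w)) \<partial>lborel)"
        using lim
      proof eventually_elim
        case (elim w)
        show ?case using elim by (intro weak_lsc_translation) auto
      qed
    qed
  qed
  have wsn: "wiener_space M T (Fn n) (Wn n)" for n
    by (intro wiener_space.intro wiener_space_axioms.intro M filtration_n wiener_n)
  have ws: "wiener_space M T F W"
    by (intro wiener_space.intro wiener_space_axioms.intro M filtration wiener)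
  have W_lim: "AE w in M. \<forall>s\<in>{0..T}. (\<lambda>n. Wn n s w) \<longlonglongrightarrow> W s w"
    using uniform by eventually_elim (auto intro: tendsto_uniform_limitI)
  show ?thesis
  proof
    fix t assume "t \<in> {0..T}"
    then have t: "0 \<le> t" "t \<le> T" by auto
    let ?Q = "lborel_on {0..t} \<Otimes>\<^sub>M M"
    have Qn: "f (fst x) (snd x) - (\<integral>z. \<beta> z *\<^sub>R Vn n (fst x) (snd x) z \<partial>torus) = f (fst x) (snd x) - Yn n (fst x) (snd x)" if "x \<in> space ?Q" for x n f
      using that t XYn by (auto simp: space_pair_measure space_restrict_space)
    have Q: "f (fst x) (snd x) - (\<integral>z. \<beta> z *\<^sub>R V (fst x) (snd x) z \<partial>torus) = f (fst x) (snd x) - Y (fst x) (snd x)" if "x \<in> space ?Q" for x f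
      using that t XY by (auto simp: space_pair_measure space_restrict_space)
    \<comment> \<open>Up to time \<open>t\<close> the integrands of the statement coincide with the
      processes \<open>Yn n\<close>, to which the error estimates refer.\<close>
    have sqn: "sqnorm ?Q (\<lambda>(s, w). f s w - (\<integral>z. \<beta> z *\<^sub>R Vn n s w z \<partial>torus)) = sqnorm ?Q (\<lambda>(s, w). f s w - Yn n s w)" for f n
      unfolding case_prod_beta' by (intro sqnorm_cong Qn)
    have sq: "sqnorm ?Q (\<lambda>(s, w). f s w - (\<integral>z. \<beta> z *\<^sub>R V s w z \<partial>torus)) = sqnorm ?Q (\<lambda>(s, w). f s w - Y s w)" for f
      unfolding case_prod_beta' by (intro sqnorm_cong Q)
    have cong: "f \<in> Lp_space 2 ?Q" if g: "g \<in> Lp_space 2 ?Q" and eq: "\<And>x. x \<in> space ?Q \<Longrightarrow> f x = g x"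
      for f g :: "real \<times> 'a \<Rightarrow> real ^ 'k ^ 'm"
      using g measurable_cong[of ?Q f g borel] sqnorm_cong[of ?Q f g] eq by (simp add: Lp_space_2_iff)
    show "Lp_tendsto 2 M (\<lambda>n. ito_integral M (Fn n) (Wn n) (\<lambda>s \<omega>. \<integral>x. \<beta> x *\<^sub>R Vn n s \<omega> x \<partial>torus) t)
        (ito_integral M F W (\<lambda>s \<omega>. \<integral>x. \<beta> x *\<^sub>R V s \<omega> x \<partial>torus) t)"
    proof (rule ito_integral_tendsto[OF wsn ws t(2)])
      show "(\<lambda>(s, w). \<integral>x. \<beta> x *\<^sub>R Vn n s w x \<partial>torus) \<in> Lp_space 2 ?Q" for n
        by (rule cong[OF moment_process.Y_L2[OF mp_n[of n] t(2)]])
          (use XYn t in \<open>auto simp: space_pair_measure space_restrict_space\<close>)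
      show "(\<lambda>(s, w). \<integral>x. \<beta> x *\<^sub>R V s w x \<partial>torus) \<in> Lp_space 2 ?Q"
        by (rule cong[OF moment_process.Y_L2[OF mp t(2)]])
          (use XY t in \<open>auto simp: space_pair_measure space_restrict_space\<close>)
      fix e :: real assume e: "e > 0"
      show "\<exists>N \<tau> \<xi>n \<xi>. (\<forall>n. elementary_process M (Fn n) t N \<tau> (\<xi>n n)) \<and> elementary_process M F t N \<tau> \<xi> \<and>
        (\<forall>n. sqnorm ?Q (\<lambda>(s, w). elementary_value N \<tau> (\<xi>n n) s w - (\<integral>x. \<beta> x *\<^sub>R Vn n s w x \<partial>torus)) \<le> ennreal e) \<and>
        sqnorm ?Q (\<lambda>(s, w). elementary_value N \<tau> \<xi> s w - (\<integral>x. \<beta> x *\<^sub>R V s w x \<partial>torus)) \<le> ennreal e \<and>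
        (\<lambda>n. sqnorm M (\<lambda>w. elementary_integral (Wn n) N \<tau> (\<xi>n n) w - elementary_integral W N \<tau> \<xi> w)) \<longlonglongrightarrow> 0"
      \<comment> \<open>At \<open>t = 0\<close> no positive step fits, so the empty grid is used;
        the error vanishes because the time interval is a single point.\<close>
      proof (cases "t = 0")
        case True
        have ev: "elementary_value 0 (\<lambda>_. 0) (\<lambda>_ _. 0) = (\<lambda>(s::real) (w::'a). 0 :: real ^ 'k ^ 'm)"
          by (simp add: elementary_value_def fun_eq_iff)
        have z: "sqnorm ?Q (\<lambda>(s, w). 0 - Z s w) = 0" if Z: "case_prod Z \<in> borel_measurable (lborel \<Otimes>\<^sub>M M)"
          for Z :: "real \<Rightarrow> 'a \<Rightarrow> real ^ 'k ^ 'm"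
        proof -
          have [measurable]: "case_prod (\<lambda>s w. 0 - Z s w) \<in> borel_measurable (lborel \<Otimes>\<^sub>M M)" using Z by measurable
          have "sqnorm ?Q (\<lambda>(s, w). 0 - Z s w) = (\<integral>\<^sup>+w. (\<integral>\<^sup>+s. indicator {0..t} s * ennreal ((norm (0 - Z s w))\<^sup>2) \<partial>lborel) \<partial>M)"
            by (rule sqnorm_lborel_on) measurable
          also have "\<dots> = (\<integral>\<^sup>+w. (\<integral>\<^sup>+s. 0 \<partial>(lborel :: real measure)) \<partial>M)"
          proof (rule nn_integral_cong, rule nn_integral_cong_AE)
            fix w
            show "AE s in lborel. indicator {0..t} s * ennreal ((norm (0 - Z s w))\<^sup>2) = 0"
              using AE_lborel_singleton[of "0::real"] by eventually_elim (simp add: True)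
          qed
          finally show ?thesis by simp
        qed
        have ep: "elementary_process M G t 0 (\<lambda>_. 0) (\<lambda>_ _. 0 :: real ^ 'k ^ 'm)" for G
          using t by (simp add: elementary_process_def)
        show ?thesis
          by (rule exI[of _ 0], rule exI[of _ "\<lambda>_. 0"], rule exI[of _ "\<lambda>_ _ _. 0"], rule exI[of _ "\<lambda>_ _. 0"])
            (simp only: sqn sq ev z[OF Yn_m] z[OF Y_m] ep, simp add: elementary_integral_def sqnorm_def)
      next
        case False
        then have "t > 0" using t by simp
        \<comment> \<open>The parameters depend only on \<open>C\<close> and
          \<open>\<kappa>\<close>, so one grid and one truncation level work for all
          \<open>n\<close> and for the limit.\<close>
        from ex_truncation_parameters[OF e this p C translation[folded \<kappa>_def]]
        obtain R h :: real and N :: nat and e' :: ennreal where R: "R > 0" and h: "h > 0" and Nh: "real N * h = t"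
          and \<kappa>e: "\<And>v. 0 < v \<Longrightarrow> v \<le> 2 * h \<Longrightarrow> \<kappa> v \<le> e'"
          and le: "ennreal (R\<^sup>2 * h) + ennreal (4 * R powr (2 - p)) * C + ennreal (2 * R) * (2 * e') \<le> ennreal e" by blast
        have NhT: "real N * h \<le> T" using Nh t by simp
        let ?\<tau> = "\<lambda>i. real i * h"
        have en: "elementary_process M (Fn n) t N ?\<tau> (truncated_average h R (Yn n))" for n
          using truncated_average_elementary[OF filtration_n predictable_n b B h NhT R] unfolding Nh Yn_def .
        have ee: "elementary_process M F t N ?\<tau> (truncated_average h R Y)"
          using truncated_average_elementary[OF filtration predictable b B h NhT R] unfolding Nh Y_def .
        have vn: "sqnorm ?Q (\<lambda>(s, w). elementary_value N ?\<tau> (truncated_average h R (Yn n)) s w - Yn n s w) \<le> ennreal e" for n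
          using order_trans[OF moment_process.truncated_error[OF mp_n h NhT \<kappa>e R] le] unfolding Nh .
        have v: "sqnorm ?Q (\<lambda>(s, w). elementary_value N ?\<tau> (truncated_average h R Y) s w - Y s w) \<le> ennreal e"
          using order_trans[OF moment_process.truncated_error[OF mp h NhT \<kappa>e R] le] unfolding Nh .
        have conv: "(\<lambda>n. sqnorm M (\<lambda>w. elementary_integral (Wn n) N ?\<tau> (truncated_average h R (Yn n)) w -
            elementary_integral W N ?\<tau> (truncated_average h R Y) w)) \<longlonglongrightarrow> 0"
        proof (rule elementary_integral_tendsto[OF wsn ws en ee t(2) _ _ _ _ W_lim])
          show "AE w in M. \<forall>i<N. (\<lambda>n. truncated_average h R (Yn n) i w) \<longlonglongrightarrow> truncated_average h R Y i w"
            using lim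
          proof eventually_elim
            case (elim w)
            have "(\<lambda>n. average_before h (\<lambda>s. Yn n s w) i) \<longlonglongrightarrow> average_before h (\<lambda>s. Y s w) i" for i
              using elim by (intro weak_average_tendsto) auto
            then show ?case unfolding truncated_average_def using R by (auto intro!: closest_point_cball_tendsto)
          qed
        qed (use R in \<open>auto intro!: norm_truncated_average\<close>)
        show ?thesis
          unfolding sqn sq
          by (intro exI[of _ N] exI[of _ ?\<tau>] exI[of _ "\<lambda>n. truncated_average h R (Yn n)"] exI[of _ "truncated_average h R Y"]
              conjI allI en ee vn v conv)
      qed
    qed
  qed
qed

end
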